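(* Let $A\ge1$. Then for $B=B(A)$ sufficiently large, for every eigenvalue $\lambda_n\in\Lambda_{\mathrm{new}}\cap[1,x]$ outside an exceptional set of size $O(x/(\log x)^A)$ we have \[ \sum_{m:\,|m-n|\le\frac nx(\log x)^B}\frac{r(m)}{m-\lambda_n}=\begin{cases}\pi\log\lambda_n+O(1)&\text{in the weak coupling quantization},\\ \frac1\alpha+O(1)&\text{in the strong coupling quantization}.\end{cases} \]
   Context: For integers $m\ge0$, $r(m)=\#\{(a,b)\in\mathbb Z^2:a^2+b^2=m\}$. Point scatterer on $\mathbb T^2=\mathbb R^2/2\pi\mathbb Z^2$: in the weak coupling quantization a phase $\varphi\in(-\pi,\pi)$ is fixed and $\Lambda_{\mathrm{new}}$ is the set of real solutions $\lambda$ of $\sum_{m\ge1}r(m)\big(\frac{1}{m-\lambda}-\frac{m}{m^2+1}\big)=\tan(\varphi/2)\sum_{m\ge1}\frac{r(m)}{m^2+1}$; in the strong coupling quantization a real constant $\alpha$ is fixed and $\Lambda_{\mathrm{new}}$ is the set of $\lambda>0$ solving $\sum_{m:|m-\lambda|\le\lambda^{1/2}}r(m)\big(\frac{1}{m-\lambda}-\frac{m}{m^2+1}\big)=\frac1\alpha$. The new eigenvalues interlace with the integers which are sums of two squares; for such an integer $n$, with $n^+$ the smallest integer $>n$ that is a sum of two squares, $\lambda_n$ denotes the new eigenvalue in $(n,n^+)$. *)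

theory Defs
  imports "HOL-Analysis.Analysis"
begin

definition r2 :: "nat \<Rightarrow> nat" where
  "r2 m = card {p :: int \<times> int. (fst p)\<^sup>2 + (snd p)\<^sup>2 = int m}"

text \<open>Integers which are sums of two squares (as reals): the poles / old spectrum.\<close>
definition sos_reals :: "real set" where
  "sos_reals = {real m | m. r2 m > 0}"

definition Lambda_weak :: "real \<Rightarrow> real set" where
  "Lambda_weak \<phi> = {lam. lam \<notin> sos_reals \<and>
     (\<Sum>k. real (r2 (Suc k)) * (1 / (real (Suc k) - lam) - real (Suc k) / ((real (Suc k))\<^sup>2 + 1)))
       = tan (\<phi> / 2) * (\<Sum>k. real (r2 (Suc k)) / ((real (Suc k))\<^sup>2 + 1))}"

definition Lambda_strong :: "real \<Rightarrow> real set" where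
  "Lambda_strong \<alpha> = {lam. lam > 0 \<and> lam \<notin> sos_reals \<and>
     (\<Sum>m\<in>{m::nat. 1 \<le> m \<and> \<bar>real m - lam\<bar> \<le> sqrt lam}.
        real (r2 m) * (1 / (real m - lam) - real m / ((real m)\<^sup>2 + 1))) = 1 / \<alpha>}"

text \<open>For a new eigenvalue lambda > 0, the sum of two squares n with lambda in (n, n^+),
  i.e. the largest integer below lambda that is a sum of two squares.\<close>
definition below_sos :: "real \<Rightarrow> nat" where
  "below_sos lam = Max {m::nat. r2 m > 0 \<and> real m < lam}"

definition short_sum :: "real \<Rightarrow> real \<Rightarrow> real \<Rightarrow> real" where
  "short_sum B x lam = (let n = below_sos lam in
     (\<Sum>m\<in>{m::nat. \<bar>real m - real n\<bar> \<le> real n / x * (ln x) powr B}.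
        real (r2 m) / (real m - lam)))"

end

theory Submission
  imports Defs "HOL-Real_Asymp.Real_Asymp"
begin

text \<open>
  By Jacobi's theorem \<open>r(m) = 4 \<Sum>\<^bsub>d|m\<^esub> \<chi>(d)\<close>, and the hyperbola method expresses \<open>r\<close>, for \<open>m\<close> in a short
  block of integers up to \<open>x\<close>, through residue classes with moduli \<open>O(\<surd>x)\<close>. The odd sum
  \<open>\<Sum>\<^bsub>L<h\<le>\<surd>x\<^esub> (r(n+h) - r(n-h))/h\<close> has no zero frequency, so a dual large sieve bounds its mean
  square over \<open>n\<close> by a power of \<open>log x\<close> divided by \<open>L\<close>; with \<open>L\<close> a large power of \<open>log x\<close> it is
  bounded for all but \<open>O(x/(log x)\<^sup>A)\<close> integers \<open>n\<close>. For \<open>h > \<surd>x\<close> the error term \<open>O(\<surd>t)\<close> in the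
  circle problem suffices. Hence the sum over \<open>L < |m-n| \<le> n/2\<close> of \<open>r(m)/(m-\<lambda>\<^sub>n)\<close> is bounded unless
  \<open>n\<close> is exceptional or the gap after \<open>n\<close> is long, and the sum over \<open>|m-n| \<le> n/2\<close> is evaluated by the
  eigenvalue equation and the circle problem. The equation is strictly monotone between
  consecutive sums of two squares, so an exceptional \<open>n\<close> accounts for at most one eigenvalue.
\<close>

section \<open>Jacobi's two-square theorem\<close>

text \<open>The sieve is used at a loss. The fractions with denominator at most \<open>Q\<close>, of
  order sqrt x, are spaced by \<open>1 / Q^2\<close>, and the Fejer weight gives the factor
  \<open>M + Q^4 / M\<close> on a block of length \<open>M\<close>. Two cut-offs move with n: that
  of the hyperbola method and the inner one of the odd sum, which is proportional to n. So blocks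
  must be short: \<open>M\<close> is about \<open>x / K\<close> with \<open>K\<close> a power of log
  x. The factor is then of order \<open>x * K\<close>, which exceeds the block length by
  \<open>K^2\<close>. This is only a power of log x, and the factor \<open>1 / L\<close> in the mean
  square repays it.

  The exponents follow. Write \<open>l = ln x\<close> and \<open>Y = l ^ k\<close>, and let a
  proportion of order \<open>1 / Y\<close> of the integers be bad. The choice
  \<open>K = Y^2 * l^2\<close> controls the two drifting cut-offs, and \<open>Lam = l powr B\<close>
  with \<open>Lam >= K^2 * Y^2 * l^8\<close> controls the mean square. Since
  \<open>K^2 * Y^2 * l^8 = l ^ (6 * k + 12)\<close>, every \<open>B >= 6 * k + 12\<close> is
  admissible. The logarithms are not counted sharply.\<close>

definition chi :: "int \<Rightarrow> int" where
  "chi n = (if n mod 4 = 1 then 1 else if n mod 4 = 3 then -1 else 0)"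

lemma chi_0 [simp]: "chi 0 = 0"
  by (simp add: chi_def)

lemma chi_uminus: "chi (- n) = - chi n"
  unfolding chi_def by presburger

lemma chi_shift: "chi (n + 4 * k) = chi n"
  by (simp add: chi_def)

text \<open>The index set of Liouville's elementary method: for all \<open>k\<close> at once it
  lists the divisors \<open>d\<close> of \<open>n - k^2\<close> with their cofactors
  \<open>e\<close>, so that involutions can mix \<open>k\<close> with \<open>d\<close> and
  \<open>e\<close>.\<close>

definition liouville_triples :: "int \<Rightarrow> (int \<times> int \<times> int) set" where
  "liouville_triples n = {(k, d, e). d > 0 \<and> e > 0 \<and> k\<^sup>2 + d * e = n}"

lemma finite_int_square_le: "finite {k::int. k\<^sup>2 \<le> n}"
proof (rule finite_subset)
  show "{k::int. k\<^sup>2 \<le> n} \<subseteq> {-\<bar>n\<bar>..\<bar>n\<bar>}"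
  proof
    fix k :: int assume "k \<in> {k::int. k\<^sup>2 \<le> n}"
    then have "k\<^sup>2 \<le> n" by simp
    moreover have "\<bar>k\<bar> \<le> \<bar>k\<bar>\<^sup>2"
      using mult_left_mono [of 1 "\<bar>k\<bar>" "\<bar>k\<bar>"] by (cases "k = 0") (auto simp: power2_eq_square)
    ultimately have "\<bar>k\<bar> \<le> n" by simp
    then show "k \<in> {-\<bar>n\<bar>..\<bar>n\<bar>}" by auto
  qed
qed auto

lemma finite_liouville_triples: "finite (liouville_triples n)"
proof (rule finite_subset)
  show "liouville_triples n \<subseteq> {k. k\<^sup>2 \<le> n} \<times> {0..n} \<times> {0..n}"
  proof
    fix t assume "t \<in> liouville_triples n"
    then obtain k d e where t: "t = (k, d, e)" and *: "d > 0" "e > 0" "k\<^sup>2 + d * e = n"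
      by (auto simp: liouville_triples_def)
    have "k\<^sup>2 \<ge> 0" "d * e \<ge> d" "d * e \<ge> e" "d * e \<ge> 0" using * by (auto simp: mult_le_cancel_left1 mult_le_cancel_right1)
    then have "k\<^sup>2 \<le> n" "d \<le> n" "e \<le> n" using * by linarith+
    then show "t \<in> {k. k\<^sup>2 \<le> n} \<times> {0..n} \<times> {0..n}"
      using * t by simp
  qed
  show "finite ({k::int. k\<^sup>2 \<le> n} \<times> {0..n} \<times> {0..n})"
    using finite_int_square_le by blast
qed

text \<open>The swap \<open>(k, d, e) \<mapsto> (- k, e, d)\<close> exchanges the regions on the two
  sides of \<open>d = e + 2 * k\<close>, so the sum folds onto one of them and the diagonal.\<close>

lemma sum_liouville_triples_split:
  fixes F :: "int \<times> int \<times> int \<Rightarrow> int"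
  shows "sum F (liouville_triples n) =
    (\<Sum>(k, d, e) \<in> {(k, d, e) \<in> liouville_triples n. d < e + 2 * k}. F (k, d, e) + F (- k, e, d)) +
    sum F {(k, d, e) \<in> liouville_triples n. d = e + 2 * k}"
proof -
  let ?S = "liouville_triples n"
  let ?A = "{(k, d, e) \<in> ?S. d < e + 2 * k}"
  let ?B = "{(k, d, e) \<in> ?S. d = e + 2 * k}"
  let ?C = "{(k, d, e) \<in> ?S. d > e + 2 * k}"
  have fin: "finite ?A" "finite ?B" "finite ?C"
    by (rule finite_subset [OF _ finite_liouville_triples [of n]]; auto)+
  have S: "?S = (?A \<union> ?C) \<union> ?B" by auto
  have "sum F ?S = sum F ?A + sum F ?C + sum F ?B"
    by (subst S, subst sum.union_disjoint, use fin in \<open>force+\<close>, subst sum.union_disjoint, use fin in \<open>force+\<close>)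
  moreover have "sum F ?C = (\<Sum>(k, d, e) \<in> ?A. F (- k, e, d))"
    by (rule sum.reindex_bij_witness [of _ "\<lambda>(k, d, e). (- k, e, d)" "\<lambda>(k, d, e). (- k, e, d)"])
       (auto simp: liouville_triples_def mult.commute)
  ultimately show ?thesis by (simp add: sum.distrib case_prod_unfold)
qed

lemma sum_involution_zero:
  fixes F :: "'a \<Rightarrow> int"
  assumes "\<And>x. x \<in> A \<Longrightarrow> f x \<in> A" "\<And>x. x \<in> A \<Longrightarrow> f (f x) = x"
    and "\<And>x. x \<in> A \<Longrightarrow> F x + F (f x) = 0"
  shows "sum F A = 0"
proof -
  have "sum F A = (\<Sum>x\<in>A. F (f x))"
    by (rule sum.reindex_bij_witness [of _ f f]) (use assms in auto)
  then have "2 * sum F A = (\<Sum>x\<in>A. F x + F (f x))" by (simp add: sum.distrib)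
  also have "\<dots> = 0" using assms(3) by simp
  finally show ?thesis by simp
qed

lemma sum_chi_atMost: "(\<Sum>d = 1..j. chi (int d)) = (if j mod 4 \<in> {1, 2} then 1 else 0)"
proof (induction j)
  case (Suc j)
  have "int (Suc j) mod 4 = int (Suc j mod 4)" by (simp add: zmod_int)
  moreover have "j mod 4 = 0 \<or> j mod 4 = 1 \<or> j mod 4 = 2 \<or> j mod 4 = 3" by auto
  ultimately have "chi (int (Suc j)) = (if j mod 4 = 0 then 1 else if j mod 4 = 2 then -1 else 0)"
    by (auto simp: chi_def mod_Suc)
  then show ?case using Suc by (auto simp: mod_Suc)
qed auto

text \<open>The weight makes this the sum of the partial sums of \<open>chi\<close> up to
  \<open>2 * s - 1\<close>, of which half are 1 and half are 0. It evaluates the diagonal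
  contribution in \<open>liouville_identity\<close>.\<close>

lemma sum_weighted_chi: "(\<Sum>d = 1..2 * s. (2 * int s - int d) * chi (int d)) = int s"
proof (induction s)
  case (Suc s)
  have "(\<Sum>d = 1..2 * Suc s. (2 * int (Suc s) - int d) * chi (int d))
      = (\<Sum>d = 1..2 * s + 1. (2 * int (Suc s) - int d) * chi (int d))"
    by simp
  also have "\<dots> = (\<Sum>d = 1..2 * s + 1. (2 * int s - int d) * chi (int d)) + 2 * (\<Sum>d = 1..2 * s + 1. chi (int d))"
    by (simp add: sum_distrib_left algebra_simps flip: sum.distrib)
  also have "(\<Sum>d = 1..2 * s + 1. (2 * int s - int d) * chi (int d)) = int s - chi (2 * int s + 1)"
    using Suc by (simp add: add.commute)
  also have "2 * (\<Sum>d = 1..2 * s + 1. chi (int d)) = (if even s then 2 else 0)"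
  proof -
    have "(2 * s + 1) mod 4 = (if even s then 1 else 3)" by presburger
    then show ?thesis unfolding sum_chi_atMost by simp
  qed
  also have "chi (2 * int s + 1) = (if even s then 1 else -1)"
    proof -
    have "(2 * int s + 1) mod 4 = (if even s then 1 else 3)" by presburger
    then show ?thesis unfolding chi_def by simp
  qed
  finally show ?case by simp
qed auto

text \<open>On a triple the weight \<open>d * e - 2 * k^2\<close> is \<open>n - 3 * k^2\<close>,
  which makes this the recursion for the divisor sums. The map
  \<open>(k, d, e) \<mapsto> (d - k, d, e + 2 * k - d)\<close> is an involution of the folded region
  \<open>d < e + 2 * k\<close>: the new third entry is positive exactly there. Only the diagonal
  survives, and on it \<open>n = (k + e)^2\<close>.\<close>

lemma liouville_identity:
  assumes "n > 0"
  shows "(\<Sum>(k, d, e) \<in> liouville_triples n. (d * e - 2 * k\<^sup>2) * chi d) = (if \<exists>s. n = s\<^sup>2 then n else 0)"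
proof -
  let ?S = "liouville_triples n"
  let ?B = "{(k, d, e) \<in> ?S. d = e + 2 * k}"
  let ?A = "{(k, d, e) \<in> ?S. d < e + 2 * k}"
  define W where "W = (\<lambda>(k, d, e). 2 * (d * e - 2 * k\<^sup>2) * chi d)"
  define G where "G = (\<lambda>(k, d, e). 2 * k * chi e * (2 * d - e) - k * chi (e + 2 * k - d) * (d + e))"
  \<comment> \<open>\<open>G\<close> is odd in \<open>k\<close> and adds nothing to the sum; it is chosen so that the folded weight is
    antisymmetric under the involution \<open>(k, d, e) \<mapsto> (d - k, d, e + 2 * k - d)\<close>.\<close>
  define H where "H = (\<lambda>t. W t + G t)"
  have z: "chi (e - 2 * k - d) = chi (e + 2 * k - d)" for e k d
    using chi_shift [of "e - 2 * k - d" k] by (simp add: algebra_simps)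
  have "sum G ?S = 0"
    by (rule sum_involution_zero [of _ "\<lambda>(k, d, e). (- k, d, e)"])
       (auto simp: liouville_triples_def G_def z)
  then have "sum W ?S = sum H ?S" by (simp add: H_def sum.distrib)
  also have "\<dots> = (\<Sum>(k, d, e) \<in> ?A. H (k, d, e) + H (- k, e, d)) +
     sum H ?B"
    by (rule sum_liouville_triples_split)
  also have "(\<Sum>(k, d, e) \<in> ?A. H (k, d, e) + H (- k, e, d)) = 0"
  proof (rule sum_involution_zero [of _ "\<lambda>(k, d, e). (d - k, d, e + 2 * k - d)"], goal_cases)
    case (3 t)
    obtain k d e where t: "t = (k, d, e)" by (cases t)
    have "e + 2 * k - d + 2 * (d - k) - d = e" "d + 2 * (- (d - k)) - (e + 2 * k - d) = - e"
      "d + 2 * (- k) - e = - (e + 2 * k - d)" by simp_all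
    then show ?case
      unfolding t H_def W_def G_def prod.case
      by (simp only: chi_uminus) (simp add: power2_eq_square algebra_simps)
  qed (auto simp: liouville_triples_def power2_eq_square algebra_simps)
  also have "sum H ?B = 2 * (if \<exists>s. n = s\<^sup>2 then n else 0)"
  proof (cases "\<exists>s. n = s\<^sup>2")
    case False
    have "?B = {}"
    proof -
      have "False" if "k\<^sup>2 + (e + 2 * k) * e = n" for k e
      proof -
        have "n = (k + e)\<^sup>2" using that by (simp add: power2_eq_square algebra_simps)
        then show False using False by blast
      qed
      then show ?thesis by (auto simp: liouville_triples_def)
    qed
    then have "sum H ?B = 0" by (simp only: sum.empty)
    then show ?thesis using False by simp
  next
    case True
    then obtain s0 where "n = s0\<^sup>2" by blast
    then obtain s :: nat where s: "n = (int s)\<^sup>2" "s > 0"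
      using assms by (intro that [of "nat \<bar>s0\<bar>"]) auto
    let ?J = "{-int s<..<int s}"
    have sq: "k\<^sup>2 + (e + 2 * k) * e = n \<longleftrightarrow> k + e = s \<or> k + e = - s" for k e :: int
    proof -
      have "k\<^sup>2 + (e + 2 * k) * e = (k + e)\<^sup>2" by (simp add: power2_eq_square algebra_simps)
      then show ?thesis unfolding s by (simp add: power2_eq_iff)
    qed
    \<comment> \<open>The root \<open>k + e = - s\<close> is excluded by positivity: it would give
      \<open>d = k - s\<close> and \<open>e = - s - k\<close>, which cannot both be
      positive.\<close>
    have B: "(k, d, e) \<in> ?S \<and> d = e + 2 * k \<longleftrightarrow> k \<in> ?J \<and> d = s + k \<and> e = s - k" for k d e :: int
      using sq [of k e] by (auto simp: liouville_triples_def; linarith)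
    have "sum H ?B = (\<Sum>k\<in>?J. H (k, s + k, s - k))"
      by (rule sum.reindex_bij_witness [of _ "\<lambda>k. (k, int s + k, int s - k)" fst])
         (use B in auto)
    also have "\<dots> = (\<Sum>k\<in>?J. W (k, s + k, s - k)) + (\<Sum>k\<in>?J. G (k, s + k, s - k))"
      by (simp add: H_def sum.distrib)
    \<comment> \<open>Reflecting \<open>k\<close> turns \<open>chi (s - k)\<close> into
      \<open>chi (s + k)\<close>, the value that occurs in \<open>W\<close>; the other term of
      \<open>G\<close> has argument 0 on the diagonal.\<close>
    also have "(\<Sum>k\<in>?J. G (k, s + k, s - k)) = (\<Sum>k\<in>?J. G (- k, s - k, s + k))"
      by (rule sum.reindex_bij_witness [of _ uminus uminus]) auto
    also have "(\<Sum>k\<in>?J. W (k, s + k, s - k)) + (\<Sum>k\<in>?J. G (- k, s - k, s + k))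
        = (\<Sum>k\<in>?J. 2 * int s * ((int s - k) * chi (s + k)))"
      unfolding sum.distrib [symmetric]
    proof (intro sum.cong refl)
      fix k
      define c where "c = chi (int s + k)"
      have "int s + k + 2 * (- k) - (int s - k) = 0" by simp
      then show "W (k, s + k, s - k) + G (- k, s - k, s + k) = 2 * int s * ((int s - k) * chi (s + k))"
        unfolding W_def G_def prod.case c_def [symmetric] by (simp only: chi_0) (simp add: power2_eq_square algebra_simps)
    qed
    also have "\<dots> = (\<Sum>d\<in>{1..<2 * s}. 2 * int s * ((2 * int s - int d) * chi (int d)))"
      by (rule sum.reindex_bij_witness [of _ "\<lambda>d. int d - int s" "\<lambda>k. nat (k + int s)"]) (auto simp: add.commute)
    also have "\<dots> = 2 * int s * (\<Sum>d\<in>{1..2 * s}. (2 * int s - int d) * chi (int d))"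
    proof -
      have "{1..2 * s} = insert (2 * s) {1..<2 * s}" using s(2) by auto
      then show ?thesis by (simp add: sum_distrib_left)
    qed
    also have "\<dots> = 2 * n" by (simp only: sum_weighted_chi) (simp add: s(1) power2_eq_square)
    finally show ?thesis using True by simp
  qed
  finally have "sum W ?S = 2 * (if \<exists>s. n = s\<^sup>2 then n else 0)" by simp
  moreover have "sum W ?S = 2 * (\<Sum>(k, d, e) \<in> ?S. (d * e - 2 * k\<^sup>2) * chi d)"
    by (simp add: W_def sum_distrib_left case_prod_unfold algebra_simps)
  ultimately show ?thesis by simp
qed

section \<open>The theta recursion and the divisor sum formula\<close>

abbreviation (input) rr :: "nat \<Rightarrow> real" where
  "rr m \<equiv> real (r2 m)"

abbreviation (input) chr :: "nat \<Rightarrow> real" where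
  "chr d \<equiv> real_of_int (chi (int d))"

text \<open>The value at 0 is the constant term of the square of the theta series. It enters the
  recursion whenever \<open>n\<close> is a square.\<close>

definition div_sum :: "nat \<Rightarrow> int" where
  "div_sum m = (if m = 0 then 1 else 4 * (\<Sum>d | d dvd m. chi (int d)))"

text \<open>The recursion is the coefficient form of \<open>\<theta> f' = 2 f \<theta>'\<close>, which characterises \<open>f = \<theta>\<^sup>2\<close> up to
  a constant factor.\<close>
lemma square_recursion_unique:
  fixes f g :: "nat \<Rightarrow> int"
  assumes "f 0 = g 0"
    and f: "\<And>n. n > 0 \<Longrightarrow> (\<Sum>k | k\<^sup>2 \<le> int n. (int n - 3 * k\<^sup>2) * f (nat (int n - k\<^sup>2))) = 0"
    and g: "\<And>n. n > 0 \<Longrightarrow> (\<Sum>k | k\<^sup>2 \<le> int n. (int n - 3 * k\<^sup>2) * g (nat (int n - k\<^sup>2))) = 0"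
  shows "f n = g n"
proof (induction n rule: less_induct)
  case (less n)
  show ?case
  proof (cases "n = 0")
    case False
    define K where "K = {k::int. k\<^sup>2 \<le> int n}"
    have K: "finite K" "0 \<in> K" using finite_int_square_le by (auto simp: K_def)
    have eq: "f (nat (int n - k\<^sup>2)) = g (nat (int n - k\<^sup>2))" if "k \<in> K - {0}" for k
    proof -
      have "k\<^sup>2 > 0" using that by auto
      then have "nat (int n - k\<^sup>2) < n" using False by linarith
      then show ?thesis by (rule less)
    qed
    have *: "(\<Sum>k\<in>K. (int n - 3 * k\<^sup>2) * h (nat (int n - k\<^sup>2)))
      = int n * h n + (\<Sum>k\<in>K - {0}. (int n - 3 * k\<^sup>2) * h (nat (int n - k\<^sup>2)))" for h :: "nat \<Rightarrow> int"
      using sum.remove [OF K, of "\<lambda>k. (int n - 3 * k\<^sup>2) * h (nat (int n - k\<^sup>2))"] by simp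
    have "int n * f n + (\<Sum>k\<in>K - {0}. (int n - 3 * k\<^sup>2) * f (nat (int n - k\<^sup>2)))
      = int n * g n + (\<Sum>k\<in>K - {0}. (int n - 3 * k\<^sup>2) * g (nat (int n - k\<^sup>2)))"
      using f [of n] g [of n] * [of f] * [of g] False unfolding K_def by simp
    then have "int n * f n = int n * g n" using eq by simp
    then show ?thesis using False by simp
  qed (use assms(1) in simp)
qed

lemma finite_r2_set: "finite {p :: int \<times> int. (fst p)\<^sup>2 + (snd p)\<^sup>2 = n}"
proof (rule finite_subset)
  show "{p :: int \<times> int. (fst p)\<^sup>2 + (snd p)\<^sup>2 = n} \<subseteq> {k. k\<^sup>2 \<le> n} \<times> {k. k\<^sup>2 \<le> n}"
    by auto
  show "finite ({k::int. k\<^sup>2 \<le> n} \<times> {k::int. k\<^sup>2 \<le> n})"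
    using finite_int_square_le by blast
qed

text \<open>A term is a sum over points with \<open>k^2 + a^2 + b^2 = n\<close>, where
  \<open>n - 3 * k^2 = a^2 + b^2 - 2 * k^2\<close>. By the symmetry of the sphere the three squares
  have equal sums.\<close>

lemma r2_recursion:
  "(\<Sum>k | k\<^sup>2 \<le> int n. (int n - 3 * k\<^sup>2) * int (r2 (nat (int n - k\<^sup>2)))) = 0"
proof -
  define K where "K = {k::int. k\<^sup>2 \<le> int n}"
  have fK: "finite K" using finite_int_square_le by (simp add: K_def)
  define R where "R = (\<lambda>k. {p :: int \<times> int. (fst p)\<^sup>2 + (snd p)\<^sup>2 = int n - k\<^sup>2})"
  define T where "T = {(k, a, b). k\<^sup>2 + a\<^sup>2 + b\<^sup>2 = int n}"
  have "(\<Sum>k\<in>K. (int n - 3 * k\<^sup>2) * int (r2 (nat (int n - k\<^sup>2)))) = (\<Sum>k\<in>K. \<Sum>p\<in>R k. (int n - 3 * k\<^sup>2))"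
    by (rule sum.cong) (auto simp: K_def R_def r2_def)
  also have "\<dots> = (\<Sum>(k, p)\<in>Sigma K R. int n - 3 * k\<^sup>2)"
    by (rule sum.Sigma) (use fK in \<open>auto simp: R_def finite_r2_set\<close>)
  also have "Sigma K R = T"
  proof -
    have "a\<^sup>2 \<le> int n" if "a\<^sup>2 + b\<^sup>2 + c\<^sup>2 = int n" for a b c :: int
      using that zero_le_power2 [of b] zero_le_power2 [of c] by linarith
    then show ?thesis by (auto simp: T_def K_def R_def)
  qed
  also have "(\<Sum>(k, p)\<in>T. int n - 3 * k\<^sup>2) = (\<Sum>(k, a, b)\<in>T. k\<^sup>2 + a\<^sup>2 + b\<^sup>2 - 3 * k\<^sup>2)"
    by (rule sum.cong) (auto simp: T_def)
  also have "\<dots> = (\<Sum>(k, a, b)\<in>T. a\<^sup>2) + (\<Sum>(k, a, b)\<in>T. b\<^sup>2) - 2 * (\<Sum>(k, a, b)\<in>T. k\<^sup>2)"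
    by (simp add: case_prod_unfold sum_distrib_left flip: sum.distrib sum_subtractf)
  also have "(\<Sum>(k, a, b)\<in>T. a\<^sup>2) = (\<Sum>(k, a, b)\<in>T. k\<^sup>2)"
    by (rule sum.reindex_bij_witness [of _ "\<lambda>(k, a, b). (a, k, b)" "\<lambda>(k, a, b). (a, k, b)"])
       (auto simp: T_def algebra_simps)
  also have "(\<Sum>(k, a, b)\<in>T. b\<^sup>2) = (\<Sum>(k, a, b)\<in>T. k\<^sup>2)"
    by (rule sum.reindex_bij_witness [of _ "\<lambda>(k, a, b). (b, a, k)" "\<lambda>(k, a, b). (b, a, k)"])
       (auto simp: T_def algebra_simps)
  finally show ?thesis by (simp add: K_def case_prod_unfold)
qed

text \<open>The \<open>k\<close> with \<open>k^2 < n\<close> contribute four times the sum in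
  \<open>liouville_identity\<close>. If \<open>n\<close> is a square, the two \<open>k\<close> with
  \<open>k^2 = n\<close> contribute \<open>- 2 * n\<close> each through
  \<open>div_sum 0 = 1\<close>, and this cancels it.\<close>

lemma div_sum_recursion:
  assumes "n > 0"
  shows "(\<Sum>k | k\<^sup>2 \<le> int n. (int n - 3 * k\<^sup>2) * div_sum (nat (int n - k\<^sup>2))) = 0"
proof -
  let ?T = "liouville_triples (int n)"
  define q where "q \<longleftrightarrow> (\<exists>s. int n = s\<^sup>2)"
  define K where "K = {k::int. k\<^sup>2 \<le> int n}"
  define K' where "K' = {k::int. k\<^sup>2 < int n}"
  define K0 where "K0 = {k::int. k\<^sup>2 = int n}"
  define f where "f = (\<lambda>k::int. (int n - 3 * k\<^sup>2) * div_sum (nat (int n - k\<^sup>2)))"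
  define D where "D = (\<lambda>k::int. {d::nat. d dvd nat (int n - k\<^sup>2)})"
  have fin: "finite K" "finite K'" "finite K0"
    by (rule finite_subset [OF _ finite_int_square_le [of "int n"]]; auto simp: K_def K'_def K0_def)+
  have "K = K' \<union> K0" "K' \<inter> K0 = {}" by (auto simp: K_def K'_def K0_def)
  then have "sum f K = sum f K' + sum f K0"
    using fin by (simp add: sum.union_disjoint)
  moreover have "sum f K0 = (if q then - 4 * int n else 0)"
  proof (cases q)
    case True
    then obtain s where s: "int n = s\<^sup>2" unfolding q_def by blast
    then have "K0 = {s, - s}" "s \<noteq> 0" using assms by (auto simp: K0_def power2_eq_iff)
    then have "sum f K0 = f s + f (- s)" by simp
    also have "\<dots> = - 4 * int n" by (simp add: f_def div_sum_def s)
    finally show ?thesis using True by simp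
  next
    case False
    then have "K0 = {}" unfolding K0_def q_def by (metis (mono_tags, lifting) Collect_empty_eq)
    then show ?thesis using False by simp
  qed
  moreover have "sum f K' = 4 * (if q then int n else 0)"
  proof -
    have "sum f K' = (\<Sum>k\<in>K'. \<Sum>d\<in>D k. 4 * ((int n - 3 * k\<^sup>2) * chi (int d)))"
      by (rule sum.cong) (auto simp: K'_def f_def div_sum_def D_def sum_distrib_left mult_ac)
    also have "\<dots> = (\<Sum>(k, d)\<in>Sigma K' D. 4 * ((int n - 3 * k\<^sup>2) * chi (int d)))"
      by (rule sum.Sigma) (use fin in \<open>auto simp: K'_def D_def\<close>)
    also have "\<dots> = (\<Sum>(k, d, e)\<in>?T. 4 * ((d * e - 2 * k\<^sup>2) * chi d))"
    proof (rule sum.reindex_bij_witness [of _ "\<lambda>(k, d, e). (k, nat d)" "\<lambda>(k, d). (k, int d, (int n - k\<^sup>2) div int d)"])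
      fix p assume "p \<in> Sigma K' D"
      then obtain k d where p: "p = (k, d)" "k\<^sup>2 < int n" "d dvd nat (int n - k\<^sup>2)"
        by (auto simp: K'_def D_def)
      from p(3) obtain e where e: "nat (int n - k\<^sup>2) = d * e" by blast
      have "int n - k\<^sup>2 = int (nat (int n - k\<^sup>2))" using p(2) by simp
      then have "int n - k\<^sup>2 = int d * int e" unfolding e by simp
      then have e': "int n = k\<^sup>2 + int d * int e" by simp
      have de: "d > 0" "e > 0" using e p(2) by (auto intro!: gr0I)
      have q: "(int n - k\<^sup>2) div int d = int e" using e' de by simp
      show "(case case p of (k, d) \<Rightarrow> (k, int d, (int n - k\<^sup>2) div int d) of (k, d, e) \<Rightarrow> (k, nat d)) = p"
        by (simp add: p(1))
      show "(case p of (k, d) \<Rightarrow> (k, int d, (int n - k\<^sup>2) div int d)) \<in> ?T"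
        using de e' by (simp add: p(1) q liouville_triples_def del: of_nat_add of_nat_mult)
      have "int d * int e - 2 * k\<^sup>2 = int n - 3 * k\<^sup>2" using e' by linarith
      then show "(case case p of (k, d) \<Rightarrow> (k, int d, (int n - k\<^sup>2) div int d) of (k, d, e) \<Rightarrow> 4 * ((d * e - 2 * k\<^sup>2) * chi d))
          = (case p of (k, d) \<Rightarrow> 4 * ((int n - 3 * k\<^sup>2) * chi (int d)))"
        by (simp only: p(1) q prod.case)
    next
      fix t assume "t \<in> ?T"
      then obtain k d e where t: "t = (k, d, e)" "d > 0" "e > 0" "k\<^sup>2 + d * e = int n"
        by (auto simp: liouville_triples_def)
      have *: "int n - k\<^sup>2 = d * e" using t by simp
      have "nat (d * e) = nat d * nat e" "d * e > 0" using t by (simp_all add: nat_mult_distrib)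
      moreover from this have "k\<^sup>2 < int n" using * by linarith
      ultimately show "(case case t of (k, d, e) \<Rightarrow> (k, nat d) of (k, d) \<Rightarrow> (k, int d, (int n - k\<^sup>2) div int d)) = t"
        "(case t of (k, d, e) \<Rightarrow> (k, nat d)) \<in> Sigma K' D"
        using t(1-3) by (auto simp: K'_def D_def *)
    qed
    also have "\<dots> = 4 * (\<Sum>(k, d, e)\<in>?T. (d * e - 2 * k\<^sup>2) * chi d)"
      by (simp add: sum_distrib_left case_prod_unfold)
    also have "(\<Sum>(k, d, e)\<in>?T. (d * e - 2 * k\<^sup>2) * chi d)
        = (if q then int n else 0)"
      unfolding q_def by (rule liouville_identity) (use assms in simp)
    finally show ?thesis .
  qed
  ultimately have "sum f K = 0" by (cases q) simp_all
  then show ?thesis by (simp add: K_def f_def)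
qed

lemma r2_eq_divisor_sum:
  assumes "m > 0"
  shows "rr m = 4 * (\<Sum>d | d dvd m. chr d)"
proof -
  have "{p :: int \<times> int. (fst p)\<^sup>2 + (snd p)\<^sup>2 = 0} = {(0, 0)}" by auto
  then have "r2 0 = 1" by (simp add: r2_def)
  then have "int (r2 0) = div_sum 0" by (simp add: div_sum_def)
  then have "int (r2 m) = div_sum m"
    by (rule square_recursion_unique [of "\<lambda>m. int (r2 m)" div_sum, OF _ r2_recursion div_sum_recursion])
  also have "\<dots> = 4 * (\<Sum>d | d dvd m. chi (int d))" using assms by (simp add: div_sum_def)
  finally have "real_of_int (int (r2 m)) = real_of_int (4 * (\<Sum>d | d dvd m. chi (int d)))" by (rule arg_cong)
  then show ?thesis by simp
qed

section \<open>The circle problem\<close>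

text \<open>Dirichlet's test by partial summation. The induction removes the boundary term
  \<open>f t *\<^sub>R U t\<close>; what is left is at most \<open>P\<close> times the variation of
  \<open>f\<close>, which telescopes. The setting of normed spaces serves character sums and
  exponential sums alike.\<close>

lemma norm_sum_decreasing_le:
  fixes u :: "nat \<Rightarrow> 'a::real_normed_vector" and f :: "nat \<Rightarrow> real"
  assumes "a < b"
    and dec: "\<And>h. a < h \<Longrightarrow> h < b \<Longrightarrow> f (Suc h) \<le> f h"
    and nonneg: "f b \<ge> 0"
    and P: "\<And>t. a < t \<Longrightarrow> t \<le> b \<Longrightarrow> norm (\<Sum>h\<in>{a<..t}. u h) \<le> P"
  shows "norm (\<Sum>h\<in>{a<..b}. f h *\<^sub>R u h) \<le> P * f (Suc a)"
proof -
  define U where "U = (\<lambda>t. \<Sum>h\<in>{a<..t}. u h)"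
  have *: "norm ((\<Sum>h\<in>{a<..t}. f h *\<^sub>R u h) - f t *\<^sub>R U t) \<le> P * (f (Suc a) - f t)"
    if "Suc a \<le> t" "t \<le> b" for t
    using that
  proof (induction t rule: dec_induct)
    case base
    have "{a<..Suc a} = {Suc a}" by auto
    then show ?case by (simp add: U_def)
  next
    case (step t)
    have ins: "{a<..Suc t} = insert (Suc t) {a<..t}" using step by auto
    have "(\<Sum>h\<in>{a<..Suc t}. f h *\<^sub>R u h) - f (Suc t) *\<^sub>R U (Suc t)
        = ((\<Sum>h\<in>{a<..t}. f h *\<^sub>R u h) - f t *\<^sub>R U t) + (f t - f (Suc t)) *\<^sub>R U t"
      unfolding U_def ins by (simp add: algebra_simps)
    moreover have "norm ((f t - f (Suc t)) *\<^sub>R U t) \<le> (f t - f (Suc t)) * P"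
      using dec [of t] P [of t] step by (auto simp: U_def intro!: mult_left_mono)
    ultimately have "norm ((\<Sum>h\<in>{a<..Suc t}. f h *\<^sub>R u h) - f (Suc t) *\<^sub>R U (Suc t))
        \<le> P * (f (Suc a) - f t) + (f t - f (Suc t)) * P"
      using step by (smt (verit) Suc_leD norm_triangle_ineq)
    then show ?case by (simp add: algebra_simps)
  qed
  have "norm (\<Sum>h\<in>{a<..b}. f h *\<^sub>R u h)
      \<le> norm ((\<Sum>h\<in>{a<..b}. f h *\<^sub>R u h) - f b *\<^sub>R U b) + norm (f b *\<^sub>R U b)"
    by (metis diff_add_cancel norm_triangle_ineq)
  also have "\<dots> \<le> P * (f (Suc a) - f b) + f b * P"
    using * [of b] P [of b] assms(1) nonneg by (intro add_mono) (auto simp: U_def intro!: mult_left_mono)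
  finally show ?thesis by (simp add: algebra_simps)
qed

lemma abs_sum_chi_le: "\<bar>\<Sum>d\<in>{a<..b}. chr d\<bar> \<le> 1"
proof (cases "a \<le> b")
  case True
  have "{1..b} = {1..a} \<union> {a<..b}" "{1..a} \<inter> {a<..b} = {}" using True by auto
  then have "(\<Sum>d=1..b. chi (int d)) = (\<Sum>d=1..a. chi (int d)) + (\<Sum>d\<in>{a<..b}. chi (int d))"
    by (simp add: sum.union_disjoint)
  then have "\<bar>\<Sum>d\<in>{a<..b}. chi (int d)\<bar> \<le> 1"
    unfolding sum_chi_atMost by (auto split: if_splits)
  then show ?thesis by (simp flip: of_int_sum)
qed auto

text \<open>The tail is bounded by partial summation, since the sums of \<open>chi\<close> over
  intervals are at most 1 in size. The limit is taken along even cut-offs because the Leibniz series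
  runs over the odd integers below \<open>2 * N\<close>.\<close>

lemma leibniz_chi: "\<bar>(\<Sum>d=1..s. chi (int d) / real d) - pi / 4\<bar> \<le> 1 / (real s + 1)"
proof -
  define g where "g = (\<lambda>b. \<Sum>d=1..b. chi (int d) / real d)"
  have "(\<Sum>k<N. (-1) ^ k / real (k * 2 + 1)) = g (2 * N)" for N
  proof (induction N)
    case (Suc N)
    have "chi (int (2 * N + 1)) = (-1) ^ N" "chi (int (2 * N + 2)) = 0"
    proof -
      have "int (2 * N + 1) mod 4 = (if even N then 1 else 3)" by presburger
      then show "chi (int (2 * N + 1)) = (-1) ^ N" by (simp add: chi_def)
      have "int (2 * N + 2) mod 4 = (if even N then 2 else 0)" by presburger
      then show "chi (int (2 * N + 2)) = 0" by (simp add: chi_def)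
    qed
    then show ?case using Suc by (simp add: g_def mult.commute add.commute)
  qed (simp add: g_def)
  moreover have "(\<lambda>N. \<Sum>k<N. (-1) ^ k / real (k * 2 + 1)) \<longlonglongrightarrow> pi / 4"
  proof -
    have "summable (\<lambda>k. (-1) ^ k * 1 / real (k * 2 + 1))"
      using summable_arctan_series [of 1] by simp
    from summable_LIMSEQ [OF this] show ?thesis
      unfolding pi_series [symmetric] by simp
  qed
  ultimately have lim: "(\<lambda>N. g (2 * N)) \<longlonglongrightarrow> pi / 4" by simp
  have bd: "\<bar>g b - g s\<bar> \<le> 1 / (real s + 1)" if "b \<ge> s" for b
  proof (cases "b = s")
    case False
    then have sb: "s < b" using that by simp
    have "{1..b} = {1..s} \<union> {s<..b}" "{1..s} \<inter> {s<..b} = {}" using sb by auto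
    then have "g b - g s = (\<Sum>d\<in>{s<..b}. (1 / real d) *\<^sub>R chr d)"
      by (simp add: g_def sum.union_disjoint)
    moreover have "norm (\<Sum>d\<in>{s<..b}. (1 / real d) *\<^sub>R chr d) \<le> 1 * (1 / real (Suc s))"
      by (rule norm_sum_decreasing_le) (use sb abs_sum_chi_le in \<open>auto simp: frac_le\<close>)
    ultimately show ?thesis by (simp add: add.commute)
  qed auto
  have "(\<lambda>N. \<bar>g (2 * N) - g s\<bar>) \<longlonglongrightarrow> \<bar>pi / 4 - g s\<bar>"
    by (intro tendsto_intros lim)
  moreover have "\<forall>\<^sub>F N in sequentially. \<bar>g (2 * N) - g s\<bar> \<le> 1 / (real s + 1)"
    using bd by (intro eventually_sequentiallyI [of s]) auto
  ultimately have "\<bar>pi / 4 - g s\<bar> \<le> 1 / (real s + 1)"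
    by (intro tendsto_upperbound [where F = sequentially]) auto
  then show ?thesis by (simp add: g_def abs_minus_commute)
qed

text \<open>Lattice points other than the origin in the disc of area \<open>pi * t\<close>.\<close>

definition r2_sum :: "nat \<Rightarrow> real" where
  "r2_sum t = (\<Sum>m=1..t. rr m)"

lemma card_multiples_atMost: "d > 0 \<Longrightarrow> card {m \<in> {1..t}. d dvd m} = t div (d::nat)"
proof -
  assume d: "d > 0"
  have "{m \<in> {1..t}. d dvd m} = (\<lambda>k. d * k) ` {1..t div d}"
    using d by (auto simp: div_le_mono less_eq_div_iff_mult_less_eq mult.commute image_iff Bex_def dvd_def)
  then show ?thesis using d by (simp add: card_image inj_on_def)
qed

lemma r2_sum_eq: "r2_sum t = 4 * (\<Sum>d=1..t. chi (int d) * real (t div d))"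
proof -
  have "r2_sum t = (\<Sum>m=1..t. 4 * (\<Sum>d\<in>{1..t}. if d dvd m then chr d else 0))"
    unfolding r2_sum_def
  proof (intro sum.cong refl)
    fix m assume m: "m \<in> {1..t}"
    have "{d. d dvd m} = {d \<in> {1..t}. d dvd m}"
      
    proof (intro set_eqI iffI)
      fix d assume "d \<in> {d. d dvd m}"
      then have "d dvd m" by simp
      moreover from this have "d \<le> m" using m by (intro dvd_imp_le) auto
      moreover from \<open>d dvd m\<close> have "d > 0" using m by (intro dvd_pos_nat [of m d]) auto
      ultimately show "d \<in> {d \<in> {1..t}. d dvd m}" using m by simp
    qed simp
    then have "(\<Sum>d | d dvd m. chr d) = (\<Sum>d\<in>{d \<in> {1..t}. d dvd m}. chr d)"
      by simp
    also have "\<dots> = (\<Sum>d\<in>{1..t}. if d dvd m then chr d else 0)"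
      by (rule sum.inter_filter) simp
    finally show "rr m = 4 * (\<Sum>d\<in>{1..t}. if d dvd m then chr d else 0)"
      using m by (subst r2_eq_divisor_sum) simp_all
  qed
  also have "\<dots> = 4 * (\<Sum>d=1..t. \<Sum>m\<in>{1..t}. if d dvd m then chr d else 0)"
    by (subst sum.swap) (simp add: sum_distrib_left)
  also have "(\<Sum>d=1..t. \<Sum>m\<in>{1..t}. if d dvd m then chr d else 0)
      = (\<Sum>d=1..t. chi (int d) * real (t div d))"
  proof (intro sum.cong refl)
    fix d assume "d \<in> {1..t}"
    then have "card {m \<in> {1..t}. d dvd m} = t div d" by (intro card_multiples_atMost) auto
    moreover have "(\<Sum>m\<in>{1..t}. if d dvd m then chr d else 0)
        = (\<Sum>m\<in>{m \<in> {1..t}. d dvd m}. chr d)"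
      by (rule sum.inter_filter [symmetric]) simp
    ultimately show "(\<Sum>m\<in>{1..t}. if d dvd m then chr d else 0) = chi (int d) * real (t div d)"
      by simp
  qed
  finally show ?thesis .
qed

lemma abs_chi_le: "\<bar>real_of_int (chi n)\<bar> \<le> 1"
  by (simp add: chi_def)

lemma nat_div_real_bounds:
  fixes m n :: nat
  shows "real (m div n) \<le> real m / real n" "real m / real n < real (m div n) + 1"
proof -
  have "real (m div n) = of_int \<lfloor>real m / real n\<rfloor>" by (simp add: floor_divide_of_nat_eq)
  then show "real (m div n) \<le> real m / real n" "real m / real n < real (m div n) + 1" by linarith+
qed

lemma sqrt_of_nat_le: "sqrt (real n) \<le> real n"
proof (cases "n = 0")
  case False
  then have "real n \<le> (real n)\<^sup>2" by (intro self_le_power) auto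
  then show ?thesis by (intro real_le_lsqrt) auto
qed auto

text \<open>Divisors up to \<open>s\<close>, the integer part of sqrt t, lose at most 1 each when
  the floor is removed. Beyond \<open>s\<close> the quotients \<open>t div d\<close> decrease and
  the sums of \<open>chi\<close> are bounded. Replacing the partial Leibniz series by its limit
  costs \<open>t / (s + 1)\<close>. Each of the three errors is at most sqrt t, and the factor 4 of
  the divisor formula gives 12.\<close>

lemma circle_bound: "\<bar>r2_sum t - pi * real t\<bar> \<le> 12 * sqrt (real t)"
proof (cases "t = 0")
  case False
  define s where "s = nat \<lfloor>sqrt (real t)\<rfloor>"
  have "real s = of_int \<lfloor>sqrt (real t)\<rfloor>" by (simp add: s_def)
  then have s: "real s \<le> sqrt t" "sqrt t < real s + 1" by linarith+
  have "s \<ge> 1" using False by (simp add: s_def le_nat_floor)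
  have st: "s \<le> t"
  proof -
    have "real s \<le> real t" using s sqrt_of_nat_le [of t] by linarith
    then show ?thesis by simp
  qed
  have ts: "t / (real s + 1) \<le> sqrt t"
  proof -
    have "real t = sqrt t * sqrt t" by simp
    also have "\<dots> \<le> sqrt t * (real s + 1)" using s by (intro mult_left_mono) auto
    finally show ?thesis by (simp add: field_simps)
  qed
  have un: "{1..t} = {1..s} \<union> {s<..t}" "{1..s} \<inter> {s<..t} = {}" using st by auto
  have "(\<Sum>d=1..t. chi (int d) * real (t div d)) =
    (\<Sum>d=1..s. chi (int d) * real (t div d)) + (\<Sum>d\<in>{s<..t}. real (t div d) *\<^sub>R chr d)"
    unfolding un(1) using un(2) by (subst sum.union_disjoint) (auto simp: mult.commute)
  moreover have "\<bar>\<Sum>d\<in>{s<..t}. real (t div d) *\<^sub>R chr d\<bar> \<le> sqrt t"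
  proof (cases "s < t")
    case True
    have "norm (\<Sum>d\<in>{s<..t}. real (t div d) *\<^sub>R chr d) \<le> 1 * real (t div Suc s)"
      by (rule norm_sum_decreasing_le) (use True abs_sum_chi_le in \<open>auto simp: div_le_mono2\<close>)
    also have "\<dots> \<le> t / (real s + 1)"
      using nat_div_real_bounds(1) [of t "Suc s"] by (simp add: add.commute)
    finally show ?thesis using ts by simp
  qed auto
  moreover have "\<bar>(\<Sum>d=1..s. chi (int d) * real (t div d)) - t * (\<Sum>d=1..s. chi (int d) / real d)\<bar> \<le> real s"
  proof -
    have "(\<Sum>d=1..s. chi (int d) * real (t div d)) - t * (\<Sum>d=1..s. chi (int d) / real d)
        = (\<Sum>d=1..s. chi (int d) * (real (t div d) - t / d))"
      by (simp add: sum_distrib_left algebra_simps flip: sum_subtractf)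
    also have "\<bar>\<dots>\<bar> \<le> (\<Sum>d=1..s. 1)"
    proof (rule order_trans [OF sum_abs], rule sum_mono)
      fix d assume "d \<in> {1..s}"
      have "\<bar>real (t div d) - t / d\<bar> \<le> 1"
        using nat_div_real_bounds [of t d] by linarith
      then show "\<bar>chi (int d) * (real (t div d) - t / d)\<bar> \<le> 1"
        using abs_chi_le [of "int d"] by (simp add: abs_mult mult_le_one)
    qed
    finally show ?thesis by simp
  qed
  moreover have "\<bar>t * (\<Sum>d=1..s. chi (int d) / real d) - t * (pi / 4)\<bar> \<le> sqrt t"
  proof -
    have "\<bar>t * (\<Sum>d=1..s. chi (int d) / real d) - t * (pi / 4)\<bar> = t * \<bar>(\<Sum>d=1..s. chi (int d) / real d) - pi / 4\<bar>"
      unfolding right_diff_distrib [symmetric] abs_mult by simp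
    also have "\<dots> \<le> t * (1 / (real s + 1))" by (intro mult_left_mono leibniz_chi) auto
    finally show ?thesis using ts by simp
  qed
  ultimately show ?thesis unfolding r2_sum_eq using s by (simp add: algebra_simps)
qed (simp add: r2_sum_def)

section \<open>Averages of r derived from the circle problem\<close>

lemma r2_sum_le: "r2_sum t \<le> 16 * real t"
proof (cases "t = 0")
  case False
  have "pi * real t \<le> 4 * real t" using pi_less_4 by (intro mult_right_mono) auto
  then show ?thesis using circle_bound [of t] sqrt_of_nat_le [of t] by linarith
qed (simp add: r2_sum_def)

lemma r2_sum_Suc: "r2_sum (Suc t) = r2_sum t + rr (Suc t)"
  by (simp add: r2_sum_def)

lemma r2_sum_interval: "a \<le> b \<Longrightarrow> (\<Sum>m\<in>{a<..b}. rr m) = r2_sum b - r2_sum a"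
proof -
  assume "a \<le> b"
  then have "{1..b} = {1..a} \<union> {a<..b}" "{1..a} \<inter> {a<..b} = {}" by auto
  then show ?thesis by (simp add: r2_sum_def sum.union_disjoint)
qed

lemma r2_square_tail: "u \<ge> 1 \<Longrightarrow> (\<Sum>m\<in>{u<..v}. rr m / (real m)\<^sup>2) \<le> 32 / real u"
proof -
  assume u: "u \<ge> 1"
  \<comment> \<open>The boundary term of partial summation is part of the claim. At the end it is at
    most \<open>16 / v\<close>, and \<open>- 32 / v\<close> absorbs it.\<close>
  have *: "(\<Sum>m\<in>{u<..v}. rr m / (real m)\<^sup>2) \<le> r2_sum v / (real v)\<^sup>2 + 32 * (1 / real u - 1 / real v)"
    if "v \<ge> u" for v
    using that
  proof (induction v rule: dec_induct)
    case base
    then show ?case by (simp add: r2_sum_def sum_nonneg)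
  next
    case (step v)
    have ins: "{u<..Suc v} = insert (Suc v) {u<..v}" using step by auto
    have v: "real v \<ge> 1" using step u by simp
    have "r2_sum v / (real v)\<^sup>2 - r2_sum v / (real v + 1)\<^sup>2 = r2_sum v * ((2 * real v + 1) / ((real v)\<^sup>2 * (real v + 1)\<^sup>2))"
      using v by (simp add: divide_simps) (simp add: power2_eq_square algebra_simps)
    also have "\<dots> \<le> (16 * real v) * ((2 * real v + 1) / ((real v)\<^sup>2 * (real v + 1)\<^sup>2))"
      using v by (intro mult_right_mono r2_sum_le) auto
    also have "\<dots> \<le> 32 * (1 / real v - 1 / (real v + 1))"
      using v by (simp add: divide_simps) (simp add: power2_eq_square algebra_simps)
    finally show ?case using step.IH unfolding ins
      by (simp add: r2_sum_Suc add_divide_distrib algebra_simps)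
  qed
  show "(\<Sum>m\<in>{u<..v}. rr m / (real m)\<^sup>2) \<le> 32 / real u"
  proof (cases "v \<ge> u")
    case True
    then have v: "real v \<ge> 1" using u by simp
    have "r2_sum v / (real v)\<^sup>2 \<le> 16 * real v / (real v)\<^sup>2" by (intro divide_right_mono r2_sum_le) auto
    also have "\<dots> = 16 / real v" using v by (simp add: power2_eq_square)
    also have "\<dots> \<le> 32 * (1 / real v)" using v by (simp add: field_simps)
    finally show ?thesis using * [OF True] by simp
  qed auto
qed

lemma harm_bounds: "n \<ge> 1 \<Longrightarrow> \<bar>(\<Sum>m=1..n. 1 / real m) - ln (real n)\<bar> \<le> 1"
  using euler_mascheroni_sequence_nonneg [of n] euler_mascheroni_sequence_decreasing [of 1 n]
  by (simp add: harm_def inverse_eq_divide)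

text \<open>Partial summation against the circle error \<open>D\<close>. The increment
  \<open>D n / (n * (n + 1))\<close> is of order \<open>n powr (-3/2)\<close>, hence dominated by a
  difference of reciprocal square roots, which telescopes.\<close>

lemma r2_harmonic_sum:
  assumes "n \<ge> 1"
  shows "\<bar>(\<Sum>m=1..n. rr m / real m) - pi * ln (real n)\<bar> \<le> 40"
proof -
  define D where "D = (\<lambda>t. r2_sum t - pi * real t)"
  define E where "E = (\<lambda>t. \<Sum>m=1..t. (rr m - pi) / real m)"
  have "\<bar>E n - D n / n\<bar> \<le> 24 * (1 - 1 / sqrt n)"
    using assms
  proof (induction n rule: dec_induct)
    case base
    then show ?case by (simp add: E_def D_def r2_sum_def)
  next
    case (step n)
    define a where "a = sqrt n"
    define b where "b = sqrt (real n + 1)"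
    have a: "a \<ge> 1" "a\<^sup>2 = n" "b\<^sup>2 = real n + 1" "b \<ge> a" using step by (auto simp: a_def b_def)
    have "E (Suc n) - D (Suc n) / Suc n = (E n - D n / n) + D n / (real n * (real n + 1))"
    proof -
      define q where "q = rr (Suc n) - pi"
      have "E (Suc n) = E n + q / (real n + 1)" by (simp add: E_def q_def add.commute)
      moreover have "D (Suc n) = D n + q" by (simp add: D_def r2_sum_Suc q_def algebra_simps)
      moreover have "D n / (real n + 1) = D n / real n - D n / (real n * (real n + 1))"
        using step by (simp add: divide_simps) (simp add: algebra_simps)
      ultimately show ?thesis by (simp add: add_divide_distrib add.commute)
    qed
    moreover have "\<bar>D n / (real n * (real n + 1))\<bar> \<le> 24 * (1 / a - 1 / b)"
    proof -
      have "\<bar>D n / (real n * (real n + 1))\<bar> = \<bar>D n\<bar> / (a\<^sup>2 * b\<^sup>2)" using a by (simp add: abs_mult)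
      also have "\<dots> \<le> 12 * a / (a\<^sup>2 * b\<^sup>2)" 
        using circle_bound [of n] by (intro divide_right_mono) (auto simp: D_def a_def)
      also have "\<dots> = 12 / (a * b\<^sup>2)" using a(1) by (simp add: divide_simps) (simp add: power2_eq_square)
      also have "\<dots> \<le> 24 * (1 / a - 1 / b)"
      proof -
        have "(b - a) * (b + a) = 1" using a by (simp add: power2_eq_square algebra_simps)
        moreover have "(b - a) * (b + a) \<le> (b - a) * (2 * b)" using a by (intro mult_left_mono) auto
        ultimately have "1 \<le> 2 * b * (b - a)" by (simp add: algebra_simps)
        then have "12 * 1 / (a * b\<^sup>2) \<le> 12 * (2 * b * (b - a)) / (a * b\<^sup>2)"
          using a(1,4) by (intro divide_right_mono mult_left_mono) auto
        also have "\<dots> = 24 * (1 / a - 1 / b)"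
          using a(1,4) by (simp add: field_simps power2_eq_square)
        finally show ?thesis by simp
      qed
      finally show ?thesis .
    qed
    moreover have "\<bar>X\<bar> \<le> 24 * (1 - q)" if "X = x + y" "\<bar>y\<bar> \<le> 24 * (p - q)" "\<bar>x\<bar> \<le> 24 * (1 - p)" for X x y p q :: real
      using that by argo
    moreover have "1 / sqrt (real (Suc n)) = 1 / b" by (simp add: b_def add.commute)
    ultimately show ?case using step.IH unfolding a_def [symmetric] by metis
  qed
  moreover have "\<bar>D n / n\<bar> \<le> 12 * (1 / sqrt n)"
  proof -
    have "\<bar>D n / n\<bar> \<le> 12 * sqrt n / n" using circle_bound [of n] by (simp add: D_def divide_right_mono)
    also have "\<dots> = 12 * (1 / sqrt n)" using sqrt_divide_self_eq [of "real n"] by (simp add: inverse_eq_divide)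
    finally show ?thesis .
  qed
  moreover have "1 / sqrt n \<ge> 0" by simp
  ultimately have "\<bar>E n\<bar> \<le> 24" by argo
  moreover have "E n = (\<Sum>m=1..n. rr m / real m) - pi * (\<Sum>m=1..n. 1 / real m)"
    by (simp add: E_def diff_divide_distrib sum_subtractf sum_distrib_left)
  moreover have "\<bar>pi * (\<Sum>m=1..n. 1 / real m) - pi * ln n\<bar> \<le> 4"
  proof -
    have "\<bar>pi * (\<Sum>m=1..n. 1 / real m) - pi * ln n\<bar> = pi * \<bar>(\<Sum>m=1..n. 1 / real m) - ln n\<bar>"
      by (simp add: abs_mult flip: right_diff_distrib)
    also have "\<dots> \<le> pi * 1" by (intro mult_left_mono harm_bounds assms) auto
    finally show ?thesis using pi_less_4 by simp
  qed
  ultimately show ?thesis by argo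
qed

text \<open>In the partial sums over \<open>h\<close> the main terms on the two sides of
  \<open>n\<close> cancel. There remain four circle errors at arguments up to \<open>2 * n\<close>,
  each at most \<open>18 * sqrt n\<close>; partial summation with weight \<open>1 / h\<close> then
  gains \<open>1 / (a + 1)\<close>.\<close>

lemma r2_symmetric_sum:
  assumes "b < n" "a \<le> b"
  shows "\<bar>\<Sum>h\<in>{a<..b}. (rr (n + h) - rr (n - h)) / real h\<bar> \<le> 72 * sqrt (real n) / (real a + 1)"
proof (cases "a < b")
  case True
  define u where "u = (\<lambda>h. rr (n + h) - rr (n - h))"
  have part: "\<bar>\<Sum>h\<in>{a<..t}. u h\<bar> \<le> 72 * sqrt n" if t: "a < t" "t \<le> b" for t
  proof -
    have "(\<Sum>h\<in>{a<..t}. rr (n + h)) = (\<Sum>m\<in>{n + a<..n + t}. rr m)"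
      by (rule sum.reindex_bij_witness [of _ "\<lambda>m. m - n" "\<lambda>h. n + h"]) auto
    also have "\<dots> = r2_sum (n + t) - r2_sum (n + a)" using t by (intro r2_sum_interval) auto
    finally have 1: "(\<Sum>h\<in>{a<..t}. rr (n + h)) = r2_sum (n + t) - r2_sum (n + a)" .
    have "(\<Sum>h\<in>{a<..t}. rr (n - h)) = (\<Sum>m\<in>{n - t - 1<..n - a - 1}. rr m)"
      by (rule sum.reindex_bij_witness [of _ "\<lambda>m. n - m" "\<lambda>h. n - h"]) (use t assms in auto)
    also have "\<dots> = r2_sum (n - a - 1) - r2_sum (n - t - 1)" using t by (intro r2_sum_interval) auto
    finally have 2: "(\<Sum>h\<in>{a<..t}. rr (n - h)) = r2_sum (n - a - 1) - r2_sum (n - t - 1)" .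
    have bd: "\<bar>r2_sum j - pi * real j\<bar> \<le> 18 * sqrt n" if "j \<le> 2 * n" for j
    proof -
      have "sqrt j \<le> sqrt (2 * n)" using that by simp
      also have "\<dots> \<le> 1.5 * sqrt n" 
      proof -
        have "sqrt 2 \<le> 1.5" by (rule real_le_lsqrt) (auto simp: power2_eq_square)
        then show ?thesis unfolding of_nat_mult real_sqrt_mult by (intro mult_right_mono) auto
      qed
      finally show ?thesis using circle_bound [of j] by linarith
    qed
    have "pi * real (n - a - 1) = pi * n - pi * a - pi" "pi * real (n - t - 1) = pi * n - pi * t - pi"
      using t assms by (auto simp: of_nat_diff algebra_simps)
    moreover have "pi * real (n + a) = pi * n + pi * a" "pi * real (n + t) = pi * n + pi * t"
      by (auto simp: algebra_simps)
    moreover have "(\<Sum>h\<in>{a<..t}. u h) = r2_sum (n + t) - r2_sum (n + a) - (r2_sum (n - a - 1) - r2_sum (n - t - 1))"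
      by (simp add: u_def sum_subtractf 1 2)
    ultimately have eq: "(\<Sum>h\<in>{a<..t}. u h) = (r2_sum (n + t) - pi * real (n + t)) - (r2_sum (n + a) - pi * real (n + a))
      - ((r2_sum (n - a - 1) - pi * real (n - a - 1)) - (r2_sum (n - t - 1) - pi * real (n - t - 1)))"
      by simp
    have gen: "\<bar>w - x - (y - z)\<bar> \<le> 72 * B"
      if "\<bar>w\<bar> \<le> 18 * B" "\<bar>x\<bar> \<le> 18 * B" "\<bar>y\<bar> \<le> 18 * B" "\<bar>z\<bar> \<le> 18 * B" for w x y z B :: real
      using that by argo
    show ?thesis unfolding eq by (rule gen; rule bd; use t assms in simp)
  qed
  have "norm (\<Sum>h\<in>{a<..b}. (1 / real h) *\<^sub>R u h) \<le> 72 * sqrt n * (1 / real (Suc a))"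
    by (rule norm_sum_decreasing_le) (use True part in \<open>auto simp: frac_le\<close>)
  then show ?thesis by (simp add: u_def add.commute)
qed (use assms in auto)

section \<open>A dual large sieve\<close>

definition ee :: "real \<Rightarrow> complex" where
  "ee t = cis (2 * pi * t)"

lemma ee_add: "ee (a + b) = ee a * ee b"
  by (simp add: ee_def cis_mult ring_distribs)

lemma norm_ee [simp]: "norm (ee t) = 1"
  by (simp add: ee_def)

lemma cnj_ee: "cnj (ee t) = ee (- t)"
  by (simp add: ee_def cis_cnj)

lemma ee_int [simp]: "t \<in> \<int> \<Longrightarrow> ee t = 1"
  by (simp add: ee_def)

lemma ee_power: "ee t ^ n = ee (t * real n)"
  unfolding ee_def Complex.DeMoivre by (rule arg_cong [where f = cis]) simp

lemma ee_eq_1_iff: "ee t = 1 \<longleftrightarrow> t \<in> \<int>"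
proof
  assume "ee t = 1"
  then have "cos (2 * pi * t) = 1" by (simp add: ee_def complex_eq_iff)
  then obtain n :: int where "2 * pi * t = real_of_int n * 2 * pi" unfolding cos_one_2pi_int by blast
  then have "t = real_of_int n" by simp
  then show "t \<in> \<int>" by simp
qed simp

lemma norm_ee_minus_1: "norm (ee t - 1) = 2 * \<bar>sin (pi * t)\<bar>"
  using dist_exp_i_1 [of "2 * pi * t"] by (simp add: ee_def cis_conv_exp)

lemma sum_ee_div:
  assumes "q > 0"
  shows "(\<Sum>a<q. ee (real a / real q * of_int m)) = (if int q dvd m then of_nat q else 0)"
proof -
  have pw: "ee (real a / real q * of_int m) = ee (of_int m / real q) ^ a" for a
    by (simp add: ee_power mult_ac)
  have iff: "of_int m / real q \<in> \<int> \<longleftrightarrow> int q dvd m"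
  proof
    assume "of_int m / real q \<in> \<int>"
    then obtain k :: int where "of_int m / real q = of_int k" by (auto elim: Ints_cases)
    then have "of_int m = real q * real_of_int k" using assms by (simp add: field_simps)
    then have "real_of_int m = of_int (int q * k)" by simp
    then have "m = int q * k" by (simp only: of_int_eq_iff)
    then show "int q dvd m" by simp
  next
    assume "int q dvd m"
    then obtain k where "m = int q * k" by blast
    then show "of_int m / real q \<in> \<int>" using assms by simp
  qed
  show ?thesis
  proof (cases "int q dvd m")
    case True
    then have "ee (of_int m / real q) = 1" using iff by simp
    then have "(\<Sum>a<q. ee (real a / real q * of_int m)) = of_nat q" by (simp only: pw) simp
    then show ?thesis using True by simp
  next
    case False
    then have "ee (of_int m / real q) \<noteq> 1" using iff by (simp add: ee_eq_1_iff)
    moreover have "ee (of_int m / real q) ^ q = 1" using assms by (simp add: ee_power)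
    ultimately have "(\<Sum>a<q. ee (real a / real q * of_int m)) = 0" by (simp only: pw) (simp add: geometric_sum)
    then show ?thesis using False by simp
  qed
qed

text \<open>A lower bound of this shape is wanted because \<open>1 / (t * (1 - t))\<close> splits by
  partial fractions into the contributions of the two ends of the period.\<close>

lemma sin_pi_ge: 
  assumes "0 < t" "t < 1"
  shows "t * (1 - t) \<le> sin (pi * t)"
proof -
  have half: "y / 2 \<le> sin y" if y: "0 \<le> y" "y \<le> pi / 2" for y
  proof (cases "y \<le> pi / 3")
    case True
    have "sin 0 - 0 / 2 \<le> sin y - y / 2"
    proof (rule DERIV_nonneg_imp_nondecreasing [OF y(1)])
      fix x assume x: "0 \<le> x" "x \<le> y"
      have "cos x \<ge> cos (pi / 3)" using x True by (intro cos_monotone_0_pi_le) auto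
      then have "cos x - 1 / 2 \<ge> 0" by (simp add: cos_60)
      moreover have "((\<lambda>x. sin x - x / 2) has_real_derivative cos x - 1 / 2) (at x)"
        by (auto intro!: derivative_eq_intros)
      ultimately show "\<exists>z. ((\<lambda>x. sin x - x / 2) has_real_derivative z) (at x) \<and> 0 \<le> z" by blast
    qed
    then show ?thesis by simp
  next
    case False
    have "sin (pi / 3) \<le> sin y" using False y by (intro sin_monotone_2pi_le) auto
    moreover have "sqrt 3 / 2 \<ge> 0.8" using real_le_rsqrt [of "1.6" 3] by (simp add: power2_eq_square)
    moreover have "y / 2 \<le> 0.8" using y pi_less_4 pi_approx by simp
    ultimately show ?thesis by (simp add: sin_60)
  qed
  have *: "t * (1 - t) \<le> sin (pi * t)" if "0 < t" "t \<le> 1 / 2" for t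
  proof -
    have "t * (1 - t) \<le> t * 1" using that by (intro mult_left_mono) auto
    also have "\<dots> \<le> t * (pi / 2)" using that pi_ge_two by (intro mult_left_mono) auto
    also have "\<dots> \<le> sin (pi * t)" using half [of "pi * t"] that by (simp add: mult.commute)
    finally show ?thesis .
  qed
  show ?thesis
  proof (cases "t \<le> 1 / 2")
    case False
    then have "(1 - t) * (1 - (1 - t)) \<le> sin (pi * (1 - t))" using assms by (intro *) auto
    moreover have "sin (pi * (1 - t)) = sin (pi * t)" by (simp add: right_diff_distrib sin_diff)
    ultimately show ?thesis by (simp add: mult.commute)
  qed (use * assms in auto)
qed

lemma inverse_sin_pi_le:
  assumes "0 < t" "t < 1"
  shows "1 / \<bar>sin (pi * t)\<bar> \<le> 1 / t + 1 / (1 - t)"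
proof -
  have "1 / \<bar>sin (pi * t)\<bar> \<le> 1 / (t * (1 - t))"
    using sin_pi_ge [OF assms] assms by (intro frac_le) auto
  also have "\<dots> = 1 / t + 1 / (1 - t)" using assms by (simp add: field_simps)
  finally show ?thesis .
qed

lemma norm_geometric_ee_le:
  assumes "sin (pi * t) \<noteq> 0"
  shows "norm (\<Sum>i<n. ee (t * real i)) \<le> 1 / \<bar>sin (pi * t)\<bar>"
proof -
  have ne: "norm (ee t - 1) \<noteq> 0" using assms by (simp add: norm_ee_minus_1)
  then have "ee t \<noteq> 1" by auto
  then have "(\<Sum>i<n. ee (t * real i)) = (ee t ^ n - 1) / (ee t - 1)"
    by (simp add: geometric_sum flip: ee_power)
  moreover have "norm (ee t ^ n - 1) \<le> 2"
    using norm_triangle_ineq4 [of "ee t ^ n" 1] by (simp add: norm_power)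
  ultimately have "norm (\<Sum>i<n. ee (t * real i)) \<le> 2 / norm (ee t - 1)"
    by (simp add: norm_divide divide_right_mono)
  then show ?thesis by (simp add: norm_ee_minus_1)
qed

text \<open>The integer part of \<open>t / d\<close> is at least 1 and, by the spacing, injective on
  \<open>P\<close>. So the sum is at most \<open>1 / d^2\<close> times the sum of the inverse
  squares of distinct positive integers.\<close>

lemma sum_inverse_squares_spaced:
  fixes P :: "real set"
  assumes "finite P" "d > 0" and ge: "\<And>t. t \<in> P \<Longrightarrow> d \<le> t"
    and spaced: "\<And>s t. s \<in> P \<Longrightarrow> t \<in> P \<Longrightarrow> s < t \<Longrightarrow> d \<le> t - s"
  shows "(\<Sum>t\<in>P. 1 / t\<^sup>2) \<le> 2 / d\<^sup>2"
proof -
  define f where "f = (\<lambda>t. nat \<lfloor>t / d\<rfloor>)"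
  have f: "real (f t) = of_int \<lfloor>t / d\<rfloor>" "f t \<ge> 1" if "t \<in> P" for t
  proof -
    have "t / d \<ge> 1" using ge [OF that] assms(2) by simp
    then have "\<lfloor>t / d\<rfloor> \<ge> 1" by linarith
    then show "real (f t) = of_int \<lfloor>t / d\<rfloor>" "f t \<ge> 1" unfolding f_def by linarith+
  qed
  have "inj_on f P"
  proof (rule linorder_inj_onI)
    fix s t assume "s < t" "s \<in> P" "t \<in> P"
    then have "1 \<le> (t - s) / d" using spaced [of s t] assms(2) by simp
    then have "s / d + 1 \<le> t / d" by (simp add: diff_divide_distrib)
    then have "\<lfloor>s / d\<rfloor> < \<lfloor>t / d\<rfloor>" by linarith
    then show "f s \<noteq> f t" using f [OF \<open>s \<in> P\<close>] f [OF \<open>t \<in> P\<close>] by auto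
  qed auto
  have sq: "(\<Sum>k=1..n. 1 / (real k)\<^sup>2) \<le> 2 - 1 / real n" if "n \<ge> 1" for n
    using that
  proof (induction n rule: dec_induct)
    case (step n)
    have "1 / (real n + 1)\<^sup>2 \<le> 1 / real n - 1 / (real n + 1)"
      using step by (simp add: divide_simps power2_eq_square)
    then show ?case using step.IH by (simp add: add.commute)
  qed auto
  have sq2: "(\<Sum>k=1..n. 1 / (real k)\<^sup>2) \<le> 2" for n
  proof (cases "n = 0")
    case False
    then show ?thesis using sq [of n] by (smt (verit) divide_nonneg_nonneg of_nat_0_le_iff less_one linorder_not_le)
  qed auto
  define n where "n = Max (insert 0 (f ` P))"
  have sub: "f ` P \<subseteq> {1..n}" using f(2) assms(1) by (auto simp: n_def)
  have "(\<Sum>t\<in>P. 1 / t\<^sup>2) \<le> (\<Sum>t\<in>P. 1 / d\<^sup>2 * (1 / (real (f t))\<^sup>2))"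
  proof (rule sum_mono)
    fix t assume t: "t \<in> P"
    have "real (f t) \<le> t / d" using f(1) [OF t] by simp
    then have "real (f t) * d \<le> t" using assms(2) by (simp add: pos_le_divide_eq)
    moreover have "0 < real (f t) * d" using f(2) [OF t] assms(2) by auto
    moreover have "0 < t" using ge [OF t] assms(2) by simp
    ultimately have "1 / t\<^sup>2 \<le> 1 / (real (f t) * d)\<^sup>2"
      using f(2) [OF t] assms(2) by (intro frac_le power_mono) auto
    then show "1 / t\<^sup>2 \<le> 1 / d\<^sup>2 * (1 / (real (f t))\<^sup>2)" by (simp add: power_mult_distrib mult.commute)
  qed
  also have "\<dots> = 1 / d\<^sup>2 * (\<Sum>k\<in>f ` P. 1 / (real k)\<^sup>2)"
    by (simp add: sum_distrib_left sum.reindex [OF \<open>inj_on f P\<close>])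
  also have "\<dots> \<le> 1 / d\<^sup>2 * (\<Sum>k=1..n. 1 / (real k)\<^sup>2)"
    using sub by (intro mult_left_mono sum_mono2) auto
  also have "\<dots> \<le> 1 / d\<^sup>2 * 2" by (intro mult_left_mono sq2) auto
  finally show ?thesis by simp
qed

text \<open>The block is majorised by a Fejer weight, whose Fourier transform is the square of a
  geometric sum.\<close>
lemma dual_large_sieve:
  fixes F :: "real set" and c :: "real \<Rightarrow> complex" and N :: int and M :: nat
  assumes "finite F" "M \<ge> 1" "d > 0"
    and spaced: "\<And>s t. s \<in> F \<Longrightarrow> t \<in> F \<Longrightarrow> s < t \<Longrightarrow> d \<le> t - s \<and> d \<le> 1 - (t - s)"
  shows "(\<Sum>t=1..M. (norm (\<Sum>x\<in>F. c x * ee (x * of_int (N + int t))))\<^sup>2)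
     \<le> (4 * real M + 16 / (d\<^sup>2 * real M)) * (\<Sum>x\<in>F. (norm (c x))\<^sup>2)"
proof -
  define S where "S = (\<lambda>n::int. \<Sum>x\<in>F. c x * ee (x * of_int n))"
  define K where "K = N + 1 - int M"
  define D where "D = (\<lambda>x. \<Sum>i<2 * M. ee (x * real i))"
  let ?n = "\<lambda>i j. norm (S (K + int i + int j))"
  let ?c = "\<lambda>x. (norm (c x))\<^sup>2"
  let ?d = "\<lambda>x. (norm (D x))\<^sup>2"
  \<comment> \<open>Each \<open>N + t\<close> of the block is \<open>K + i + j\<close> with
    \<open>j = t + M - 1 - i\<close> for all \<open>M\<close> choices \<open>i < M\<close>, and this
    \<open>j\<close> is below \<open>2 * M\<close>. So the double sum over \<open>i\<close> and
    \<open>j\<close> counts every element of the block at least \<open>M\<close> times.\<close>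
  have "real M * (\<Sum>t=1..M. (norm (S (N + int t)))\<^sup>2) = (\<Sum>(t, i)\<in>{1..M} \<times> {..<M}. (norm (S (N + int t)))\<^sup>2)"
    by (simp add: sum_distrib_left flip: sum.cartesian_product)
  also have "\<dots> = (\<Sum>(i, j)\<in>(\<lambda>(t, i). (i, t + M - 1 - i)) ` ({1..M} \<times> {..<M}). (?n i j)\<^sup>2)"
    by (subst sum.reindex) (auto simp: inj_on_def K_def of_nat_diff intro!: sum.cong)
  also have "\<dots> \<le> (\<Sum>(i, j)\<in>{..<2 * M} \<times> {..<2 * M}. (?n i j)\<^sup>2)"
    by (rule sum_mono2) auto
  also have "\<dots> = (\<Sum>i<2 * M. \<Sum>j<2 * M. (?n i j)\<^sup>2)"
    by (simp add: sum.cartesian_product)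
  finally have 1: "real M * (\<Sum>t=1..M. (norm (S (N + int t)))\<^sup>2)
    \<le> (\<Sum>i<2 * M. \<Sum>j<2 * M. (?n i j)\<^sup>2)" .
  have sq: "complex_of_real ((norm (S n))\<^sup>2) = (\<Sum>x\<in>F. \<Sum>y\<in>F. c x * cnj (c y) * ee ((x - y) * of_int n))" for n
  proof -
    have "complex_of_real ((norm (S n))\<^sup>2) = S n * cnj (S n)" by (rule complex_norm_square)
    also have "\<dots> = (\<Sum>x\<in>F. \<Sum>y\<in>F. (c x * ee (x * of_int n)) * cnj (c y * ee (y * of_int n)))"
      unfolding S_def cnj_sum by (rule sum_product)
    also have "\<dots> = (\<Sum>x\<in>F. \<Sum>y\<in>F. c x * cnj (c y) * ee ((x - y) * of_int n))"
    proof (intro sum.cong refl)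
      fix x y
      have "ee (x * of_int n) * ee (- (y * of_int n)) = ee ((x - y) * of_int n)"
        by (simp add: left_diff_distrib flip: ee_add)
      then show "c x * ee (x * of_int n) * cnj (c y * ee (y * of_int n)) = c x * cnj (c y) * ee ((x - y) * of_int n)"
        by (simp add: cnj_ee mult_ac)
    qed
    finally show ?thesis .
  qed
  have "complex_of_real (\<Sum>i<2 * M. \<Sum>j<2 * M. (?n i j)\<^sup>2)
      = (\<Sum>i<2 * M. \<Sum>j<2 * M. \<Sum>x\<in>F. \<Sum>y\<in>F. c x * cnj (c y) * ee ((x - y) * of_int (K + int i + int j)))"
    by (simp only: of_real_sum sq)
  also have "\<dots> = (\<Sum>x\<in>F. \<Sum>y\<in>F. \<Sum>i<2 * M. \<Sum>j<2 * M. c x * cnj (c y) * ee ((x - y) * of_int (K + int i + int j)))"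
    by (simp only: sum.swap [of _ F "{..<2 * M}"])
  also have "\<dots> = (\<Sum>x\<in>F. \<Sum>y\<in>F. c x * cnj (c y) * ee ((x - y) * of_int K) * (D (x - y))\<^sup>2)"
  proof (intro sum.cong refl)
    fix x y
    have "(D (x - y))\<^sup>2 = (\<Sum>i<2 * M. \<Sum>j<2 * M. ee ((x - y) * real i) * ee ((x - y) * real j))"
      by (simp add: D_def power2_eq_square sum_product)
    then show "(\<Sum>i<2 * M. \<Sum>j<2 * M. c x * cnj (c y) * ee ((x - y) * of_int (K + int i + int j)))
      = c x * cnj (c y) * ee ((x - y) * of_int K) * (D (x - y))\<^sup>2"
      by (simp add: sum_distrib_left distrib_left ee_add mult.assoc)
  qed
  finally have 2: "complex_of_real (\<Sum>i<2 * M. \<Sum>j<2 * M. (?n i j)\<^sup>2)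
      = (\<Sum>x\<in>F. \<Sum>y\<in>F. c x * cnj (c y) * ee ((x - y) * of_int K) * (D (x - y))\<^sup>2)" .
  have "(\<Sum>i<2 * M. \<Sum>j<2 * M. (?n i j)\<^sup>2)
      \<le> norm (complex_of_real (\<Sum>i<2 * M. \<Sum>j<2 * M. (?n i j)\<^sup>2))"
    unfolding norm_of_real by (rule abs_ge_self)
  also have "\<dots> \<le> (\<Sum>x\<in>F. \<Sum>y\<in>F. norm (c x) * norm (c y) * ?d (x - y))"
    unfolding 2 by (intro order_trans [OF norm_sum] sum_mono) (simp add: norm_mult norm_power)
  \<comment> \<open>Schur's test: after the inequality of arithmetic and geometric means and the
    symmetry of \<open>?d\<close>, only the row sums of \<open>?d\<close> have to be
    bounded.\<close>
  also have "\<dots> \<le> (\<Sum>x\<in>F. \<Sum>y\<in>F. (?c x / 2 + ?c y / 2) * ?d (x - y))"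
  proof (intro sum_mono mult_right_mono)
    fix x y
    show "norm (c x) * norm (c y) \<le> ?c x / 2 + ?c y / 2"
      using sum_squares_bound [of "norm (c x)" "norm (c y)"] by simp
  qed auto
  also have "\<dots> = (\<Sum>x\<in>F. \<Sum>y\<in>F. ?c x / 2 * ?d (x - y))
      + (\<Sum>x\<in>F. \<Sum>y\<in>F. ?c y / 2 * ?d (x - y))"
    by (simp add: sum.distrib distrib_right)
  also have "(\<Sum>x\<in>F. \<Sum>y\<in>F. ?c y / 2 * ?d (x - y))
      = (\<Sum>x\<in>F. \<Sum>y\<in>F. ?c x / 2 * ?d (x - y))"
  proof -
    have "norm (D (- t)) = norm (D t)" for t
    proof -
      have "D (- t) = cnj (D t)" by (simp add: D_def cnj_ee)
      then show ?thesis by simp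
    qed
    from this [of "x - y" for x y] show ?thesis by (subst sum.swap) simp
  qed
  also have "(\<Sum>x\<in>F. \<Sum>y\<in>F. ?c x / 2 * ?d (x - y))
      + (\<Sum>x\<in>F. \<Sum>y\<in>F. ?c x / 2 * ?d (x - y))
      = (\<Sum>x\<in>F. ?c x * (\<Sum>y\<in>F. ?d (x - y)))"
    by (simp add: sum_distrib_left flip: sum.distrib)
  also have "\<dots> \<le> (\<Sum>x\<in>F. ?c x * (4 * (real M)\<^sup>2 + 16 / d\<^sup>2))"
  proof (intro sum_mono mult_left_mono)
    fix x assume x: "x \<in> F"
    have D0: "norm (D 0) = 2 * real M" by (simp add: D_def)
    have Dt: "(norm (D s))\<^sup>2 \<le> 2 / t\<^sup>2 + 2 / (1 - t)\<^sup>2" if "0 < t" "t < 1" "\<bar>s\<bar> = t" for s t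
    proof -
      have "sin (pi * t) > 0" using that by (intro sin_gt_zero) auto
      moreover have st: "\<bar>sin (pi * s)\<bar> = \<bar>sin (pi * t)\<bar>" using that by (cases "s \<ge> 0") auto
      ultimately have "sin (pi * s) \<noteq> 0" by auto
      then have "norm (D s) \<le> 1 / \<bar>sin (pi * t)\<bar>"
        unfolding D_def st [symmetric] by (rule norm_geometric_ee_le)
      also have "\<dots> \<le> 1 / t + 1 / (1 - t)" by (intro inverse_sin_pi_le that)
      finally have "(norm (D s))\<^sup>2 \<le> (1 / t + 1 / (1 - t))\<^sup>2" by (intro power_mono) auto
      also have "\<dots> \<le> 2 * (1 / t)\<^sup>2 + 2 * (1 / (1 - t))\<^sup>2"
        using sum_squares_bound [of "1 / t" "1 / (1 - t)"] by (simp add: power2_sum)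
      finally show ?thesis by (simp add: power_divide)
    qed
    \<comment> \<open>Two points are close modulo 1 if \<open>t\<close> or \<open>1 - t\<close> is
      small, where \<open>t\<close> is their distance. On either side of \<open>x\<close> both
      families are spaced by \<open>d\<close>, so four sums of at most \<open>2 / d^2\<close> occur,
      each with the factor 2 from \<open>Dt\<close>.\<close>
    define F1 where "F1 = {y \<in> F. x < y}"
    define F2 where "F2 = {y \<in> F. y < x}"
    have fin: "finite F1" "finite F2" using assms(1) by (auto simp: F1_def F2_def)
    have F: "F = insert x (F1 \<union> F2)" "x \<notin> F1 \<union> F2" "F1 \<inter> F2 = {}" using x by (auto simp: F1_def F2_def)
    have aux: "(\<Sum>y\<in>Y. 1 / (g y)\<^sup>2) \<le> 2 / d\<^sup>2" if "finite Y" "inj_on g Y" "\<And>y. y \<in> Y \<Longrightarrow> d \<le> g y"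
        "\<And>y z. y \<in> Y \<Longrightarrow> z \<in> Y \<Longrightarrow> g y < g z \<Longrightarrow> d \<le> g z - g y" for g and Y :: "real set"
      using sum_inverse_squares_spaced [of "g ` Y" d] that assms(3) by (auto simp: sum.reindex)
    have b1: "(\<Sum>y\<in>F1. 1 / (y - x)\<^sup>2) \<le> 2 / d\<^sup>2" "(\<Sum>y\<in>F1. 1 / (1 - (y - x))\<^sup>2) \<le> 2 / d\<^sup>2"
      by (rule aux [OF fin(1)]; use spaced x in \<open>force simp: F1_def inj_on_def\<close>)+
    have b2: "(\<Sum>y\<in>F2. 1 / (x - y)\<^sup>2) \<le> 2 / d\<^sup>2" "(\<Sum>y\<in>F2. 1 / (1 - (x - y))\<^sup>2) \<le> 2 / d\<^sup>2"
      by (rule aux [OF fin(2)]; use spaced x in \<open>force simp: F2_def inj_on_def\<close>)+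
    have "(\<Sum>y\<in>F1. ?d (x - y)) \<le> (\<Sum>y\<in>F1. 2 / (y - x)\<^sup>2 + 2 / (1 - (y - x))\<^sup>2)"
      using spaced x assms(3) by (intro sum_mono Dt) (force simp: F1_def)+
    also have "\<dots> = 2 * (\<Sum>y\<in>F1. 1 / (y - x)\<^sup>2) + 2 * (\<Sum>y\<in>F1. 1 / (1 - (y - x))\<^sup>2)"
      by (simp add: sum.distrib sum_distrib_left)
    finally have c1: "(\<Sum>y\<in>F1. ?d (x - y)) \<le> 8 / d\<^sup>2" using b1 by simp
    have "(\<Sum>y\<in>F2. ?d (x - y)) \<le> (\<Sum>y\<in>F2. 2 / (x - y)\<^sup>2 + 2 / (1 - (x - y))\<^sup>2)"
      using spaced x assms(3) by (intro sum_mono Dt) (force simp: F2_def)+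
    also have "\<dots> = 2 * (\<Sum>y\<in>F2. 1 / (x - y)\<^sup>2) + 2 * (\<Sum>y\<in>F2. 1 / (1 - (x - y))\<^sup>2)"
      by (simp add: sum.distrib sum_distrib_left)
    finally have c2: "(\<Sum>y\<in>F2. ?d (x - y)) \<le> 8 / d\<^sup>2" using b2 by simp
    have "(\<Sum>y\<in>F. ?d (x - y)) = (norm (D 0))\<^sup>2 + ((\<Sum>y\<in>F1. ?d (x - y)) + (\<Sum>y\<in>F2. ?d (x - y)))"
      by (subst F(1)) (use fin F(2,3) in \<open>simp add: sum.union_disjoint\<close>)
    then show "(\<Sum>y\<in>F. ?d (x - y)) \<le> 4 * (real M)\<^sup>2 + 16 / d\<^sup>2"
      using c1 c2 by (simp add: D0 power_mult_distrib)
  qed auto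
  also have "\<dots> = real M * ((4 * real M + 16 / (d\<^sup>2 * real M)) * (\<Sum>x\<in>F. ?c x))"
  proof -
    have "4 * (real M)\<^sup>2 + 16 / d\<^sup>2 = real M * (4 * real M + 16 / (d\<^sup>2 * real M))"
      using assms(2) by (simp add: distrib_left power2_eq_square)
    then show ?thesis by (simp add: sum_distrib_left sum_distrib_right mult_ac)
  qed
  finally have "real M * (\<Sum>t=1..M. (norm (S (N + int t)))\<^sup>2)
      \<le> real M * ((4 * real M + 16 / (d\<^sup>2 * real M)) * (\<Sum>x\<in>F. ?c x))"
    using 1 by (rule order_trans [rotated])
  then show ?thesis unfolding S_def by (rule mult_left_le_imp_le) (use assms(2) in simp)
qed

section \<open>Farey fractions and their multiplicities\<close>

definition farey :: "nat \<Rightarrow> real set" where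
  "farey Q = (\<lambda>(q, a). real a / real q) ` (SIGMA q:{1..Q}. {..<q})"

lemma finite_farey: "finite (farey Q)"
  by (auto simp: farey_def)

text \<open>Distinct fractions differ by at least the reciprocal of the product of their
  denominators. The second bound is the spacing around the circle: \<open>t\<close> is at most
  \<open>1 - 1 / r\<close> and \<open>s\<close> is nonnegative.\<close>

lemma farey_spaced:
  assumes "s \<in> farey Q" "t \<in> farey Q" "s < t"
  shows "1 / (real Q)\<^sup>2 \<le> t - s" "1 / (real Q)\<^sup>2 \<le> 1 - (t - s)"
proof -
  obtain q a where s: "s = real a / real q" "q \<in> {1..Q}" "a < q" using assms(1) by (auto simp: farey_def)
  obtain r b where t: "t = real b / real r" "r \<in> {1..Q}" "b < r" using assms(2) by (auto simp: farey_def)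
  have qr: "real q > 0" "real r > 0" "real q \<le> Q" "real r \<le> Q" "real Q \<ge> 1" using s t by auto
  have eq: "t - s = (real b * real q - real a * real r) / (real q * real r)"
    using qr by (simp add: s t field_simps)
  have "real a * real r < real b * real q" using assms(3) qr by (simp add: s t field_simps)
  then have "a * r < b * q" by (simp only: of_nat_less_iff flip: of_nat_mult)
  then have "real (a * r) + 1 \<le> real (b * q)" by linarith
  then have 1: "1 \<le> real b * real q - real a * real r" by simp
  have "1 / (real Q)\<^sup>2 \<le> 1 / (real q * real r)"
    using qr by (intro divide_left_mono) (auto simp: power2_eq_square intro!: mult_mono)
  also have "\<dots> \<le> t - s" unfolding eq using 1 qr by (intro divide_right_mono) auto
  finally show "1 / (real Q)\<^sup>2 \<le> t - s" .
  have "1 / (real Q)\<^sup>2 \<le> 1 / real Q" using qr by (intro divide_left_mono) (auto simp: power2_eq_square)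
  also have "\<dots> \<le> 1 / real r" using qr by (intro divide_left_mono) auto
  also have "\<dots> = 1 - (real r - 1) / real r" using qr by (simp add: field_simps)
  also have "\<dots> \<le> 1 - t" using t qr by (simp add: t(1) divide_right_mono)
  also have "\<dots> \<le> 1 - (t - s)" using s by simp
  finally show "1 / (real Q)\<^sup>2 \<le> 1 - (t - s)" .
qed

text \<open>Fractions need not be reduced, so a value \<open>x\<close> occurs once for every
  \<open>q\<close> up to \<open>Q\<close> for which \<open>q * x\<close> is an integer. The identity
  is used in both directions: to collect frequencies before the sieve, and to spread the mean square
  over denominators after it.\<close>

lemma sum_farey_swap:
  fixes f :: "nat \<Rightarrow> real \<Rightarrow> 'a::comm_monoid_add"
  shows "(\<Sum>q=1..Q. \<Sum>a<q. f q (real a / real q))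
    = (\<Sum>x\<in>farey Q. \<Sum>q\<in>{q \<in> {1..Q}. real q * x \<in> \<int>}. f q x)"
proof -
  have "(\<Sum>a<q. f q (real a / real q)) = (\<Sum>x\<in>{x \<in> farey Q. real q * x \<in> \<int>}. f q x)" if q: "q \<in> {1..Q}" for q
  proof -
    have "{x \<in> farey Q. real q * x \<in> \<int>} = (\<lambda>a. real a / real q) ` {..<q}"
    proof (intro equalityI subsetI)
      fix x assume "x \<in> {x \<in> farey Q. real q * x \<in> \<int>}"
      then have x: "x \<in> farey Q" "real q * x \<in> \<int>" by auto
      then have x01: "0 \<le> x" "x < 1" by (auto simp: farey_def)
      from x(2) obtain k :: int where k: "real q * x = of_int k" by (auto elim: Ints_cases)
      have "of_int k \<ge> (0::real)" "of_int k < real q" using x01 q unfolding k [symmetric] by auto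
      then have "k \<ge> 0" "k < int q" by auto
      then have "nat k < q" "real (nat k) = of_int k" by auto
      moreover have "x = of_int k / real q" using k q by (simp add: field_simps)
      ultimately show "x \<in> (\<lambda>a. real a / real q) ` {..<q}" by (intro image_eqI [of _ _ "nat k"]) auto
    next
      fix x assume "x \<in> (\<lambda>a. real a / real q) ` {..<q}"
      then show "x \<in> {x \<in> farey Q. real q * x \<in> \<int>}" using q by (force simp: farey_def)
    qed
    moreover have "inj_on (\<lambda>a. real a / real q) {..<q}" using q by (auto simp: inj_on_def)
    ultimately show ?thesis by (simp add: sum.reindex)
  qed
  then have "(\<Sum>q=1..Q. \<Sum>a<q. f q (real a / real q)) = (\<Sum>q=1..Q. \<Sum>x\<in>{x \<in> farey Q. real q * x \<in> \<int>}. f q x)"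
    by (intro sum.cong) auto
  also have "\<dots> = (\<Sum>x\<in>farey Q. \<Sum>q\<in>{q \<in> {1..Q}. real q * x \<in> \<int>}. f q x)"
    by (rule sum.swap_restrict) (auto simp: finite_farey)
  finally show ?thesis .
qed

lemma harm_le: "(\<Sum>m=1..n. 1 / real m) \<le> 1 + ln (real n)"
proof (cases "n = 0")
  case False
  then show ?thesis using harm_bounds [of n] by (simp add: abs_le_iff)
qed auto

text \<open>The admissible \<open>q\<close> are multiples of the least one, \<open>r\<close>, the
  reduced denominator of \<open>x\<close>. So the sum is at most \<open>1 / r\<close> times a
  harmonic sum, and \<open>1 / r^2\<close> is a term on the right. The right side keeps all
  \<open>q\<close> so that \<open>sum_farey_swap\<close> can be applied backwards.\<close>

lemma sum_inverse_denominators_sq_le: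
  assumes "x \<in> farey Q"
  shows "(\<Sum>q\<in>{q \<in> {1..Q}. real q * x \<in> \<int>}. 1 / real q)\<^sup>2
    \<le> (1 + ln (real Q))\<^sup>2 * (\<Sum>q\<in>{q \<in> {1..Q}. real q * x \<in> \<int>}. 1 / (real q)\<^sup>2)"
proof -
  let ?A = "{q \<in> {1..Q}. real q * x \<in> \<int>}"
  define r where "r = Min ?A"
  have "?A \<noteq> {}"
  proof -
    obtain q a where "x = real a / real q" "q \<in> {1..Q}" using assms by (auto simp: farey_def)
    then have "q \<in> ?A" by simp
    then show ?thesis by blast
  qed
  then have r: "r \<in> ?A" using Min_in [of ?A] by (simp add: r_def)
  have rmin: "r \<le> q" if "q \<in> ?A" for q using that by (simp add: r_def)
  have dvd: "r dvd q" if q: "q \<in> ?A" for q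
  proof (rule ccontr)
    assume "\<not> r dvd q"
    then have m: "q mod r > 0" by (simp add: dvd_eq_mod_eq_0)
    have "real (q mod r) + real (q div r) * real r = real (q mod r + q div r * r)" by (simp only: of_nat_add of_nat_mult)
    also have "\<dots> = real q" by (simp only: mod_div_mult_eq)
    finally have "real (q mod r) = real q - real (q div r) * real r" by linarith
    then have "real (q mod r) * x = real q * x - real (q div r) * (real r * x)"
      by (simp only: left_diff_distrib mult.assoc)
    also have "\<dots> \<in> \<int>" by (rule Ints_diff [OF _ Ints_mult]) (use q r in auto)
    finally have "q mod r \<in> ?A" using m q mod_less_eq_dividend [of q r] by (auto simp del: mod_less_eq_dividend)
    then have "r \<le> q mod r" by (rule rmin)
    moreover have "q mod r < r" using r by (intro mod_less_divisor) auto
    ultimately show False by simp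
  qed
  have "(\<Sum>q\<in>?A. 1 / real q) \<le> (\<Sum>q\<in>(\<lambda>k. r * k) ` {1..Q}. 1 / real q)"
  proof (rule sum_mono2)
    show "?A \<subseteq> (\<lambda>k. r * k) ` {1..Q}"
    proof
      fix q assume q: "q \<in> ?A"
      then obtain k where "q = r * k" using dvd by blast
      moreover from this have "k \<ge> 1" "k \<le> Q" using q r by (auto intro: Suc_leI gr0I order_trans [of k "r * k"])
      ultimately show "q \<in> (\<lambda>k. r * k) ` {1..Q}" by auto
    qed
  qed auto
  also have "\<dots> = (\<Sum>k=1..Q. 1 / real (r * k))" using r by (subst sum.reindex) (auto simp: inj_on_def)
  also have "\<dots> = (1 / real r) * (\<Sum>k=1..Q. 1 / real k)" by (simp add: sum_distrib_left)
  also have "\<dots> \<le> (1 / real r) * (1 + ln (real Q))" by (intro mult_left_mono harm_le) auto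
  finally have "(\<Sum>q\<in>?A. 1 / real q)\<^sup>2 \<le> ((1 / real r) * (1 + ln (real Q)))\<^sup>2"
    by (intro power_mono) (auto intro: sum_nonneg)
  also have "\<dots> = (1 + ln (real Q))\<^sup>2 * (1 / (real r)\<^sup>2)" by (simp add: power_mult_distrib power_divide)
  also have "1 / (real r)\<^sup>2 \<le> (\<Sum>q\<in>?A. 1 / (real q)\<^sup>2)"
    using member_le_sum [of r ?A "\<lambda>q. 1 / (real q)\<^sup>2"] r by simp
  finally show ?thesis by (simp add: mult_left_mono)
qed

section \<open>The odd kernel and the mean square for residue classes\<close>

definition odd_kernel :: "nat \<Rightarrow> nat \<Rightarrow> real \<Rightarrow> complex" where
  "odd_kernel L H x = (\<Sum>h\<in>{L<..H}. (1 / real h) *\<^sub>R (ee (x * real h) - ee (- (x * real h))))"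

lemma odd_kernel_0 [simp]: "odd_kernel L H 0 = 0"
  by (simp add: odd_kernel_def)

lemma norm_odd_kernel_le: "norm (odd_kernel L H x) \<le> 2 * (1 + ln (real H))"
proof -
  have "norm (odd_kernel L H x) \<le> (\<Sum>h\<in>{L<..H}. (1 / real h) * 2)"
    unfolding odd_kernel_def
  proof (intro order_trans [OF norm_sum] sum_mono)
    fix h
    have "norm (ee (x * real h) - ee (- (x * real h))) \<le> 2"
      using norm_triangle_ineq4 [of "ee (x * real h)" "ee (- (x * real h))"] by simp
    then show "norm ((1 / real h) *\<^sub>R (ee (x * real h) - ee (- (x * real h)))) \<le> (1 / real h) * 2"
      by (simp add: divide_right_mono)
  qed
  also have "\<dots> = 2 * (\<Sum>h\<in>{L<..H}. 1 / real h)" by (simp add: sum_distrib_left)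
  also have "\<dots> \<le> 2 * (\<Sum>h=1..H. 1 / real h)" by (intro mult_left_mono sum_mono2) auto
  also have "\<dots> \<le> 2 * (1 + ln (real H))" by (intro mult_left_mono harm_le) auto
  finally show ?thesis .
qed

text \<open>The weights \<open>1 / h\<close> decrease from \<open>1 / (L + 1)\<close> and the
  exponential sums are geometric. This is the source of the gain \<open>1 / L\<close>.\<close>

lemma norm_odd_kernel_le':
  assumes "0 < x" "x < 1" "L \<ge> 1"
  shows "norm (odd_kernel L H x) \<le> 2 / real L * (1 / x + 1 / (1 - x))"
proof (cases "L < H")
  case True
  have s: "sin (pi * x) > 0" using assms by (intro sin_gt_zero) auto
  have bound: "norm (\<Sum>h\<in>{L<..t}. ee (y * real h)) \<le> 1 / \<bar>sin (pi * x)\<bar>"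
    if t: "L < t" and y: "\<bar>y\<bar> = x" for t y
  proof -
    have sy: "\<bar>sin (pi * y)\<bar> = \<bar>sin (pi * x)\<bar>" using y by (cases "y \<ge> 0") auto
    have "(\<Sum>h\<in>{L<..t}. ee (y * real h)) = (\<Sum>i<t - L. ee (y * real (L + 1)) * ee (y * real i))"
      by (rule sum.reindex_bij_witness [of _ "\<lambda>i. L + 1 + i" "\<lambda>h. h - (L + 1)"])
         (auto simp: of_nat_diff right_diff_distrib distrib_left simp flip: ee_add)
    also have "\<dots> = ee (y * real (L + 1)) * (\<Sum>i<t - L. ee (y * real i))" by (rule sum_distrib_left [symmetric])
    finally have "norm (\<Sum>h\<in>{L<..t}. ee (y * real h)) = norm (\<Sum>i<t - L. ee (y * real i))" by (simp add: norm_mult)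
    also have "\<dots> \<le> 1 / \<bar>sin (pi * y)\<bar>" using s sy by (intro norm_geometric_ee_le) auto
    finally show ?thesis using sy by simp
  qed
  have b: "norm (\<Sum>h\<in>{L<..H}. (1 / real h) *\<^sub>R ee (y * real h)) \<le> 1 / \<bar>sin (pi * x)\<bar> * (1 / real (Suc L))"
    if y: "\<bar>y\<bar> = x" for y
    by (rule norm_sum_decreasing_le) (use True bound y in \<open>auto simp: frac_le\<close>)
  have "odd_kernel L H x = (\<Sum>h\<in>{L<..H}. (1 / real h) *\<^sub>R ee (x * real h)) - (\<Sum>h\<in>{L<..H}. (1 / real h) *\<^sub>R ee ((- x) * real h))"
    by (simp add: odd_kernel_def scaleR_diff_right sum_subtractf)
  then have "norm (odd_kernel L H x) \<le> 2 * (1 / \<bar>sin (pi * x)\<bar> * (1 / real (Suc L)))"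
    using b [of x] b [of "- x"] assms(1)
      norm_triangle_ineq4 [of "\<Sum>h\<in>{L<..H}. (1 / real h) *\<^sub>R ee (x * real h)" "\<Sum>h\<in>{L<..H}. (1 / real h) *\<^sub>R ee ((- x) * real h)"]
    by simp
  also have "\<dots> \<le> 2 * ((1 / x + 1 / (1 - x)) * (1 / real L))"
    using assms s by (intro mult_left_mono mult_mono inverse_sin_pi_le frac_le) auto
  finally show ?thesis by simp
qed (use assms in \<open>simp add: odd_kernel_def\<close>)

definition class_sum :: "(nat \<Rightarrow> real) \<Rightarrow> (nat \<Rightarrow> int) \<Rightarrow> nat \<Rightarrow> int \<Rightarrow> real" where
  "class_sum u c Q m = (\<Sum>q=1..Q. u q * (if int q dvd m - c q then 1 else 0))"

text \<open>Additive characters expand the residue classes, and equal fractions are collected into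
  coefficients \<open>b\<close>. On frequency \<open>x\<close> the odd sum acts as multiplication by
  \<open>odd_kernel L H x\<close>, so the sieve applies with \<open>d = 1 / Q^2\<close>. Of the five
  logarithms, \<open>lh\<close> comes from the trivial bound of the kernel, two factors
  \<open>lq\<close> from the collected denominators, and one each from the sums over
  \<open>a\<close> and over \<open>q\<close>.\<close>

lemma class_sum_variance:
  assumes u: "\<And>q. \<bar>u q\<bar> \<le> 1" and "L \<ge> 1" "M \<ge> 1" "Q \<ge> 1" "H \<ge> 1"
  shows "(\<Sum>t=1..M. (\<Sum>h\<in>{L<..H}.
      (class_sum u c Q (N + int t + int h) - class_sum u c Q (N + int t - int h)) / real h)\<^sup>2)
    \<le> (4 * real M + 16 * (real Q)^4 / real M) * (8 * (1 + ln (real H)) * (1 + ln (real Q))^4 / real L)"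
proof -
  let ?s = "class_sum u c Q"
  let ?k = "\<lambda>a q. norm (odd_kernel L H (real a / real q))"
  define lq where "lq = 1 + ln (real Q)"
  define lh where "lh = 1 + ln (real H)"
  have l: "lq \<ge> 1" "lh \<ge> 1" using assms by (auto simp: lq_def lh_def)
  define A where "A = (\<lambda>x. {q \<in> {1..Q}. real q * x \<in> \<int>})"
  define b where "b = (\<lambda>x. \<Sum>q\<in>A x. complex_of_real (u q / real q) * ee (- (x * of_int (c q))))"
  define g where "g = (\<lambda>x. b x * odd_kernel L H x)"
  have cs: "complex_of_real (?s m) = (\<Sum>x\<in>farey Q. b x * ee (x * of_int m))" for m
  proof -
    have "complex_of_real (?s m)
        = (\<Sum>q=1..Q. complex_of_real (u q / real q) * (if int q dvd m - c q then of_nat q else 0))"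
      unfolding class_sum_def of_real_sum by (intro sum.cong refl) auto
    also have "\<dots> = (\<Sum>q=1..Q. complex_of_real (u q / real q) * (\<Sum>a<q. ee (real a / real q * of_int (m - c q))))"
      by (intro sum.cong refl arg_cong2 [where f = "(*)"] sum_ee_div [symmetric]) auto
    also have "\<dots> = (\<Sum>q=1..Q. \<Sum>a<q. complex_of_real (u q / real q) * ee (real a / real q * of_int (m - c q)))"
      by (simp only: sum_distrib_left)
    also have "\<dots> = (\<Sum>x\<in>farey Q. \<Sum>q\<in>A x. complex_of_real (u q / real q) * ee (x * of_int (m - c q)))"
      unfolding A_def by (rule sum_farey_swap)
    also have "\<dots> = (\<Sum>x\<in>farey Q. b x * ee (x * of_int m))"
    proof (intro sum.cong refl)
      fix x
      have "ee (x * of_int (m - c q)) = ee (- (x * of_int (c q))) * ee (x * of_int m)" for q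
        by (simp add: right_diff_distrib flip: ee_add)
      then show "(\<Sum>q\<in>A x. complex_of_real (u q / real q) * ee (x * of_int (m - c q))) = b x * ee (x * of_int m)"
        by (simp only: b_def sum_distrib_right mult.assoc)
    qed
    finally show ?thesis .
  qed
  have G: "complex_of_real (\<Sum>h\<in>{L<..H}. (?s (n + int h) - ?s (n - int h)) / real h)
      = (\<Sum>x\<in>farey Q. g x * ee (x * of_int n))" for n
  proof -
    have "complex_of_real (\<Sum>h\<in>{L<..H}. (?s (n + int h) - ?s (n - int h)) / real h)
       = (\<Sum>h\<in>{L<..H}. (1 / real h) *\<^sub>R (complex_of_real (?s (n + int h)) - complex_of_real (?s (n - int h))))"
      unfolding of_real_sum by (intro sum.cong refl) (simp add: scaleR_conv_of_real)
    also have "\<dots> = (\<Sum>h\<in>{L<..H}. \<Sum>x\<in>farey Q. b x * ee (x * of_int n) * ((1 / real h) *\<^sub>R (ee (x * real h) - ee (- (x * real h)))))"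
    proof (intro sum.cong refl)
      fix h
      have e: "ee (x * of_int (n + int h)) = ee (x * of_int n) * ee (x * real h)"
        "ee (x * of_int (n - int h)) = ee (x * of_int n) * ee (- (x * real h))" for x
        by (simp_all add: distrib_left right_diff_distrib flip: ee_add)
      show "(1 / real h) *\<^sub>R (complex_of_real (?s (n + int h)) - complex_of_real (?s (n - int h)))
        = (\<Sum>x\<in>farey Q. b x * ee (x * of_int n) * ((1 / real h) *\<^sub>R (ee (x * real h) - ee (- (x * real h)))))"
        unfolding cs e by (simp add: scaleR_sum_right right_diff_distrib mult.assoc flip: sum_subtractf)
    qed
    also have "\<dots> = (\<Sum>x\<in>farey Q. g x * ee (x * of_int n))"
      by (subst sum.swap) (simp add: g_def odd_kernel_def sum_distrib_left sum_distrib_right mult_ac)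
    finally show ?thesis .
  qed
  have "(\<Sum>t=1..M. (\<Sum>h\<in>{L<..H}. (?s (N + int t + int h) - ?s (N + int t - int h)) / real h)\<^sup>2)
      = (\<Sum>t=1..M. (norm (\<Sum>x\<in>farey Q. g x * ee (x * of_int (N + int t))))\<^sup>2)"
    unfolding G [symmetric] norm_of_real by simp
  also have "\<dots> \<le> (4 * real M + 16 / ((1 / (real Q)\<^sup>2)\<^sup>2 * real M)) * (\<Sum>x\<in>farey Q. (norm (g x))\<^sup>2)"
    by (rule dual_large_sieve) (use assms farey_spaced in \<open>auto simp: finite_farey\<close>)
  also have "(4 * real M + 16 / ((1 / (real Q)\<^sup>2)\<^sup>2 * real M)) = 4 * real M + 16 * (real Q)^4 / real M"
    by (simp add: power_divide flip: power_mult)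
  also have "(\<Sum>x\<in>farey Q. (norm (g x))\<^sup>2) \<le> 8 * lh * lq ^ 4 / real L"
  proof -
    have "(\<Sum>x\<in>farey Q. (norm (g x))\<^sup>2) \<le> (\<Sum>x\<in>farey Q. \<Sum>q\<in>A x. lq\<^sup>2 * (1 / (real q)\<^sup>2 * (norm (odd_kernel L H x))\<^sup>2))"
    proof (rule sum_mono)
      fix x assume x: "x \<in> farey Q"
      have "norm (b x) \<le> (\<Sum>q\<in>A x. 1 / real q)"
        unfolding b_def
      proof (intro order_trans [OF norm_sum] sum_mono)
        fix q
        show "norm (complex_of_real (u q / real q) * ee (- (x * of_int (c q)))) \<le> 1 / real q"
          using u [of q] by (simp add: norm_mult norm_divide divide_right_mono)
      qed
      then have "(norm (b x))\<^sup>2 \<le> (\<Sum>q\<in>A x. 1 / real q)\<^sup>2" by (intro power_mono) auto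
      also have "\<dots> \<le> lq\<^sup>2 * (\<Sum>q\<in>A x. 1 / (real q)\<^sup>2)"
        unfolding A_def lq_def by (rule sum_inverse_denominators_sq_le [OF x])
      finally have "(norm (b x))\<^sup>2 * (norm (odd_kernel L H x))\<^sup>2 \<le> lq\<^sup>2 * (\<Sum>q\<in>A x. 1 / (real q)\<^sup>2) * (norm (odd_kernel L H x))\<^sup>2"
        by (rule mult_right_mono) auto
      then show "(norm (g x))\<^sup>2 \<le> (\<Sum>q\<in>A x. lq\<^sup>2 * (1 / (real q)\<^sup>2 * (norm (odd_kernel L H x))\<^sup>2))"
        by (simp add: g_def norm_mult power_mult_distrib sum_distrib_left sum_distrib_right mult.assoc)
    qed
    also have "\<dots> = (\<Sum>q=1..Q. \<Sum>a<q. lq\<^sup>2 * (1 / (real q)\<^sup>2 * (?k a q)\<^sup>2))"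
      unfolding A_def by (rule sum_farey_swap [symmetric])
    also have "\<dots> \<le> (\<Sum>q=1..Q. lq\<^sup>2 * (1 / (real q)\<^sup>2 * (8 * lh * lq * real q / real L)))"
    proof (rule sum_mono)
      fix q assume q: "q \<in> {1..Q}"
      \<comment> \<open>The frequency 0 occurs for every \<open>q\<close> and would carry no decay
        in \<open>L\<close>; it drops out because the kernel is odd.\<close>
      have "(\<Sum>a<q. (?k a q)\<^sup>2) = (\<Sum>a\<in>{0<..<q}. (?k a q)\<^sup>2)"
        by (rule sum.mono_neutral_right) (auto simp: not_less)
      also have "\<dots> \<le> (\<Sum>a\<in>{0<..<q}. 2 * lh * (2 / real L * (real q / real a + real q / real (q - a))))"
      proof (rule sum_mono)
        fix a assume a: "a \<in> {0<..<q}"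
        have x: "0 < real a / real q" "real a / real q < 1" using a by auto
        \<comment> \<open>One factor is bounded trivially and only the other by its decay. The
          square of the decay would sum over \<open>a\<close> to order \<open>q^2\<close>, and with
          the weight \<open>1 / q^2\<close> the sum over \<open>q\<close> would be of order
          \<open>Q\<close> instead of a logarithm.\<close>
        have "?k a q * ?k a q
          \<le> (2 * lh) * (2 / real L * (1 / (real a / real q) + 1 / (1 - real a / real q)))"
          unfolding lh_def using l norm_odd_kernel_le norm_odd_kernel_le' [OF x assms(2)]
          by (intro mult_mono) (auto simp: lh_def)
        also have "1 / (real a / real q) + 1 / (1 - real a / real q) = real q / real a + real q / real (q - a)"
          using a by (simp add: of_nat_diff field_simps)
        finally show "(?k a q)\<^sup>2 \<le> 2 * lh * (2 / real L * (real q / real a + real q / real (q - a)))"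
          by (simp only: power2_eq_square)
      qed
      also have "\<dots> = 4 * lh * real q / real L * ((\<Sum>a\<in>{0<..<q}. 1 / real a) + (\<Sum>a\<in>{0<..<q}. 1 / real (q - a)))"
      proof -
        have "2 * lh * (2 / l * (p / x + p / y)) = 4 * lh * p / l * (1 / x + 1 / y)" for l p x y :: real
          by (simp add: divide_inverse algebra_simps)
        then show ?thesis unfolding sum.distrib [symmetric] sum_distrib_left by (intro sum.cong refl)
      qed
      also have "(\<Sum>a\<in>{0<..<q}. 1 / real (q - a)) = (\<Sum>a\<in>{0<..<q}. 1 / real a)"
        by (rule sum.reindex_bij_witness [of _ "\<lambda>a. q - a" "\<lambda>a. q - a"]) auto
      also have "4 * lh * real q / real L * ((\<Sum>a\<in>{0<..<q}. 1 / real a) + (\<Sum>a\<in>{0<..<q}. 1 / real a)) \<le> 4 * lh * real q / real L * (lq + lq)"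
      proof -
        have "(\<Sum>a\<in>{0<..<q}. 1 / real a) \<le> (\<Sum>a=1..Q. 1 / real a)" using q by (intro sum_mono2) auto
        also have "\<dots> \<le> lq" unfolding lq_def by (rule harm_le)
        finally show ?thesis using l by (intro mult_left_mono add_mono) auto
      qed
      finally have "(\<Sum>a<q. (?k a q)\<^sup>2) \<le> 8 * lh * lq * real q / real L" by (simp add: mult_ac)
      then have "lq\<^sup>2 * (1 / (real q)\<^sup>2 * (\<Sum>a<q. (?k a q)\<^sup>2)) \<le> lq\<^sup>2 * (1 / (real q)\<^sup>2 * (8 * lh * lq * real q / real L))"
        by (intro mult_left_mono) auto
      then show "(\<Sum>a<q. lq\<^sup>2 * (1 / (real q)\<^sup>2 * (?k a q)\<^sup>2)) \<le> lq\<^sup>2 * (1 / (real q)\<^sup>2 * (8 * lh * lq * real q / real L))"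
        by (simp only: sum_distrib_left)
    qed
    also have "\<dots> = 8 * lh * lq ^ 3 / real L * (\<Sum>q=1..Q. 1 / real q)"
      unfolding sum_distrib_left by (intro sum.cong refl) (simp add: field_simps power2_eq_square power3_eq_cube)
    also have "\<dots> \<le> 8 * lh * lq ^ 3 / real L * lq"
      using l unfolding lq_def by (intro mult_left_mono harm_le) auto
    also have "\<dots> = 8 * lh * lq ^ 4 / real L" by (simp add: power3_eq_cube power4_eq_xxxx)
    finally show ?thesis .
  qed
  finally show ?thesis by (simp add: lq_def lh_def mult_left_mono)
qed

section \<open>Sums of two squares in a block\<close>

text \<open>Divisors beyond \<open>D\<close> are indexed by their cofactor \<open>e\<close>, for
  which \<open>d > D\<close> becomes \<open>e * D < m\<close>.\<close>

lemma chi_sum_hyperbola: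
  assumes "m > 0"
  shows "(\<Sum>d | d dvd m. chr d) =
    (\<Sum>d=1..D. if d dvd m then chr d else 0) +
    (\<Sum>e | e dvd m \<and> e * D < m. chr (m div e))"
proof -
  have fin: "finite {d. d dvd m}" using assms by simp
  have un: "{d. d dvd m} = {d \<in> {1..D}. d dvd m} \<union> {d. d dvd m \<and> D < d}"
    using assms by (auto simp: Suc_le_eq intro: dvd_pos_nat)
  have "(\<Sum>d | d dvd m. chr d)
      = (\<Sum>d\<in>{d \<in> {1..D}. d dvd m}. chr d) + (\<Sum>d\<in>{d. d dvd m \<and> D < d}. chr d)"
    by (subst un, rule sum.union_disjoint) (use fin in auto)
  also have "(\<Sum>d\<in>{d \<in> {1..D}. d dvd m}. chr d)
      = (\<Sum>d=1..D. if d dvd m then chr d else 0)"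
    by (rule sum.inter_filter) simp
  also have "(\<Sum>d\<in>{d. d dvd m \<and> D < d}. chr d) = (\<Sum>e | e dvd m \<and> e * D < m. chr (m div e))"
  proof (rule sum.reindex_bij_witness [of _ "\<lambda>e. m div e" "\<lambda>d. m div d"])
    fix d assume "d \<in> {d. d dvd m \<and> D < d}"
    then obtain e where d: "m = d * e" "D < d" by auto
    then have "e > 0" "d > 0" using assms by auto
    then show "m div (m div d) = d" "m div d \<in> {e. e dvd m \<and> e * D < m}"
      "chr (m div (m div d)) = chr d" using d by auto
  next
    fix e assume "e \<in> {e. e dvd m \<and> e * D < m}"
    then obtain d where d: "m = e * d" "e * D < m" by auto
    then have "e > 0" "d > 0" using assms by auto
    then show "m div (m div e) = e" "m div e \<in> {d. d dvd m \<and> D < d}" using d by auto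
  qed
  finally show ?thesis .
qed

lemma chi_eq_residues: "chi k = (if 4 dvd k - 1 then 1 else 0) - (if 4 dvd k - 3 then 1 else 0)"
  unfolding chi_def by presburger

text \<open>The quotient \<open>m div e\<close> is exact and congruent to 1 or 3 modulo 4 precisely
  when \<open>m\<close> lies in the class of \<open>e\<close> or \<open>3 * e\<close> modulo
  \<open>4 * e\<close>. This is why cofactors up to \<open>E\<close> need moduli up to
  \<open>4 * E\<close>.\<close>

lemma chi_quotient:
  fixes e m :: int
  assumes "e > 0"
  shows "(if e dvd m then chi (m div e) else 0) = (if 4 * e dvd m - e then 1 else 0) - (if 4 * e dvd m - 3 * e then 1 else 0)"
proof (cases "e dvd m")
  case True
  then obtain k where k: "m = e * k" by blast
  have "4 * e dvd m - e \<longleftrightarrow> 4 dvd k - 1" "4 * e dvd m - 3 * e \<longleftrightarrow> 4 dvd k - 3"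
  proof -
    have "m - e = (k - 1) * e" "m - 3 * e = (k - 3) * e" by (simp_all add: k algebra_simps)
    then show "4 * e dvd m - e \<longleftrightarrow> 4 dvd k - 1" "4 * e dvd m - 3 * e \<longleftrightarrow> 4 dvd k - 3" using assms by simp_all
  qed
  moreover have "m div e = k" using assms k by simp
  ultimately show ?thesis using True by (simp only: chi_eq_residues if_True)
next
  case False
  have "e dvd m" if "4 * e dvd m - e"
    using dvd_add [of e "m - e" e] dvd_mult_right [OF that] by simp
  moreover have "e dvd m" if "4 * e dvd m - 3 * e"
    using dvd_add [of e "m - 3 * e" "3 * e"] dvd_mult_right [OF that] by simp
  ultimately show ?thesis using False by auto
qed

text \<open>The exact hyperbola identity cuts \<open>e\<close> at \<open>m/D\<close>. Freezing the cut-off at \<open>E\<close> makes this a fixed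
  combination of residue classes throughout a block, as the large sieve requires.\<close>
definition trunc_r2 :: "nat \<Rightarrow> nat \<Rightarrow> nat \<Rightarrow> real" where
  "trunc_r2 D E m = 4 * ((\<Sum>d=1..D. if d dvd m then chr d else 0) +
     (\<Sum>e=1..E. if e dvd m then chr (m div e) else 0))"

text \<open>A \<open>class_sum\<close> allows one class per modulus, hence three of them: class 0
  for the divisors, and for the moduli \<open>4 * e\<close> the classes \<open>e\<close> and
  \<open>3 * e\<close>, where \<open>e\<close> is recovered as \<open>q div 4\<close>.\<close>

lemma trunc_r2_eq_class_sum:
  assumes "D + 4 * E \<le> Q"
  shows "trunc_r2 D E m = 4 *
    (class_sum (\<lambda>q. if q \<le> D then chr q else 0) (\<lambda>q. 0) Q (int m) +
     class_sum (\<lambda>q. if 4 dvd q \<and> q \<le> 4 * E then 1 else 0) (\<lambda>q. int (q div 4)) Q (int m) -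
     class_sum (\<lambda>q. if 4 dvd q \<and> q \<le> 4 * E then 1 else 0) (\<lambda>q. 3 * int (q div 4)) Q (int m))"
proof -
  let ?C = "class_sum (\<lambda>q. if 4 dvd q \<and> q \<le> 4 * E then 1 else 0)"
  have 1: "class_sum (\<lambda>q. if q \<le> D then chr q else 0) (\<lambda>q. 0) Q (int m)
      = (\<Sum>d=1..D. if d dvd m then chr d else 0)"
    unfolding class_sum_def
    by (rule sum.mono_neutral_cong_right) (use assms in auto)
  have 2: "?C (\<lambda>q. k * int (q div 4)) Q (int m)
      = (\<Sum>e=1..E. if 4 * int e dvd int m - k * int e then 1 else 0)" for k
  proof -
    have "?C (\<lambda>q. k * int (q div 4)) Q (int m)
      = (\<Sum>q\<in>(\<lambda>e. 4 * e) ` {1..E}. if int q dvd int m - k * int (q div 4) then 1 else 0)"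
      unfolding class_sum_def
    proof (rule sum.mono_neutral_cong_right)
      show "\<forall>q\<in>{1..Q} - (\<lambda>e. 4 * e) ` {1..E}. (if 4 dvd q \<and> q \<le> 4 * E then 1 else 0) * (if int q dvd int m - k * int (q div 4) then 1 else 0) = (0::real)"
        by (auto simp: image_iff)
    qed (use assms in auto)
    also have "\<dots> = (\<Sum>e=1..E. if 4 * int e dvd int m - k * int e then 1 else 0)"
      by (subst sum.reindex) (auto simp: inj_on_def)
    finally show ?thesis .
  qed
  have 3: "(\<Sum>e=1..E. if e dvd m then chr (m div e) else 0)
      = (\<Sum>e=1..E. if 4 * int e dvd int m - 1 * int e then 1 else 0) - (\<Sum>e=1..E. if 4 * int e dvd int m - 3 * int e then 1 else 0)"
    unfolding sum_subtractf [symmetric]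
  proof (intro sum.cong refl)
    fix e assume "e \<in> {1..E}"
    then have "(if int e dvd int m then chi (int m div int e) else 0)
       = (if 4 * int e dvd int m - int e then 1 else 0) - (if 4 * int e dvd int m - 3 * int e then 1 else 0)"
      by (intro chi_quotient) auto
    from arg_cong [where f = real_of_int, OF this]
    show "(if e dvd m then chr (m div e) else 0)
      = (if 4 * int e dvd int m - 1 * int e then 1 else 0) - (if 4 * int e dvd int m - 3 * int e then 1 else 0)"
      by (auto simp: zdiv_int split: if_splits)
  qed
  show ?thesis unfolding trunc_r2_def 3 1 [symmetric] 2 [symmetric] by simp
qed

lemma r2_trunc_error:
  assumes m: "lo < m" "m \<le> hi" and N: "lo \<le> N" "N \<le> hi" and D: "D \<ge> 1" "D \<le> lo"
  shows "\<bar>rr m - trunc_r2 D (N div D) m\<bar> \<le> 4 * (\<Sum>e=lo div D..hi div D. if e dvd m then 1 else 0)"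
proof -
  have m0: "m > 0" using m by simp
  define f where "f = (\<lambda>e. chr (m div e))"
  define A where "A = {e. e dvd m \<and> e * D < m}"
  define B where "B = {e \<in> {1..N div D}. e dvd m}"
  define C where "C = {e \<in> {lo div D..hi div D}. e dvd m}"
  have fin: "finite A" "finite B" "finite C" using m0 by (auto simp: A_def B_def C_def)
  have AC: "A - B \<subseteq> C"
  proof
    fix e assume e: "e \<in> A - B"
    then have "e > 0" using m0 by (auto simp: A_def intro: dvd_pos_nat)
    then have "N div D < e" using e by (auto simp: A_def B_def)
    then have "lo div D \<le> e" using div_le_mono [OF N(1), of D] by simp
    moreover have "e * D \<le> hi" using e m by (auto simp: A_def)
    then have "e \<le> hi div D" using D by (simp add: less_eq_div_iff_mult_less_eq)
    ultimately show "e \<in> C" using e by (auto simp: A_def C_def)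
  qed
  have BC: "B - A \<subseteq> C"
  proof
    fix e assume e: "e \<in> B - A"
    then have "lo < e * D" using m by (auto simp: A_def B_def)
    then have "lo div D \<le> e" using D by (metis div_le_mono div_mult_self_is_m less_imp_le_nat less_le_trans zero_less_one)
    moreover have "e \<le> hi div D" using e div_le_mono [OF N(2), of D] by (auto simp: B_def)
    ultimately show "e \<in> C" using e by (auto simp: B_def C_def)
  qed
  have "rr m - trunc_r2 D (N div D) m = 4 * (sum f A - sum f B)"
    unfolding r2_eq_divisor_sum [OF m0] chi_sum_hyperbola [OF m0, of D] trunc_r2_def A_def B_def f_def
    by (simp only: sum.inter_filter finite_atLeastAtMost) (simp add: algebra_simps)
  also have "sum f A - sum f B = sum f (A - B) - sum f (B - A)"
  proof -
    have "sum f A = sum f (A - B) + sum f (A \<inter> B)" "sum f B = sum f (B - A) + sum f (A \<inter> B)"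
      using sum.Int_Diff [OF fin(1), of f B] sum.Int_Diff [OF fin(2), of f A] by (simp_all add: Int_commute)
    then show ?thesis by simp
  qed
  also have "\<bar>4 * (sum f (A - B) - sum f (B - A))\<bar> \<le> 4 * real (card C)"
  proof -
    have f: "\<bar>f e\<bar> \<le> 1" for e by (simp add: f_def abs_chi_le)
    have "\<bar>sum f X\<bar> \<le> real (card X)" for X
      using order_trans [OF sum_abs [of f X] sum_mono [of X "\<lambda>e. \<bar>f e\<bar>" "\<lambda>e. 1"]] f by simp
    from this [of "A - B"] this [of "B - A"]
    have "\<bar>sum f (A - B)\<bar> \<le> real (card (A - B))" "\<bar>sum f (B - A)\<bar> \<le> real (card (B - A))" .
    moreover have "card (A - B) + card (B - A) = card ((A - B) \<union> (B - A))"
      by (rule card_Un_disjoint [symmetric]) (use fin in auto)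
    moreover have "card ((A - B) \<union> (B - A)) \<le> card C" using AC BC fin by (intro card_mono) auto
    ultimately have "\<bar>sum f (A - B)\<bar> \<le> real (card (A - B))" "\<bar>sum f (B - A)\<bar> \<le> real (card (B - A))"
      "real (card (A - B)) + real (card (B - A)) \<le> real (card C)" by linarith+
    then show ?thesis by argo
  qed
  also have "real (card C) = (\<Sum>e=lo div D..hi div D. if e dvd m then 1 else 0)"
    unfolding C_def by (subst sum.inter_filter [symmetric]) auto
  finally show ?thesis .
qed

lemma count_multiples_interval:
  assumes "e \<ge> 1"
  shows "(\<Sum>m\<in>{a<..a + M}. if e dvd m then 1 else 0 :: real) \<le> real M / real e + 1"
proof -
  have "{m \<in> {1..a + M}. e dvd m} = {m \<in> {1..a}. e dvd m} \<union> {m \<in> {a<..a + M}. e dvd m}" by auto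
  then have "card {m \<in> {1..a + M}. e dvd m} = card {m \<in> {1..a}. e dvd m} + card {m \<in> {a<..a + M}. e dvd m}"
    by (simp only:) (rule card_Un_disjoint, auto)
  then have "(a + M) div e = a div e + card {m \<in> {a<..a + M}. e dvd m}"
    using assms by (simp only: card_multiples_atMost)
  then have "real (card {m \<in> {a<..a + M}. e dvd m}) = real ((a + M) div e) - real (a div e)" by linarith
  also have "\<dots> \<le> real (a + M) / real e - (real a / real e - 1)"
    using nat_div_real_bounds(1) [of "a + M" e] nat_div_real_bounds(2) [of a e] by linarith
  also have "\<dots> = real M / real e + 1" by (simp add: add_divide_distrib)
  finally show ?thesis by (subst sum.inter_filter [symmetric]) auto
qed

definition odd_sum :: "nat \<Rightarrow> nat \<Rightarrow> nat \<Rightarrow> real" where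
  "odd_sum n a b = (\<Sum>h\<in>{a<..b}. (rr (n + h) - rr (n - h)) / real h)"

lemma trunc_variance:
  assumes "L \<ge> 1" "M \<ge> 1" "Q \<ge> 1" "H \<ge> 1" "D + 4 * E \<le> Q" "H \<le> N"
  shows "(\<Sum>t=1..M. (\<Sum>h\<in>{L<..H}. (trunc_r2 D E (N + t + h) - trunc_r2 D E (N + t - h)) / real h)\<^sup>2)
    \<le> 144 * ((4 * real M + 16 * (real Q)^4 / real M) * (8 * (1 + ln (real H)) * (1 + ln (real Q))^4 / real L))"
proof -
  let ?V = "(4 * real M + 16 * (real Q)^4 / real M) * (8 * (1 + ln (real H)) * (1 + ln (real Q))^4 / real L)"
  define c1 where "c1 = class_sum (\<lambda>q. if q \<le> D then chr q else 0) (\<lambda>q. 0) Q"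
  define c2 where "c2 = class_sum (\<lambda>q. if 4 dvd q \<and> q \<le> 4 * E then 1 else 0) (\<lambda>q. int (q div 4)) Q"
  define c3 where "c3 = class_sum (\<lambda>q. if 4 dvd q \<and> q \<le> 4 * E then 1 else 0) (\<lambda>q. 3 * int (q div 4)) Q"
  define G where "G = (\<lambda>c t. \<Sum>h\<in>{L<..H}. (c (int N + int t + int h) - c (int N + int t - int h)) / real h :: real)"
  have G: "(\<Sum>t=1..M. (G c1 t)\<^sup>2) \<le> ?V" "(\<Sum>t=1..M. (G c2 t)\<^sup>2) \<le> ?V" "(\<Sum>t=1..M. (G c3 t)\<^sup>2) \<le> ?V"
    unfolding G_def c1_def c2_def c3_def
    by (rule class_sum_variance; use assms abs_chi_le in simp)+
  have "(\<Sum>t=1..M. (\<Sum>h\<in>{L<..H}. (trunc_r2 D E (N + t + h) - trunc_r2 D E (N + t - h)) / real h)\<^sup>2)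
      = (\<Sum>t=1..M. (4 * (G c1 t + G c2 t - G c3 t))\<^sup>2)"
  proof (intro sum.cong refl arg_cong [where f = "\<lambda>x. x\<^sup>2"])
    fix t assume t: "t \<in> {1..M}"
    have "(trunc_r2 D E (N + t + h) - trunc_r2 D E (N + t - h)) / real h
       = 4 * ((c1 (int N + int t + int h) - c1 (int N + int t - int h)) / real h
         + (c2 (int N + int t + int h) - c2 (int N + int t - int h)) / real h
         - (c3 (int N + int t + int h) - c3 (int N + int t - int h)) / real h)" if h: "h \<in> {L<..H}" for h
    proof -
      have "int (N + t - h) = int N + int t - int h" using h t assms by auto
      then show ?thesis
        unfolding trunc_r2_eq_class_sum [OF assms(5)] c1_def c2_def c3_def
        by (simp add: diff_divide_distrib add_divide_distrib algebra_simps)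
    qed
    then show "(\<Sum>h\<in>{L<..H}. (trunc_r2 D E (N + t + h) - trunc_r2 D E (N + t - h)) / real h) = 4 * (G c1 t + G c2 t - G c3 t)"
      unfolding G_def by (simp add: sum_distrib_left flip: sum.distrib sum_subtractf)
  qed
  \<comment> \<open>Cauchy's inequality for three terms turns the factor \<open>4^2\<close> into 48;
    adding three variances gives 144.\<close>
  also have "\<dots> \<le> (\<Sum>t=1..M. 48 * (G c1 t)\<^sup>2 + 48 * (G c2 t)\<^sup>2 + 48 * (G c3 t)\<^sup>2)"
  proof (rule sum_mono)
    fix t
    have "(4 * (x + y - z))\<^sup>2 \<le> 48 * x\<^sup>2 + 48 * y\<^sup>2 + 48 * z\<^sup>2" for x y z :: real
    proof -
      have "48 * x\<^sup>2 + 48 * y\<^sup>2 + 48 * z\<^sup>2 - (4 * (x + y - z))\<^sup>2 = 16 * ((x - y)\<^sup>2 + (x + z)\<^sup>2 + (y + z)\<^sup>2)"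
        by (simp add: power2_eq_square algebra_simps)
      moreover have "16 * ((x - y)\<^sup>2 + (x + z)\<^sup>2 + (y + z)\<^sup>2) \<ge> 0" by (intro mult_nonneg_nonneg add_nonneg_nonneg) auto
      ultimately show ?thesis by linarith
    qed
    then show "(4 * (G c1 t + G c2 t - G c3 t))\<^sup>2 \<le> 48 * (G c1 t)\<^sup>2 + 48 * (G c2 t)\<^sup>2 + 48 * (G c3 t)\<^sup>2" .
  qed
  also have "\<dots> = 48 * ((\<Sum>t=1..M. (G c1 t)\<^sup>2) + (\<Sum>t=1..M. (G c2 t)\<^sup>2) + (\<Sum>t=1..M. (G c3 t)\<^sup>2))"
    by (simp add: sum.distrib sum_distrib_left)
  also have "\<dots> \<le> 48 * (?V + ?V + ?V)" using G by (intro mult_left_mono add_mono) auto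
  also have "48 * (v + v + v) = 144 * v" for v :: real by simp
  finally show ?thesis .
qed

text \<open>The three terms come from the mean square of the truncation, from the moduli near the moving
  hyperbola cut-off, and from the shifts between the two inner cut-offs \<open>L1\<close> and \<open>L2\<close>.\<close>
lemma block_bad_count:
  assumes L: "1 \<le> L1" "L1 \<le> L2" "L2 \<le> H" and M: "M \<ge> 1" and D: "1 \<le> D" "D + H \<le> N"
    and Q: "D + 4 * (N div D) \<le> Q"
  defines "E1 \<equiv> (N - H) div D" and "E2 \<equiv> (N + M + H) div D"
  shows "real (card {n \<in> {N<..N + M}. \<exists>L\<in>{L1..L2}. \<bar>odd_sum n L H\<bar> > 3})
    \<le> 144 * ((4 * real M + 16 * (real Q)^4 / real M) * (8 * (1 + ln (real H)) * (1 + ln (real Q))^4 / real L1))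
     + 8 * (1 + ln (real H)) * (real (E2 + 1 - E1) * (real M / real E1 + 1))
     + 2 * (real (L2 - L1) / real L1) * (pi * real M + 24 * sqrt (real (N + M + H)))"
proof -
  let ?V = "144 * ((4 * real M + 16 * (real Q)^4 / real M) * (8 * (1 + ln (real H)) * (1 + ln (real Q))^4 / real L1))"
  let ?W = "pi * real M + 24 * sqrt (real (N + M + H))"
  let ?N = "{n \<in> {N<..N + M}. \<exists>L\<in>{L1..L2}. \<bar>odd_sum n L H\<bar> > 3}"
  let ?X = "real M / real E1 + 1"
  define E where "E = N div D"
  define I where "I = (\<lambda>e m::nat. if e dvd m then 1 else 0 :: real)"
  define G where "G = (\<lambda>n. \<Sum>h\<in>{L1<..H}. (trunc_r2 D E (n + h) - trunc_r2 D E (n - h)) / real h)"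
  define T where "T = (\<lambda>n. \<Sum>h\<in>{L1<..H}. (1 / real h) * (4 * (\<Sum>e=E1..E2. I e (n + h) + I e (n - h))))"
  define U where "U = (\<lambda>n. \<Sum>h\<in>{L1<..L2}. (rr (n + h) + rr (n - h)) / real h)"
  have NH: "N > H" "N - H \<ge> D" using D by auto
  have E1: "E1 \<ge> 1" unfolding E1_def using D NH by (simp add: Suc_le_eq div_greater_zero_iff)
  have E12: "E1 \<le> E2" unfolding E1_def E2_def by (intro div_le_mono) auto
  have TU: "T n \<ge> 0" "U n \<ge> 0" for n
    by (auto simp: T_def U_def I_def intro!: sum_nonneg mult_nonneg_nonneg divide_nonneg_nonneg add_nonneg_nonneg)
  have err: "\<bar>rr m - trunc_r2 D E m\<bar> \<le> 4 * (\<Sum>e=E1..E2. I e m)" if "N - H < m" "m \<le> N + M + H" for m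
    unfolding E_def E1_def E2_def I_def using that NH D by (intro r2_trunc_error) auto
  \<comment> \<open>The sieve is applied once, with the inner cut-off \<open>L1\<close>. The shifts
    from \<open>L1\<close> to \<open>L\<close> are taken in absolute value, so that one bound serves
    every \<open>L\<close> of the block.\<close>
  have main: "\<bar>odd_sum n L H\<bar> \<le> \<bar>G n\<bar> + T n + U n" if n: "n \<in> {N<..N + M}" and LL: "L \<in> {L1..L2}" for n L
  proof -
    have un: "{L1<..H} = {L1<..L} \<union> {L<..H}" "{L1<..L} \<inter> {L<..H} = {}" using L LL by auto
    have "odd_sum n L1 H = odd_sum n L1 L + odd_sum n L H"
      unfolding odd_sum_def by (subst un(1), rule sum.union_disjoint) (use un(2) in auto)
    moreover have "\<bar>odd_sum n L1 L\<bar> \<le> U n"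
    proof -
      have "\<bar>odd_sum n L1 L\<bar> \<le> (\<Sum>h\<in>{L1<..L}. (rr (n + h) + rr (n - h)) / real h)"
        unfolding odd_sum_def by (intro order_trans [OF sum_abs] sum_mono) (auto intro!: divide_right_mono)
      also have "\<dots> \<le> U n" unfolding U_def using LL by (intro sum_mono2) auto
      finally show ?thesis .
    qed
    moreover have "\<bar>odd_sum n L1 H - G n\<bar> \<le> T n"
    proof -
      have "odd_sum n L1 H - G n = (\<Sum>h\<in>{L1<..H}. (1 / real h) * ((rr (n + h) - trunc_r2 D E (n + h)) - (rr (n - h) - trunc_r2 D E (n - h))))"
        unfolding odd_sum_def G_def sum_subtractf [symmetric] by (intro sum.cong refl) (simp add: diff_divide_distrib)
      also have "\<bar>\<dots>\<bar> \<le> T n"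
        unfolding T_def
      proof (intro order_trans [OF sum_abs] sum_mono)
        fix h assume h: "h \<in> {L1<..H}"
        have "\<bar>(rr (n + h) - trunc_r2 D E (n + h)) - (rr (n - h) - trunc_r2 D E (n - h))\<bar>
          \<le> 4 * (\<Sum>e=E1..E2. I e (n + h)) + 4 * (\<Sum>e=E1..E2. I e (n - h))"
        proof -
          have "N - H < n + h" "n + h \<le> N + M + H" "N - H < n - h" "n - h \<le> N + M + H"
            using n h NH by auto
          then show ?thesis using err [of "n + h"] err [of "n - h"] by linarith
        qed
        also have "\<dots> = 4 * (\<Sum>e=E1..E2. I e (n + h) + I e (n - h))" by (simp add: sum.distrib)
        finally show "\<bar>(1 / real h) * ((rr (n + h) - trunc_r2 D E (n + h)) - (rr (n - h) - trunc_r2 D E (n - h)))\<bar>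
           \<le> (1 / real h) * (4 * (\<Sum>e=E1..E2. I e (n + h) + I e (n - h)))"
          unfolding abs_mult by (intro mult_mono) auto
      qed
      finally show ?thesis .
    qed
    ultimately show ?thesis by argo
  qed
  have "real (card ?N)
      = (\<Sum>n\<in>?N. 1)" by simp
  also have "\<dots> \<le> (\<Sum>n\<in>?N. (G n)\<^sup>2 + T n + U n)"
  proof (rule sum_mono)
    fix n assume "n \<in> ?N"
    then obtain L where "n \<in> {N<..N + M}" "L \<in> {L1..L2}" "\<bar>odd_sum n L H\<bar> > 3" by blast
    then have "\<bar>G n\<bar> + T n + U n > 3" using main [of n L] by simp
    \<comment> \<open>The threshold 3 leaves 1 for each part. A large \<open>G\<close> is counted by
      Chebyshev's inequality, and the nonnegative \<open>T\<close> and \<open>U\<close> by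
      Markov's.\<close>
    then consider "\<bar>G n\<bar> \<ge> 1" | "T n \<ge> 1" | "U n \<ge> 1" by linarith
    then show "1 \<le> (G n)\<^sup>2 + T n + U n"
    proof cases
      case 1
      then have "1\<^sup>2 \<le> \<bar>G n\<bar>\<^sup>2" by (intro power_mono) auto
      then show ?thesis using TU [of n] by simp
    next
      case 2
      then show ?thesis using TU [of n] zero_le_power2 [of "G n"] by linarith
    next
      case 3
      then show ?thesis using TU [of n] zero_le_power2 [of "G n"] by linarith
    qed
  qed
  also have "\<dots> \<le> (\<Sum>n\<in>{N<..N + M}. (G n)\<^sup>2 + T n + U n)"
    using TU by (intro sum_mono2) auto
  also have "\<dots> = (\<Sum>n\<in>{N<..N + M}. (G n)\<^sup>2) + (\<Sum>n\<in>{N<..N + M}. T n) + (\<Sum>n\<in>{N<..N + M}. U n)"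
    by (simp add: sum.distrib)
  also have "\<dots> \<le> ?V
     + 8 * (1 + ln (real H)) * (real (E2 + 1 - E1) * ?X)
     + 2 * (real (L2 - L1) / real L1) * ?W"
  proof (intro add_mono)
    have "(\<Sum>n\<in>{N<..N + M}. (G n)\<^sup>2) = (\<Sum>t=1..M. (G (N + t))\<^sup>2)"
      by (rule sum.reindex_bij_witness [of _ "\<lambda>t. N + t" "\<lambda>n. n - N"]) auto
    also have "\<dots> \<le> ?V"
      unfolding G_def by (rule trunc_variance) (use L M D Q NH in \<open>auto simp: E_def\<close>)
    finally show "(\<Sum>n\<in>{N<..N + M}. (G n)\<^sup>2) \<le> ?V" .
  next
    have cnt: "(\<Sum>n\<in>{N<..N + M}. I e (n + h)) \<le> ?X" "(\<Sum>n\<in>{N<..N + M}. I e (n - h)) \<le> ?X"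
      if e: "e \<in> {E1..E2}" and h: "h \<in> {L1<..H}" for e h
    proof -
      have le: "real M / real e + 1 \<le> ?X" using e E1 by (auto intro!: divide_left_mono)
      have "(\<Sum>n\<in>{N<..N + M}. I e (n + h)) = (\<Sum>m\<in>{N + h<..N + h + M}. I e m)"
        by (rule sum.reindex_bij_witness [of _ "\<lambda>m. m - h" "\<lambda>n. n + h"]) auto
      also have "\<dots> \<le> real M / real e + 1" unfolding I_def using e E1 by (intro count_multiples_interval) auto
      finally show "(\<Sum>n\<in>{N<..N + M}. I e (n + h)) \<le> ?X" using le by simp
      have "(\<Sum>n\<in>{N<..N + M}. I e (n - h)) = (\<Sum>m\<in>{N - h<..N - h + M}. I e m)"
        by (rule sum.reindex_bij_witness [of _ "\<lambda>m. m + h" "\<lambda>n. n - h"]) (use h NH in auto)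
      also have "\<dots> \<le> real M / real e + 1" unfolding I_def using e E1 by (intro count_multiples_interval) auto
      finally show "(\<Sum>n\<in>{N<..N + M}. I e (n - h)) \<le> ?X" using le by simp
    qed
    have "(\<Sum>n\<in>{N<..N + M}. T n) = (\<Sum>h\<in>{L1<..H}. (1 / real h) * (4 * (\<Sum>e=E1..E2. (\<Sum>n\<in>{N<..N + M}. I e (n + h)) + (\<Sum>n\<in>{N<..N + M}. I e (n - h)))))"
    proof -
      have "(\<Sum>n\<in>{N<..N + M}. (1 / real h) * (4 * (\<Sum>e=E1..E2. I e (n + h) + I e (n - h))))
        = (1 / real h) * (4 * (\<Sum>e=E1..E2. (\<Sum>n\<in>{N<..N + M}. I e (n + h)) + (\<Sum>n\<in>{N<..N + M}. I e (n - h))))" for h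
      proof -
        have "(\<Sum>n\<in>{N<..N + M}. \<Sum>e=E1..E2. I e (n + h) + I e (n - h))
          = (\<Sum>e=E1..E2. (\<Sum>n\<in>{N<..N + M}. I e (n + h)) + (\<Sum>n\<in>{N<..N + M}. I e (n - h)))"
          by (subst sum.swap) (simp only: sum.distrib)
        then show ?thesis by (simp only: sum_distrib_left [symmetric])
      qed
      then show ?thesis unfolding T_def by (subst sum.swap) (simp only:)
    qed
    also have "\<dots> \<le> (\<Sum>h\<in>{L1<..H}. (1 / real h) * (4 * (\<Sum>e=E1..E2. ?X + ?X)))"
      using cnt by (intro sum_mono mult_left_mono add_mono) auto
    also have "\<dots> = 8 * (\<Sum>h\<in>{L1<..H}. 1 / real h) * (real (E2 + 1 - E1) * ?X)"
    proof -
      have "4 * (\<Sum>e=E1..E2. X + X) = 8 * (real (E2 + 1 - E1) * X)" for X :: real by simp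
      then show ?thesis by (simp only: sum_distrib_right [symmetric] mult_ac)
    qed
    also have "\<dots> \<le> 8 * (1 + ln (real H)) * (real (E2 + 1 - E1) * ?X)"
    proof -
      have "(\<Sum>h\<in>{L1<..H}. 1 / real h) \<le> (\<Sum>h=1..H. 1 / real h)" by (intro sum_mono2) auto
      also have "\<dots> \<le> 1 + ln (real H)" by (rule harm_le)
      finally show ?thesis by (intro mult_right_mono mult_left_mono mult_nonneg_nonneg) auto
    qed
    finally show "(\<Sum>n\<in>{N<..N + M}. T n) \<le> 8 * (1 + ln (real H)) * (real (E2 + 1 - E1) * ?X)" .
  next
    have cnt: "(\<Sum>m\<in>{a<..a + M}. rr m) \<le> ?W" if "a + M \<le> N + M + H" for a
    proof -
      have "(\<Sum>m\<in>{a<..a + M}. rr m) = r2_sum (a + M) - r2_sum a" by (rule r2_sum_interval) simp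
      moreover have "sqrt (real (a + M)) \<le> sqrt (real (N + M + H))" "sqrt (real a) \<le> sqrt (real (N + M + H))" using that by (auto simp del: of_nat_add)
      moreover have "pi * real (a + M) = pi * real a + pi * real M" by (simp add: distrib_left)
      ultimately show ?thesis using circle_bound [of "a + M"] circle_bound [of a] by argo
    qed
    have "(\<Sum>n\<in>{N<..N + M}. U n) = (\<Sum>h\<in>{L1<..L2}. (1 / real h) * ((\<Sum>n\<in>{N<..N + M}. rr (n + h)) + (\<Sum>n\<in>{N<..N + M}. rr (n - h))))"
      unfolding U_def by (subst sum.swap) (simp add: sum_divide_distrib sum.distrib add_divide_distrib)
    also have "\<dots> \<le> (\<Sum>h\<in>{L1<..L2}. (1 / real L1) * (?W + ?W))"
    proof (intro sum_mono mult_mono add_mono)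
      fix h assume h: "h \<in> {L1<..L2}"
      have "(\<Sum>n\<in>{N<..N + M}. rr (n + h)) = (\<Sum>m\<in>{N + h<..N + h + M}. rr m)"
        by (rule sum.reindex_bij_witness [of _ "\<lambda>m. m - h" "\<lambda>n. n + h"]) auto
      also have "\<dots> \<le> ?W" using h L by (intro cnt) auto
      finally show "(\<Sum>n\<in>{N<..N + M}. rr (n + h)) \<le> ?W" .
      have "(\<Sum>n\<in>{N<..N + M}. rr (n - h)) = (\<Sum>m\<in>{N - h<..N - h + M}. rr m)"
        by (rule sum.reindex_bij_witness [of _ "\<lambda>m. m + h" "\<lambda>n. n - h"]) (use h NH L in auto)
      also have "\<dots> \<le> ?W" using h L by (intro cnt) auto
      finally show "(\<Sum>n\<in>{N<..N + M}. rr (n - h)) \<le> ?W" .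
      show "1 / real h \<le> 1 / real L1" using h L by (intro divide_left_mono) auto
    qed (auto intro!: sum_nonneg add_nonneg_nonneg)
    also have "\<dots> = 2 * (real (L2 - L1) / real L1) * ?W"
      by (simp add: field_simps)
    finally show "(\<Sum>n\<in>{N<..N + M}. U n) \<le> 2 * (real (L2 - L1) / real L1) * ?W" .
  qed
  finally show ?thesis .
qed

text \<open>The choice of parameters in \<open>block_bad_count\<close>, with \<open>D = H\<close> of
  order \<open>s\<close> and a target of order \<open>x / (Y * K)\<close> bad integers per block. Up
  to constants the three terms are \<open>x * K * Y * l^5 / Lam\<close>,
  \<open>x * Y * l / K^2\<close> and \<open>x * Y / K^2\<close>. The assumed size of
  \<open>Lam\<close> settles the first, and \<open>K = Y^2 * l^2\<close> the other two.\<close>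

lemma block_bad_small:
  fixes x Y l Lam K s :: real and N M H :: nat
  assumes x: "x > 0" "s = sqrt x" "l = ln x" "l \<ge> 10"
    and Y: "Y \<ge> 1" "K = Y\<^sup>2 * l\<^sup>2"
    and Lam: "K\<^sup>2 * Y\<^sup>2 * l ^ 8 \<le> Lam" "4 * Lam \<le> s"
    and H: "s \<le> real H" "real H \<le> s + 1"
    and M: "x / K \<le> real M" "real M \<le> x / K + 1"
    and N: "x / (2 * Y) \<le> real N" "real N \<le> x"
  defines "L1 \<equiv> nat \<lfloor>real N * Lam / x\<rfloor>" and "L2 \<equiv> nat \<lfloor>real (N + M) * Lam / x\<rfloor>"
  shows "real (card {n \<in> {N<..N + M}. \<exists>L\<in>{L1..L2}. \<bar>odd_sum n L H\<bar> > 3}) \<le> 4000000000 * (x / (Y * K))"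
proof -
  have xs: "x = s * s" using x by simp
  have s0: "s > 0" using x by simp
  have Y2: "Y\<^sup>2 \<ge> 1" "Y\<^sup>2 \<ge> Y" using Y(1) self_le_power [of Y 2] by auto
  have l2: "l\<^sup>2 \<ge> 100" using power_mono [of 10 l 2] x by simp
  have l8: "l ^ 8 \<ge> 100000000" using power_mono [of 10 l 8] x by simp
  have K: "K \<ge> 100" "K \<ge> Y\<^sup>2" "K \<ge> Y"
  proof -
    have "1 * 100 \<le> Y\<^sup>2 * l\<^sup>2" using Y2 l2 by (intro mult_mono) auto
    then show "K \<ge> 100" using Y by simp
    have "Y\<^sup>2 * 1 \<le> Y\<^sup>2 * l\<^sup>2" using Y2 l2 by (intro mult_mono) auto
    then show "K \<ge> Y\<^sup>2" using Y by simp
    then show "K \<ge> Y" using Y2 by simp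
  qed
  have KY: "K\<^sup>2 * Y\<^sup>2 \<ge> K" "K\<^sup>2 * Y\<^sup>2 \<ge> 1"
  proof -
    have "K * 1 \<le> (K * K) * Y\<^sup>2" using K Y2 by (intro mult_mono) (auto simp: mult_le_cancel_left1)
    then show "K\<^sup>2 * Y\<^sup>2 \<ge> K" by (simp add: power2_eq_square)
    then show "K\<^sup>2 * Y\<^sup>2 \<ge> 1" using K by simp
  qed
  have LK: "100000000 * K \<le> Lam"
  proof -
    have "K * 100000000 \<le> (K\<^sup>2 * Y\<^sup>2) * l ^ 8" using KY l8 K by (intro mult_mono) auto
    then show ?thesis using Lam by simp
  qed
  have Lam0: "Lam > 0" using LK K by simp
  have sK: "s \<ge> 400000000 * K" using LK Lam by simp
  have sY: "s \<ge> 400000000 * Y" using sK K by simp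
  have s1: "s \<ge> 1000000000" using sK K by simp
  have xK: "x / K \<ge> s"
  proof -
    have "s * K \<le> s * s" using sK K s0 by (intro mult_left_mono) auto
    then show ?thesis using K xs by (simp add: field_simps)
  qed
  have M': "real M \<le> 2 * (x / K)" "M \<ge> 1"
  proof -
    show "real M \<le> 2 * (x / K)" using M xK s1 by simp
    have "real M > 0" using M xK s1 by linarith
    then show "M \<ge> 1" by simp
  qed
  have Mx: "50 * real M \<le> x"
  proof -
    define w where "w = x / K"
    have "w \<le> x / 100" using K x unfolding w_def by (intro divide_left_mono) auto
    moreover have "real M \<le> 2 * w" using M' by (simp add: w_def)
    ultimately show ?thesis by simp
  qed
  have H': "real H \<le> 2 * s" "H \<ge> 1"
  proof -
    show "real H \<le> 2 * s" using H s1 by simp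
    have "real H > 0" using H s1 by linarith
    then show "H \<ge> 1" by simp
  qed
  have xY: "x / Y \<ge> 400000000 * s"
  proof -
    have "(400000000 * Y) * s \<le> s * s" using sY s0 by (intro mult_right_mono) auto
    then show ?thesis using Y xs by (simp add: field_simps)
  qed
  have HY: "real H \<le> x / (8 * Y)" using H' xY s1 by (simp add: field_simps)
  have NH: "real (N - H) \<ge> x / (4 * Y)" "H + H \<le> N"
  proof -
    define w where "w = x / Y"
    have w: "w / 2 \<le> real N" "real H \<le> w / 8" "w > 0" using N HY xY s0 unfolding w_def by auto
    then have "real H + real H \<le> real N" by linarith
    then show HN: "H + H \<le> N" by linarith
    have "real (N - H) = real N - real H" using HN by simp
    then have "w / 4 \<le> real (N - H)" using w by linarith
    then show "real (N - H) \<ge> x / (4 * Y)" by (simp add: w_def)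
  qed
  have L1: "real L1 \<ge> Lam / (4 * Y)" "L1 \<ge> 1"
  proof -
    have "Lam / (2 * Y) = (x / (2 * Y)) * Lam / x" using x by simp
    also have "\<dots> \<le> real N * Lam / x" using N x Lam0 by (intro divide_right_mono mult_right_mono) auto
    finally have a: "Lam / (2 * Y) \<le> real N * Lam / x" .
    have "4 * Y \<le> Lam" using LK K by linarith
    then have b: "1 \<le> Lam / (4 * Y)" using Y by simp
    have "Lam / (2 * Y) = 2 * (Lam / (4 * Y))" by simp
    then have "real L1 \<ge> Lam / (4 * Y)" using a b unfolding L1_def by linarith
    then show "real L1 \<ge> Lam / (4 * Y)" .
    then show "L1 \<ge> 1" using b by linarith
  qed
  have L12: "L1 \<le> L2" "L2 \<le> H" "real (L2 - L1) \<le> 3 * Lam / K"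
  proof -
    have le: "real N * Lam / x \<le> real (N + M) * Lam / x" using x Lam0 by (intro divide_right_mono mult_right_mono) auto
    then show L12: "L1 \<le> L2" unfolding L1_def L2_def by (intro nat_mono floor_mono)
    have nn: "real N * Lam / x \<ge> 0" using x Lam0 by simp
    have L2r: "real L2 \<le> real (N + M) * Lam / x" using nn le unfolding L2_def by linarith
    have "real (N + M) \<le> 2 * x" using N Mx x by simp
    then have "real (N + M) * Lam / x \<le> (2 * x) * Lam / x" using x Lam0 by (intro divide_right_mono mult_right_mono) auto
    also have "\<dots> = 2 * Lam" using x by simp
    finally have "real L2 \<le> 2 * Lam" using L2r by linarith
    then have "real L2 \<le> real H" using Lam H Lam0 by linarith
    then show "L2 \<le> H" by simp
    have "real L1 \<ge> real N * Lam / x - 1" unfolding L1_def using nn by linarith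
    then have "real (L2 - L1) \<le> real (N + M) * Lam / x - real N * Lam / x + 1" using L2r L12 by (simp add: of_nat_diff)
    also have "real (N + M) * Lam / x - real N * Lam / x = real M * Lam / x" by (simp add: distrib_right add_divide_distrib)
    also have "real M * Lam / x \<le> (2 * (x / K)) * Lam / x" using M' x Lam0 by (intro divide_right_mono mult_right_mono) auto
    also have "\<dots> = 2 * Lam / K" using x by simp
    finally have "real (L2 - L1) \<le> 2 * Lam / K + 1" by simp
    moreover have "1 \<le> Lam / K" using LK K by simp
    ultimately show "real (L2 - L1) \<le> 3 * Lam / K" by simp
  qed
  define Q where "Q = H + 4 * (N div H)"
  have Q: "real Q \<le> 6 * s" "Q \<ge> 1"
  proof -
    have "real (N div H) \<le> real N / real H" by (rule nat_div_real_bounds)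
    also have "\<dots> \<le> x / s" using N H s0 x by (intro frac_le) auto
    also have "\<dots> = s" using xs s0 by simp
    finally show "real Q \<le> 6 * s" using H' by (simp add: Q_def)
    show "Q \<ge> 1" using H' by (simp add: Q_def)
  qed
  have s6: "6 * s \<le> x"
  proof -
    have "6 * s \<le> s * s" using s1 s0 by (intro mult_right_mono) auto
    then show ?thesis using xs by simp
  qed
  have lH: "1 + ln (real H) \<le> 2 * l" "1 + ln (real H) \<ge> 0"
  proof -
    have "ln (real H) \<le> ln x" using H' s6 s0 by (intro ln_mono) auto
    then show "1 + ln (real H) \<le> 2 * l" using x by simp
    show "1 + ln (real H) \<ge> 0" using H' by (simp add: add_nonneg_nonneg)
  qed
  have lQ: "1 + ln (real Q) \<le> 2 * l" "1 + ln (real Q) \<ge> 0"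
  proof -
    have "ln (real Q) \<le> ln x" using Q s6 s0 by (intro ln_mono) auto
    then show "1 + ln (real Q) \<le> 2 * l" using x by simp
    show "1 + ln (real Q) \<ge> 0" using Q by (simp add: add_nonneg_nonneg)
  qed
  define E1 where "E1 = (N - H) div H"
  define E2 where "E2 = (N + M + H) div H"
  let ?V = "144 * ((4 * real M + 16 * (real Q)^4 / real M) * (8 * (1 + ln (real H)) * (1 + ln (real Q))^4 / real L1))"
  let ?T = "8 * (1 + ln (real H)) * (real (E2 + 1 - E1) * (real M / real E1 + 1))"
  let ?U = "2 * (real (L2 - L1) / real L1) * (pi * real M + 24 * sqrt (real (N + M + H)))"
  let ?w = "x / (Y * K)"
  have V: "?V
     \<le> 3058827264 * ?w"
  proof -
    \<comment> \<open>The second summand dominates: \<open>Q\<close> is at most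
      \<open>6 * s\<close>, so \<open>Q^4 / M\<close> is of order \<open>x * K\<close>, which is
      \<open>K^2\<close> times the block length.\<close>
    have "4 * real M + 16 * (real Q)^4 / real M \<le> 20744 * (x * K)"
    proof -
      have "(real Q)^4 \<le> (6 * s)^4" using Q by (intro power_mono) auto
      also have "\<dots> = 1296 * (x * x)" by (simp add: xs power4_eq_xxxx)
      finally have "16 * (real Q)^4 / real M \<le> 16 * (1296 * (x * x)) / (x / K)"
        using M x K by (intro frac_le mult_left_mono) auto
      also have "\<dots> = 20736 * (x * K)" using x K by (simp add: field_simps)
      finally have "16 * (real Q)^4 / real M \<le> 20736 * (x * K)" .
      moreover have "4 * real M \<le> 8 * (x * K)"
      proof -
        have "x / K \<le> x * K" using K x by (simp add: field_simps mult_le_cancel_left1 power2_eq_square mult_ge1_I)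
        have "4 * real M \<le> 4 * (2 * (x / K))" using M' by (intro mult_left_mono) auto
        also have "\<dots> \<le> 4 * (2 * (x * K))" using \<open>x / K \<le> x * K\<close> by (intro mult_left_mono) auto
        finally show ?thesis by simp
      qed
      ultimately show ?thesis by argo
    qed
    moreover have "8 * (1 + ln (real H)) * (1 + ln (real Q))^4 / real L1 \<le> 1024 / (K\<^sup>2 * Y)"
    proof -
      have "8 * (1 + ln (real H)) * (1 + ln (real Q))^4 \<le> 8 * (2 * l) * (2 * l)^4"
        using lH lQ x(4) by (intro mult_mono power_mono) auto
      also have "\<dots> = 256 * l ^ 5" by (simp add: power_mult_distrib eval_nat_numeral)
      finally have "8 * (1 + ln (real H)) * (1 + ln (real Q))^4 / real L1 \<le> 256 * l ^ 5 / (Lam / (4 * Y))"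
        using L1 Lam0 Y(1) x(1,4) by (intro frac_le) auto
      also have "\<dots> = 1024 * Y * l ^ 5 / Lam" by simp
      also have "\<dots> \<le> 1024 * Y * l ^ 8 / (K\<^sup>2 * Y\<^sup>2 * l ^ 8)"
        using Lam Lam0 Y(1) x(1,4) K by (intro frac_le mult_left_mono power_increasing) auto
      also have "\<dots> = 1024 / (K\<^sup>2 * Y)" using x(1,4) Y(1) by (simp add: power2_eq_square)
      finally show ?thesis .
    qed
    ultimately have "(4 * real M + 16 * (real Q)^4 / real M) * (8 * (1 + ln (real H)) * (1 + ln (real Q))^4 / real L1)
      \<le> 20744 * (x * K) * (1024 / (K\<^sup>2 * Y))"
      using x K lH lQ by (intro mult_mono) auto
    also have "\<dots> = 21241856 * ?w" using K by (simp add: power2_eq_square)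
    finally show ?thesis by simp
  qed
  have T: "?T \<le> 10000 * ?w"
  proof -
    have E1r: "real E1 \<ge> s / (16 * Y)"
    proof -
      have "x / (4 * Y) / (2 * s) \<le> real (N - H) / real H" using NH H' Y x s0 by (intro frac_le) auto
      also have "\<dots> < real E1 + 1" unfolding E1_def by (rule nat_div_real_bounds)
      finally have "s / (8 * Y) \<le> real E1 + 1" using s0 by (simp add: xs)
      moreover have "s / (8 * Y) = s / (16 * Y) + s / (16 * Y)" by simp
      moreover have "s / (16 * Y) \<ge> 1" using sY Y by simp
      ultimately show ?thesis by linarith
    qed
    have "real M / real E1 \<le> (2 * (x / K)) / (s / (16 * Y))" using M' E1r Y s0 x K by (intro frac_le) auto
    also have "\<dots> = 32 * s * Y / K" using s0 by (simp add: xs)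
    finally have "real M / real E1 \<le> 32 * (s * Y / K)" by simp
    moreover have "1 \<le> s * Y / K"
    proof -
      have "K * 1 \<le> s * Y" using sK K Y by (intro mult_mono) auto
      then show ?thesis using K by simp
    qed
    ultimately have a: "real M / real E1 + 1 \<le> 33 * (s * Y / K)" by argo
    have "E1 \<le> E2" unfolding E1_def E2_def by (intro div_le_mono) auto
    then have "real (E2 + 1 - E1) = real E2 + 1 - real E1" by simp
    also have "\<dots> \<le> real (N + M + H) / real H + 1 - (real (N - H) / real H - 1)"
      using nat_div_real_bounds(1) [of "N + M + H" H] nat_div_real_bounds(2) [of "N - H" H] unfolding E1_def E2_def by linarith
    also have "\<dots> = real M / real H + 4" using NH H' by (simp add: of_nat_diff field_simps)
    also have "\<dots> \<le> 2 * (x / K) / s + 4" using M' H s0 x K by (intro add_right_mono frac_le) auto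
    also have "\<dots> = 2 * (s / K) + 4" using s0 by (simp add: xs)
    also have "\<dots> \<le> 6 * (s / K)" using sK K by (simp add: field_simps)
    finally have b: "real (E2 + 1 - E1) \<le> 6 * (s / K)" .
    have "?T \<le> 8 * (2 * l) * (6 * (s / K) * (33 * (s * Y / K)))"
      using a b lH x(1,4) Y(1) s0 K by (intro mult_mono) auto
    also have "\<dots> = 3168 * (x * (l * Y) / (K * K))" by (simp add: xs)
    also have "\<dots> \<le> 3168 * (x * (K / Y) / (K * K))"
    proof -
      have "l * Y \<le> K / Y"
      proof -
        have "l * Y * Y \<le> l\<^sup>2 * (Y * Y)" using x(4) Y(1) by (simp add: power2_eq_square mult_le_cancel_right1 mult_le_cancel_right)
        also have "\<dots> = K" by (simp add: Y(2) power2_eq_square)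
        finally show ?thesis using Y(1) by (simp add: pos_le_divide_eq)
      qed
      then show ?thesis using x K by (intro mult_left_mono divide_right_mono) auto
    qed
    also have "\<dots> = 3168 * ?w" using K by simp
    also have "\<dots> \<le> 10000 * ?w" using x Y K by (intro mult_right_mono) auto
    finally show ?thesis .
  qed
  \<comment> \<open>Across a block the inner cut-off moves by at most \<open>3 * Lam / K\<close>,
    while it is at least \<open>Lam / (4 * Y)\<close>; the relative change is of order
    \<open>Y / K\<close>.\<close>
  have U: "?U \<le> 10000 * ?w"
  proof -
    have "real (L2 - L1) / real L1 \<le> (3 * Lam / K) / (Lam / (4 * Y))" using L1 L12 Lam0 Y K by (intro frac_le) auto
    also have "\<dots> = 12 * Y / K" using Lam0 by simp
    finally have a: "real (L2 - L1) / real L1 \<le> 12 * Y / K" .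
    have "real (N + M + H) \<le> 4 * x" using N Mx H' s6 s0 x by simp
    then have "sqrt (real (N + M + H)) \<le> sqrt (4 * x)" by (rule real_sqrt_le_mono)
    also have "\<dots> = 2 * s" using x by (simp add: real_sqrt_mult)
    finally have "sqrt (real (N + M + H)) \<le> 2 * s" .
    moreover have "pi * real M \<le> 4 * (2 * (x / K))" using M' pi_less_4 by (intro mult_mono) auto
    ultimately have b: "pi * real M + 24 * sqrt (real (N + M + H)) \<le> 56 * (x / K)" using xK by argo
    have "?U \<le> 2 * (12 * Y / K) * (56 * (x / K))"
      using a b Y K by (intro mult_mono) auto
    also have "\<dots> = 1344 * (x * Y / (K * K))" by simp
    also have "\<dots> \<le> 1344 * (x * (K / Y) / (K * K))"
    proof -
      have "Y \<le> K / Y" using K(2) Y(1) by (simp add: pos_le_divide_eq power2_eq_square)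
      then show ?thesis using x K by (intro mult_left_mono divide_right_mono) auto
    qed
    also have "\<dots> = 1344 * ?w" using K by simp
    also have "\<dots> \<le> 10000 * ?w" using x Y K by (intro mult_right_mono) auto
    finally show ?thesis .
  qed
  have "real (card {n \<in> {N<..N + M}. \<exists>L\<in>{L1..L2}. \<bar>odd_sum n L H\<bar> > 3})
     \<le> ?V
     + ?T
     + ?U"
    unfolding E1_def E2_def
    by (rule block_bad_count) (use L1 L12 M' H' NH in \<open>auto simp: Q_def\<close>)
  also have "\<dots> \<le> 3058827264 * ?w + 10000 * ?w + 10000 * ?w"
    using V T U by (intro add_mono)
  also have "\<dots> = 3058847264 * ?w" by argo
  also have "\<dots> \<le> 4000000000 * ?w" using x Y K by (intro mult_right_mono) auto
  finally show ?thesis .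
qed

section \<open>Exceptional integers\<close>

lemma sum_inverse_squares_tail:
  assumes "a \<ge> 1"
  shows "(\<Sum>h\<in>{a<..b}. 1 / (real h)\<^sup>2) \<le> 1 / real a"
proof (cases "a \<le> b")
  case True
  then have "(\<Sum>h\<in>{a<..b}. 1 / (real h)\<^sup>2) \<le> 1 / real a - 1 / real b"
  proof (induction b rule: dec_induct)
    case (step b)
    have "{a<..Suc b} = insert (Suc b) {a<..b}" using step by auto
    moreover have "1 / (real b + 1)\<^sup>2 \<le> 1 / real b - 1 / (real b + 1)"
      using step assms by (simp add: divide_simps power2_eq_square)
    ultimately show ?case using step.IH by (simp add: add.commute)
  qed auto
  moreover have "1 / real b \<ge> 0" by simp
  ultimately show ?thesis by linarith
qed auto

lemma odd_sum_split: "a \<le> b \<Longrightarrow> b \<le> c \<Longrightarrow> odd_sum n a c = odd_sum n a b + odd_sum n b c"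
proof -
  assume "a \<le> b" "b \<le> c"
  then have "{a<..c} = {a<..b} \<union> {b<..c}" "{a<..b} \<inter> {b<..c} = {}" by auto
  then show ?thesis by (simp add: odd_sum_def sum.union_disjoint)
qed

text \<open>Measures the effect of moving the centre from an eigenvalue to the integer below it; see
  \<open>two_sided_bound\<close>.\<close>

definition square_sum :: "nat \<Rightarrow> nat \<Rightarrow> nat \<Rightarrow> real" where
  "square_sum n a b = (\<Sum>h\<in>{a<..b}. (rr (n + h) + rr (n - h)) / (real h)\<^sup>2)"

text \<open>For fixed \<open>h\<close> the shifted values of \<open>r\<close> sum over
  \<open>n\<close> to at most twice \<open>r2_sum (2 * X)\<close>, so only the sum of
  \<open>1 / h^2\<close> beyond \<open>a\<close> remains.\<close>

lemma square_sum_first_moment: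
  assumes "a \<ge> 1"
  shows "(\<Sum>n=1..X. square_sum n a (n div 2)) \<le> 64 * real X / real a"
proof -
  let ?N = "\<lambda>h. {n \<in> {1..X}. h \<le> n div 2}"
  define f where "f = (\<lambda>n h. if h \<le> n div 2 then (rr (n + h) + rr (n - h)) / (real h)\<^sup>2 else 0)"
  have "(\<Sum>n=1..X. square_sum n a (n div 2)) = (\<Sum>n=1..X. \<Sum>h\<in>{a<..X}. f n h)"
    unfolding square_sum_def f_def
    by (intro sum.cong refl sum.mono_neutral_cong_left) auto
  also have "\<dots> = (\<Sum>h\<in>{a<..X}. \<Sum>n=1..X. f n h)" by (rule sum.swap)
  also have "\<dots> \<le> (\<Sum>h\<in>{a<..X}. 64 * real X * (1 / (real h)\<^sup>2))"
  proof (rule sum_mono)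
    fix h assume h: "h \<in> {a<..X}"
    have "(\<Sum>n=1..X. f n h) = (\<Sum>n\<in>?N h. (rr (n + h) + rr (n - h)) / (real h)\<^sup>2)"
      unfolding f_def by (rule sum.inter_filter [symmetric]) simp
    also have "\<dots> = ((\<Sum>n\<in>?N h. rr (n + h)) + (\<Sum>n\<in>?N h. rr (n - h))) / (real h)\<^sup>2"
      by (simp add: sum.distrib sum_divide_distrib add_divide_distrib)
    also have "\<dots> \<le> (r2_sum (2 * X) + r2_sum (2 * X)) / (real h)\<^sup>2"
    proof (intro divide_right_mono add_mono)
      have "(\<Sum>n\<in>?N h. rr (n + h)) = (\<Sum>m\<in>(\<lambda>n. n + h) ` ?N h. rr m)"
        by (subst sum.reindex) (auto simp: inj_on_def)
      also have "\<dots> \<le> r2_sum (2 * X)"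
        unfolding r2_sum_def using h by (intro sum_mono2) auto
      finally show "(\<Sum>n\<in>?N h. rr (n + h)) \<le> r2_sum (2 * X)" .
      have "(\<Sum>n\<in>?N h. rr (n - h)) = (\<Sum>m\<in>(\<lambda>n. n - h) ` ?N h. rr m)"
        by (subst sum.reindex) (auto simp: inj_on_def)
      also have "\<dots> \<le> r2_sum (2 * X)"
        unfolding r2_sum_def using h by (intro sum_mono2) auto
      finally show "(\<Sum>n\<in>?N h. rr (n - h)) \<le> r2_sum (2 * X)" .
    qed auto
    also have "\<dots> \<le> (64 * real X) / (real h)\<^sup>2"
      using r2_sum_le [of "2 * X"] by (intro divide_right_mono) auto
    finally show "(\<Sum>n=1..X. f n h) \<le> 64 * real X * (1 / (real h)\<^sup>2)" by simp
  qed
  also have "\<dots> = 64 * real X * (\<Sum>h\<in>{a<..X}. 1 / (real h)\<^sup>2)" by (simp add: sum_distrib_left)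
  also have "\<dots> \<le> 64 * real X * (1 / real a)" by (intro mult_left_mono sum_inverse_squares_tail assms) auto
  finally show ?thesis by simp
qed

lemma square_sum_nonneg: "square_sum n a b \<ge> 0"
  by (simp add: square_sum_def sum_nonneg)

lemma square_sum_antimono: "a \<le> a' \<Longrightarrow> square_sum n a' b \<le> square_sum n a b"
  unfolding square_sum_def by (intro sum_mono2) auto

text \<open>Bad integers are those below \<open>x / Y\<close>, those with a large square sum,
  counted by Markov's inequality, and those found in the blocks. The bound 75 is 3 from the blocks
  plus 72 from \<open>r2_symmetric_sum\<close> for shifts beyond \<open>H\<close>, which is at least
  sqrt x.\<close>

lemma generic_estimate:
  fixes x Y l Lam K s :: real
  assumes x: "x > 0" "s = sqrt x" "l = ln x" "l \<ge> 10"
    and Y: "Y \<ge> 1" "K = Y\<^sup>2 * l\<^sup>2"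
    and Lam: "K\<^sup>2 * Y\<^sup>2 * l ^ 8 \<le> Lam" "4 * Lam \<le> s"
  shows "\<exists>Bad. finite Bad \<and> real (card Bad) \<le> 10000000000 * (x / Y) \<and>
    (\<forall>n::nat. 0 < n \<longrightarrow> real n \<le> x \<longrightarrow> n \<notin> Bad \<longrightarrow>
      x / Y \<le> real n \<and> \<bar>odd_sum n (nat \<lfloor>real n * Lam / x\<rfloor>) (n div 2)\<bar> \<le> 75 \<and>
      square_sum n (nat \<lfloor>real n * Lam / x\<rfloor>) (n div 2) \<le> 1 / Y)"
proof -
  have xs: "x = s * s" and s0: "s > 0" using x by simp_all
  have l2: "l\<^sup>2 \<ge> 100" using power_mono [of 10 l 2] x(4) by simp
  have l8: "l ^ 8 \<ge> 1" using x(4) by (intro one_le_power) simp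
  have Y2: "Y\<^sup>2 \<ge> 1" "Y\<^sup>2 \<ge> Y" using Y(1) self_le_power [of Y 2] by auto
  have K: "K \<ge> 100 * Y"
  proof -
    have "Y * 100 \<le> Y\<^sup>2 * l\<^sup>2" using Y2 l2 by (intro mult_mono) auto
    then show ?thesis using Y by simp
  qed
  have K1: "K \<ge> 100" using K Y by simp
  have LY: "Y\<^sup>2 * Y \<le> Lam" and LK: "K * K \<le> Lam"
  proof -
    have "(K * K) * 1 * 1 \<le> K\<^sup>2 * Y\<^sup>2 * l ^ 8" using K1 Y2 l8 by (intro mult_mono) (auto simp: power2_eq_square)
    then show LK: "K * K \<le> Lam" using Lam by simp
    have "Y\<^sup>2 * 1 \<le> Y\<^sup>2 * l\<^sup>2" using l2 by (intro mult_left_mono) auto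
    then have "Y\<^sup>2 \<le> K" by (simp add: Y(2))
    then have "Y\<^sup>2 * Y \<le> K * K" using K Y(1) K1 by (intro mult_mono) auto
    then show "Y\<^sup>2 * Y \<le> Lam" using LK by linarith
  qed
  have KK: "100 * K \<le> K * K" using K1 by simp
  have LK1: "100 * K \<le> Lam" using KK LK by linarith
  have Lam0: "Lam \<ge> 10000" using LK1 K1 by simp
  have sK: "s \<ge> 400 * K" using LK1 Lam by simp
  have s1: "s \<ge> 40000" using sK K1 by simp
  define H where "H = nat \<lceil>s\<rceil>"
  have H: "s \<le> real H" "real H \<le> s + 1" using s0 unfolding H_def by linarith+
  define M where "M = nat \<lceil>x / K\<rceil>"
  have xK0: "x / K > 0" using x K1 by simp
  have M: "x / K \<le> real M" "real M \<le> x / K + 1" using xK0 unfolding M_def by linarith+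
  have xK: "x / K \<ge> s"
  proof -
    have "s * K \<le> s * s" using sK K1 s0 by (intro mult_left_mono) auto
    then show ?thesis using K1 xs by (simp add: pos_le_divide_eq)
  qed
  have M0: "M > 0" using M xK s1 by (intro gr0I) auto
  have xYK: "x / K \<le> (x / Y) / 100"
  proof -
    have "x / K \<le> x / (100 * Y)" using K x Y K1 by (intro divide_left_mono) auto
    then show ?thesis by simp
  qed
  have xYs: "x / Y \<ge> 100 * s" using xYK xK by argo
  have MY: "50 * real M \<le> x / Y" using M xYK xK s1 by argo
  define X where "X = nat \<lfloor>x\<rfloor>"
  have X: "real X \<le> x" "real n \<le> x \<longleftrightarrow> n \<le> X" for n
    using x unfolding X_def by (linarith, auto simp: le_nat_floor le_nat_iff le_floor_iff)
  define Lf where "Lf = (\<lambda>n. nat \<lfloor>real n * Lam / x\<rfloor>)"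
  \<comment> \<open>\<open>L0\<close> is the inner cut-off at \<open>n = x / Y\<close>, the least
    that occurs for the remaining \<open>n\<close>. By monotonicity it suffices to test the square
    sum there.\<close>
  define L0 where "L0 = nat \<lfloor>Lam / Y\<rfloor>"
  have LamY: "Lam / Y \<ge> 100"
  proof -
    have "100 * Y \<le> Lam" using K LK1 K1 by linarith
    then show ?thesis using Y by (simp add: pos_le_divide_eq)
  qed
  have L0: "L0 \<ge> 1" "real L0 \<ge> Lam / (2 * Y)"
  proof -
    have r: "real L0 \<ge> Lam / Y - 1" using LamY unfolding L0_def by linarith
    have "Lam / (2 * Y) = (Lam / Y) / 2" by simp
    then show "real L0 \<ge> Lam / (2 * Y)" using r LamY by argo
    have "real L0 \<ge> 1" using r LamY by argo
    then show "L0 \<ge> 1" by simp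
  qed
  define B0 where "B0 = {n \<in> {1..X}. real n < x / Y}"
  define B2 where "B2 = {n \<in> {1..X}. square_sum n L0 (n div 2) > 1 / Y}"
  \<comment> \<open>The blocks start at multiples of \<open>M\<close>. As \<open>M\<close> is at
    most \<open>x / (50 * Y)\<close>, the block of an \<open>n\<close> with
    \<open>n >= x / Y\<close> starts at \<open>x / (2 * Y)\<close> or later.\<close>
  define J where "J = {j. x / (2 * Y) \<le> real (j * M) \<and> real (j * M) \<le> x}"
  define Bj where "Bj = (\<lambda>j. {n \<in> {j * M<..j * M + M}.
     \<exists>L\<in>{nat \<lfloor>real (j * M) * Lam / x\<rfloor>..nat \<lfloor>real (j * M + M) * Lam / x\<rfloor>}. \<bar>odd_sum n L H\<bar> > 3})"
  define Bad where "Bad = B0 \<union> B2 \<union> (\<Union>j\<in>J. Bj j)"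
  let ?U = "\<Union>j\<in>J. Bj j"
  have c0: "real (card B0) \<le> x / Y"
  proof -
    have "B0 \<subseteq> {1..nat \<lfloor>x / Y\<rfloor>}" by (auto simp: B0_def le_nat_floor)
    then have "card B0 \<le> card {1..nat \<lfloor>x / Y\<rfloor>}" by (intro card_mono) auto
    then have "real (card B0) \<le> real (nat \<lfloor>x / Y\<rfloor>)" by simp
    also have "\<dots> \<le> x / Y" using x Y by simp
    finally show ?thesis .
  qed
  have c2: "real (card B2) \<le> 128 * (x / Y)"
  proof -
    have "real (card B2) * (1 / Y) = (\<Sum>n\<in>B2. 1 / Y)" by simp
    also have "\<dots> \<le> (\<Sum>n\<in>B2. square_sum n L0 (n div 2))" by (rule sum_mono) (simp add: B2_def)
    also have "\<dots> \<le> (\<Sum>n=1..X. square_sum n L0 (n div 2))"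
      by (rule sum_mono2) (auto simp: B2_def square_sum_nonneg)
    also have "\<dots> \<le> 64 * real X / real L0" by (rule square_sum_first_moment [OF L0(1)])
    also have "\<dots> \<le> 64 * x / (Lam / (2 * Y))" using X x L0 Lam0 Y by (intro frac_le) auto
    also have "\<dots> = 128 * (x * Y / Lam)" by simp
    also have "\<dots> \<le> 128 * (x * Y / (Y\<^sup>2 * Y))" using LY Y x Y2 Lam0 by (intro mult_left_mono divide_left_mono) auto
    finally have "real (card B2) * (1 / Y) * Y \<le> 128 * (x * Y / (Y\<^sup>2 * Y)) * Y" using Y by (intro mult_right_mono) auto
    then show ?thesis using Y by (simp add: power2_eq_square)
  qed
  have Jsub: "J \<subseteq> {..nat \<lfloor>K\<rfloor>}"
  proof
    fix j assume "j \<in> J"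
    then have "real j * real M \<le> x" by (simp add: J_def)
    moreover have "real j * (x / K) \<le> real j * real M" using M by (intro mult_left_mono) auto
    ultimately have "real j * (x / K) \<le> x" by linarith
    then have "real j \<le> K" using x K1 by (simp add: field_simps)
    then show "j \<in> {..nat \<lfloor>K\<rfloor>}" by (simp add: le_nat_floor)
  qed
  then have fJ: "finite J" by (rule finite_subset) simp
  have cJ: "real (card J) \<le> 2 * K"
  proof -
    have "card J \<le> card {..nat \<lfloor>K\<rfloor>}" using Jsub by (intro card_mono) auto
    then have "real (card J) \<le> real (nat \<lfloor>K\<rfloor>) + 1" by simp
    also have "\<dots> \<le> 2 * K" using K1 by linarith
    finally show ?thesis .
  qed
  have c3: "real (card ?U) \<le> 8000000000 * (x / Y)"
  proof -
    have "real (card ?U) \<le> (\<Sum>j\<in>J. real (card (Bj j)))"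
      unfolding of_nat_sum [symmetric] of_nat_le_iff by (rule card_UN_le [OF fJ])
    also have "\<dots> \<le> (\<Sum>j\<in>J. 4000000000 * (x / (Y * K)))"
    proof (rule sum_mono)
      fix j assume "j \<in> J"
      then have "x / (2 * Y) \<le> real (j * M)" "real (j * M) \<le> x" by (auto simp: J_def)
      then show "real (card (Bj j)) \<le> 4000000000 * (x / (Y * K))"
        unfolding Bj_def by (rule block_bad_small [OF x Y Lam H M])
    qed
    also have "\<dots> = real (card J) * (4000000000 * (x / (Y * K)))" by simp
    also have "\<dots> \<le> 2 * K * (4000000000 * (x / (Y * K)))" using cJ x Y K1 by (intro mult_right_mono) auto
    also have "\<dots> = 8000000000 * (x / Y)" using K1 by simp
    finally show ?thesis .
  qed
  have fin: "finite B0" "finite B2" "finite ?U"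
    using fJ by (auto simp: B0_def B2_def Bj_def)
  have "real (card Bad) \<le> real (card B0) + real (card B2) + real (card ?U)"
    using card_Un_le [of "B0 \<union> B2" ?U] card_Un_le [of B0 B2] unfolding Bad_def by linarith
  also have "\<dots> \<le> x / Y + 128 * (x / Y) + 8000000000 * (x / Y)" using c0 c2 c3 by (intro add_mono)
  also have "\<dots> = 8000000129 * (x / Y)" by argo
  also have "\<dots> \<le> 10000000000 * (x / Y)" using x Y by (intro mult_right_mono) auto
  finally have card: "real (card Bad) \<le> 10000000000 * (x / Y)" .
  have good: "x / Y \<le> real n \<and> \<bar>odd_sum n (Lf n) (n div 2)\<bar> \<le> 75 \<and> square_sum n (Lf n) (n div 2) \<le> 1 / Y"
    if n: "0 < n" "real n \<le> x" "n \<notin> Bad" for n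
  proof -
    have nX: "n \<in> {1..X}" using n X by simp
    have nY: "x / Y \<le> real n" using n nX by (auto simp: Bad_def B0_def)
    have L0n: "L0 \<le> Lf n"
    proof -
      have "Lam / Y = (x / Y) * Lam / x" using x by simp
      also have "\<dots> \<le> real n * Lam / x" using nY x Lam0 by (intro divide_right_mono mult_right_mono) auto
      finally show ?thesis unfolding L0_def Lf_def by (intro nat_mono floor_mono)
    qed
    have "square_sum n (Lf n) (n div 2) \<le> square_sum n L0 (n div 2)" using L0n by (rule square_sum_antimono)
    also have "\<dots> \<le> 1 / Y" using n nX by (auto simp: Bad_def B2_def)
    finally have sq: "square_sum n (Lf n) (n div 2) \<le> 1 / Y" .
    \<comment> \<open>The blocks are open on the left and closed on the right, hence
      \<open>n - 1\<close>.\<close>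
    define j where "j = (n - 1) div M"
    have "j * M + (n - 1) mod M = n - 1" unfolding j_def by (rule div_mult_mod_eq)
    moreover have "(n - 1) mod M < M" using M0 by simp
    ultimately have jn: "j * M < n" "n \<le> j * M + M" using n by linarith+
    have jJ: "j \<in> J"
    proof -
      have "real n \<le> real (j * M) + real M" using jn by linarith
      moreover have "x / (2 * Y) = (x / Y) / 2" by simp
      ultimately have "x / (2 * Y) \<le> real (j * M)" using nY MY xYs s1 by argo
      moreover have "real (j * M) \<le> x" using jn n by linarith
      ultimately show ?thesis by (simp add: J_def)
    qed
    have Lin: "Lf n \<in> {nat \<lfloor>real (j * M) * Lam / x\<rfloor>..nat \<lfloor>real (j * M + M) * Lam / x\<rfloor>}"
    proof -
      have "real (j * M) * Lam / x \<le> real n * Lam / x" "real n * Lam / x \<le> real (j * M + M) * Lam / x"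
        using jn x Lam0 by (intro divide_right_mono mult_right_mono; linarith)+
      then show ?thesis unfolding Lf_def by (auto intro!: nat_mono floor_mono)
    qed
    have "n \<notin> Bj j" using n(3) jJ by (auto simp: Bad_def)
    then have 1: "\<bar>odd_sum n (Lf n) H\<bar> \<le> 3" using jn Lin by (auto simp: Bj_def not_less)
    have LH: "Lf n \<le> H"
    proof -
      have "real n * Lam / x \<le> x * Lam / x" using n x Lam0 by (intro divide_right_mono mult_right_mono) auto
      then have "real n * Lam / x \<le> Lam" using x by simp
      then have "real (Lf n) \<le> Lam" unfolding Lf_def using Lam0 by linarith
      then have "real (Lf n) \<le> real H" using Lam H Lam0 by linarith
      then show ?thesis by simp
    qed
    have Hn: "H \<le> n div 2"
    proof -
      have "2 * real H \<le> real n" using H xYs nY s1 by argo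
      then show ?thesis by linarith
    qed
    have "\<bar>odd_sum n H (n div 2)\<bar> \<le> 72 * sqrt (real n) / (real H + 1)"
      unfolding odd_sum_def using n Hn by (intro r2_symmetric_sum) auto
    also have "\<dots> \<le> 72 * s / s"
    proof (intro frac_le mult_left_mono)
      show "sqrt (real n) \<le> s" unfolding x(2) using n by simp
    qed (use s0 H in auto)
    also have "\<dots> = 72" using s0 by simp
    finally have 2: "\<bar>odd_sum n H (n div 2)\<bar> \<le> 72" .
    have "odd_sum n (Lf n) (n div 2) = odd_sum n (Lf n) H + odd_sum n H (n div 2)"
      by (rule odd_sum_split [OF LH Hn])
    then have "\<bar>odd_sum n (Lf n) (n div 2)\<bar> \<le> 75" using 1 2 by linarith
    then show ?thesis using nY sq by blast
  qed
  show ?thesis using good card fin unfolding Lf_def Bad_def [symmetric]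
    by (intro exI [of _ Bad]) (auto simp: Bad_def)
qed

section \<open>New eigenvalues\<close>

lemma r2_1_pos: "r2 1 > 0"
proof -
  have "{p :: int \<times> int. (fst p)\<^sup>2 + (snd p)\<^sup>2 = int 1} \<noteq> {}"
    by (rule ex_in_conv [THEN iffD1], rule exI [of _ "(1, 0)"]) simp
  then show ?thesis unfolding r2_def using finite_r2_set [of "int 1"] by (simp add: card_gt_0_iff)
qed

text \<open>Since 1 is a sum of two squares and hence a pole, \<open>lam\<close> exceeds 1, so the
  \<open>Max\<close> is taken over a nonempty finite set and attained.\<close>

lemma below_sos:
  assumes "lam \<ge> 1" "lam \<notin> sos_reals"
  shows "lam > 1" "r2 (below_sos lam) > 0" "1 \<le> below_sos lam" "real (below_sos lam) < lam"
    "\<And>m. r2 m > 0 \<Longrightarrow> real m < lam \<Longrightarrow> m \<le> below_sos lam"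
proof -
  let ?S = "{m::nat. r2 m > 0 \<and> real m < lam}"
  have "1 \<in> sos_reals" unfolding sos_reals_def using r2_1_pos by (auto intro!: exI [of _ 1])
  then show lam1: "lam > 1" using assms by (cases "lam = 1") auto
  have "?S \<subseteq> {..nat \<lceil>lam\<rceil>}" by (auto simp: nat_le_iff le_nat_iff) (use lam1 in linarith)
  then have fin: "finite ?S" by (rule finite_subset) simp
  have 1: "1 \<in> ?S" using r2_1_pos lam1 by simp
  have "Max ?S \<in> ?S" using fin 1 by (intro Max_in) auto
  then show "r2 (below_sos lam) > 0" "real (below_sos lam) < lam" by (auto simp: below_sos_def)
  show ge: "m \<le> below_sos lam" if "r2 m > 0" "real m < lam" for m
    unfolding below_sos_def using fin that by (intro Max_ge) auto
  show "1 \<le> below_sos lam" using 1 by (intro ge) auto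
qed

text \<open>A sum of two squares strictly between the two points would be at most
  \<open>below_sos lam'\<close>, which equals \<open>below_sos lam\<close> and lies below
  \<open>lam\<close>.\<close>

lemma no_sos_between:
  assumes "lam \<ge> 1" "lam \<notin> sos_reals" "lam' \<notin> sos_reals" "lam < lam'"
    and "below_sos lam = below_sos lam'" "r2 m > 0"
  shows "real m < lam \<or> lam' < real m"
proof (rule ccontr)
  assume *: "\<not> (real m < lam \<or> lam' < real m)"
  have "real m \<in> sos_reals" using assms(6) by (auto simp: sos_reals_def)
  then have "real m \<noteq> lam" "real m \<noteq> lam'" using assms by auto
  then have m: "lam < real m" "real m < lam'" using * by auto
  have "m \<le> below_sos lam'" using assms m by (intro below_sos(5)) auto
  also have "real (below_sos lam) < lam" using assms by (intro below_sos(4))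
  ultimately show False using m assms(5) by linarith
qed

lemma inverse_diff_mono:
  fixes a b t :: real
  assumes "a < b" "t < a \<or> b < t"
  shows "1 / (t - a) < 1 / (t - b)"
  using assms by (auto simp: divide_simps mult_less_0_iff)

section \<open>The terms of the eigenvalue equation\<close>

definition regularized :: "nat \<Rightarrow> real \<Rightarrow> real" where
  "regularized m lam = rr m * (1 / (real m - lam) - real m / ((real m)\<^sup>2 + 1))"

text \<open>The two fractions combine to \<open>(1 + lam * m) / ((m - lam) * (m^2 + 1))\<close>, and
  the hypothesis gives \<open>m - lam >= m / 4\<close>. This controls the tail of the weak equation
  uniformly.\<close>

lemma regularized_bound:
  assumes "lam \<ge> 1" "4 * lam \<le> 3 * real m"
  shows "0 \<le> regularized m lam" "regularized m lam \<le> 8 * lam * (rr m / (real m)\<^sup>2)"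
proof -
  have m: "real m \<ge> lam" "real m - lam \<ge> real m / 4" "real m > 0" using assms by auto
  then have ml: "real m - lam > 0" by linarith
  have sq: "(real m)\<^sup>2 + 1 > 0" by (simp add: add_nonneg_pos)
  have eq: "1 / (real m - lam) - real m / ((real m)\<^sup>2 + 1) = (1 + lam * real m) / ((real m - lam) * ((real m)\<^sup>2 + 1))"
    using ml sq by (simp add: diff_frac_eq power2_eq_square algebra_simps)
  have "(1 + lam * real m) / ((real m - lam) * ((real m)\<^sup>2 + 1)) \<le> (2 * (lam * real m)) / ((real m / 4) * (real m)\<^sup>2)"
  proof (intro frac_le mult_mono)
    have "1 * 1 \<le> lam * real m" using assms m by (intro mult_mono) auto
    then show "1 + lam * real m \<le> 2 * (lam * real m)" by simp
  qed (use m assms in auto)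
  also have "\<dots> = 8 * lam / (real m)\<^sup>2" using m by (simp add: power2_eq_square)
  finally have "1 / (real m - lam) - real m / ((real m)\<^sup>2 + 1) \<le> 8 * lam / (real m)\<^sup>2" unfolding eq .
  then have "regularized m lam \<le> rr m * (8 * lam / (real m)\<^sup>2)"
    unfolding regularized_def by (rule mult_left_mono) simp
  then show "regularized m lam \<le> 8 * lam * (rr m / (real m)\<^sup>2)" by (simp add: mult_ac)
  show "0 \<le> regularized m lam"
    unfolding regularized_def eq using ml sq assms m by (intro mult_nonneg_nonneg divide_nonneg_nonneg add_nonneg_nonneg) auto
qed

lemma r2_square_sum_le: "(\<Sum>m=1..n. rr m / (real m)\<^sup>2) \<le> 48"
proof (cases "n \<ge> 1")
  case True
  then have "{1..n} = insert 1 {1<..n}" by auto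
  then have "(\<Sum>m=1..n. rr m / (real m)\<^sup>2) = rr 1 + (\<Sum>m\<in>{1<..n}. rr m / (real m)\<^sup>2)"
    by simp
  moreover have "rr 1 \<le> 16" using r2_sum_le [of 1] by (simp add: r2_sum_def)
  ultimately show ?thesis using r2_square_tail [of 1 n] by simp
qed auto

text \<open>The weak equation is stated with an infinite sum, which can be split and compared
  termwise only once convergence is known.\<close>

lemma summable_regularized:
  assumes "lam \<ge> 1"
  shows "summable (\<lambda>k. regularized (Suc k) lam)"
proof (rule summable_comparison_test_ev)
  have "summable (\<lambda>k. rr (Suc k) / (real (Suc k))\<^sup>2)"
  proof (rule summableI_nonneg_bounded)
    fix n
    have "(\<Sum>k<n. rr (Suc k) / (real (Suc k))\<^sup>2) = (\<Sum>m=1..n. rr m / (real m)\<^sup>2)"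
      by (rule sum.reindex_bij_witness [of _ "\<lambda>m. m - 1" Suc]) auto
    then show "(\<Sum>k<n. rr (Suc k) / (real (Suc k))\<^sup>2) \<le> 48" using r2_square_sum_le [of n] by simp
  qed simp
  then show "summable (\<lambda>k. 8 * lam * (rr (Suc k) / (real (Suc k))\<^sup>2))" by (rule summable_mult)
  show "\<forall>\<^sub>F k in sequentially. norm (regularized (Suc k) lam) \<le> 8 * lam * (rr (Suc k) / (real (Suc k))\<^sup>2)"
  proof (rule eventually_sequentiallyI)
    fix k assume "k \<ge> nat \<lceil>4 * lam\<rceil>"
    then have "4 * lam \<le> real k" by linarith
    then have "4 * lam \<le> 3 * real (Suc k)" by simp
    then show "norm (regularized (Suc k) lam) \<le> 8 * lam * (rr (Suc k) / (real (Suc k))\<^sup>2)"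
      using regularized_bound [OF assms, of "Suc k"] by simp
  qed
qed

text \<open>No pole lies between two points of the same gap, so every term with
  \<open>r2 m > 0\<close> increases strictly from \<open>a\<close> to \<open>b\<close>. The term
  \<open>m = 1\<close> makes the increase of the sum strict.\<close>

lemma Lambda_weak_unique:
  assumes "a \<in> Lambda_weak \<phi>" "b \<in> Lambda_weak \<phi>" "a \<ge> 1" "b \<ge> 1" "below_sos a = below_sos b"
  shows "a = b"
proof -
  have False if ab: "a < b" and prem: "a \<in> Lambda_weak \<phi>" "b \<in> Lambda_weak \<phi>" "a \<ge> 1" "below_sos a = below_sos b" for a b
  proof -
    have sos: "a \<notin> sos_reals" "b \<notin> sos_reals" using prem by (auto simp: Lambda_weak_def)
    have eq: "(\<Sum>k. regularized (Suc k) a) = (\<Sum>k. regularized (Suc k) b)"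
      using prem(1,2) by (simp add: Lambda_weak_def regularized_def)
    have sm: "summable (\<lambda>k. regularized (Suc k) a)" "summable (\<lambda>k. regularized (Suc k) b)"
      using prem(3) ab by (auto intro!: summable_regularized)
    have less: "regularized m a < regularized m b" if "r2 m > 0" for m
    proof -
      have "1 / (real m - a) < 1 / (real m - b)"
        using inverse_diff_mono [OF ab] no_sos_between [OF prem(3) sos ab prem(4) that] by blast
      then show ?thesis using that by (simp add: regularized_def)
    qed
    have "0 < (\<Sum>k. regularized (Suc k) b - regularized (Suc k) a)"
    proof (rule suminf_pos2 [of _ 0])
      show "summable (\<lambda>k. regularized (Suc k) b - regularized (Suc k) a)" by (intro summable_diff sm)
      show "0 \<le> regularized (Suc k) b - regularized (Suc k) a" for k
        using less [of "Suc k"] by (cases "r2 (Suc k) = 0") (auto simp: regularized_def)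
      show "0 < regularized (Suc 0) b - regularized (Suc 0) a"
        using less [of "Suc 0"] r2_1_pos by simp
    qed
    also have "\<dots> = 0" using suminf_diff [OF sm(2,1)] eq by simp
    finally show False by simp
  qed
  then show ?thesis using assms by (metis linorder_neqE_linordered_idom)
qed

text \<open>When \<open>lam\<close> moves to the right inside a gap, every term increases, a term that leaves the
  window on the left is negative, and a term that enters on the right is positive.\<close>
lemma Lambda_strong_unique:
  assumes "a \<in> Lambda_strong \<alpha>" "b \<in> Lambda_strong \<alpha>" "a \<ge> 1" "b \<ge> 1" "\<alpha> \<noteq> 0" "below_sos a = below_sos b"
  shows "a = b"
proof -
  have False if ab: "a < b" and prem: "a \<in> Lambda_strong \<alpha>" "b \<in> Lambda_strong \<alpha>" "a \<ge> 1" "below_sos a = below_sos b" for a b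
  proof -
    have sos: "a \<notin> sos_reals" "b \<notin> sos_reals" using prem by (auto simp: Lambda_strong_def)
    define w where "w = (\<lambda>c. {m::nat. 1 \<le> m \<and> \<bar>real m - c\<bar> \<le> sqrt c})"
    define U where "U = {..nat \<lceil>2 * b\<rceil>}"
    have sq: "sqrt c \<le> c" if "c \<ge> 1" for c :: real using that by (intro real_le_lsqrt self_le_power) auto
    have sub: "w c \<subseteq> U" if "1 \<le> c" "c \<le> b" for c
    proof
      fix m assume "m \<in> w c"
      then have "real m \<le> 2 * b" using sq [OF that(1)] that by (auto simp: w_def)
      then show "m \<in> U" unfolding U_def by simp linarith
    qed
    have ws: "w a \<subseteq> U" "w b \<subseteq> U" using sub ab prem(3) by auto
    have sums: "(\<Sum>m\<in>w a. regularized m a) = 1 / \<alpha>" "(\<Sum>m\<in>w b. regularized m b) = 1 / \<alpha>"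
      using prem(1,2) by (simp_all add: Lambda_strong_def regularized_def w_def)
    \<comment> \<open>Extension by zero puts both windows on the common index set \<open>U\<close>,
      so that the sums can be compared term by term.\<close>
    define t where "t = (\<lambda>c m. if m \<in> w c then regularized m c else 0)"
    have ts: "(\<Sum>m\<in>U. t a m) = 1 / \<alpha>" "(\<Sum>m\<in>U. t b m) = 1 / \<alpha>"
      using sums ws by (simp_all add: t_def U_def sum.If_cases Int_absorb1)
    \<comment> \<open>The left end of the window does not move back because the square root grows no
      faster than its argument beyond 1.\<close>
    have left: "a - sqrt a \<le> b - sqrt b"
    proof -
      have "(sqrt b - sqrt a) * 1 \<le> (sqrt b - sqrt a) * (sqrt b + sqrt a)"
        using ab prem(3) by (intro mult_left_mono) (auto intro: order_trans [of 1 "sqrt b"])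
      also have "\<dots> = b - a" using ab prem(3) by (simp add: algebra_simps)
      finally show ?thesis by simp
    qed
    have right: "a + sqrt a < b + sqrt b" using ab by (simp add: add_strict_mono)
    have mono: "t a m \<le> t b m" and strict: "m \<in> w a \<Longrightarrow> r2 m > 0 \<Longrightarrow> t a m < t b m" for m
    proof -
      have "t a m \<le> t b m \<and> (m \<in> w a \<longrightarrow> r2 m > 0 \<longrightarrow> t a m < t b m)"
      proof (cases "r2 m > 0")
        case False
        then show ?thesis by (simp add: t_def regularized_def)
      next
        case True
        have sep: "real m < a \<or> b < real m" by (rule no_sos_between [OF prem(3) sos ab prem(4) True])
        have less: "regularized m a < regularized m b"
          using inverse_diff_mono [OF ab sep] True by (simp add: regularized_def)
        have neg: "regularized m a < 0" if "real m < a"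
        proof -
          have "1 / (real m - a) < 0" using that by simp
          moreover have "real m / ((real m)\<^sup>2 + 1) \<ge> 0" by simp
          ultimately have "1 / (real m - a) - real m / ((real m)\<^sup>2 + 1) < 0" by linarith
          then show ?thesis unfolding regularized_def using True by (intro mult_pos_neg) auto
        qed
        \<comment> \<open>Both reciprocals are compared with \<open>1 / m\<close>:
          \<open>m - b <= m\<close> from one side and \<open>m / (m^2 + 1) <= 1 / m\<close> from the
          other.\<close>
        have pos: "regularized m b \<ge> 0" if mb: "b < real m" "real m \<le> b + sqrt b"
        proof -
          have b1: "b \<ge> 1" using ab prem(3) by simp
          have "real m - b \<le> real m" using b1 by simp
          then have "1 / real m \<le> 1 / (real m - b)" using mb b1 by (intro divide_left_mono) auto
          moreover have "real m / ((real m)\<^sup>2 + 1) \<le> real m / (real m)\<^sup>2"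
            using mb b1 by (intro frac_le) auto
          moreover have "real m / (real m)\<^sup>2 = 1 / real m" using mb b1 by (simp add: power2_eq_square)
          ultimately have "0 \<le> 1 / (real m - b) - real m / ((real m)\<^sup>2 + 1)" by linarith
          then show ?thesis unfolding regularized_def by (intro mult_nonneg_nonneg) auto
        qed
        consider "m \<in> w a" "m \<in> w b" | "m \<in> w a" "m \<notin> w b" | "m \<notin> w a" "m \<in> w b" | "m \<notin> w a" "m \<notin> w b" by blast
        then show ?thesis
        proof cases
          case 1
          then show ?thesis using less by (simp add: t_def)
        next
          case 2
          then have "real m < a" using sep left right by (auto simp: w_def abs_le_iff)
          then show ?thesis using 2 neg by (simp add: t_def)
        next
          case 3
          then have "b < real m \<and> real m \<le> b + sqrt b" using sep left right by (auto simp: w_def abs_le_iff)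
          then show ?thesis using 3 pos by (simp add: t_def)
        next
          case 4
          then show ?thesis by (simp add: t_def)
        qed
      qed
      then show "t a m \<le> t b m" "m \<in> w a \<Longrightarrow> r2 m > 0 \<Longrightarrow> t a m < t b m" by blast+
    qed
    \<comment> \<open>A window without sums of two squares would make the left side 0, whereas
      \<open>1 / \<alpha>\<close> is nonzero. A term present in the window at \<open>a\<close> then
      gives strictness.\<close>
    have "\<exists>m\<in>w a. r2 m > 0"
    proof (rule ccontr)
      assume "\<not> (\<exists>m\<in>w a. r2 m > 0)"
      then have "(\<Sum>m\<in>w a. regularized m a) = 0" by (intro sum.neutral) (auto simp: regularized_def)
      then show False using sums assms(5) by simp
    qed
    then obtain m where m: "m \<in> w a" "r2 m > 0" by blast
    have "(\<Sum>m\<in>U. t a m) < (\<Sum>m\<in>U. t b m)"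
      by (rule sum_strict_mono_ex1) (use mono strict m ws in \<open>auto simp: U_def\<close>)
    then show False using ts by simp
  qed
  then show ?thesis using assms by (metis linorder_neqE_linordered_idom)
qed

section \<open>Sums centred at n\<close>

definition two_sided :: "nat \<Rightarrow> nat \<Rightarrow> nat \<Rightarrow> real \<Rightarrow> real" where
  "two_sided n a b lam = (\<Sum>h\<in>{a<..b}. rr (n + h) / (real (n + h) - lam) + rr (n - h) / (real (n - h) - lam))"

definition centred_sum :: "nat \<Rightarrow> nat \<Rightarrow> real \<Rightarrow> real" where
  "centred_sum n b lam = (\<Sum>m\<in>{n - b..n + b}. rr m / (real m - lam))"

lemma centred_sum_split:
  assumes "a \<le> b" "b \<le> n"
  shows "centred_sum n b lam = centred_sum n a lam + two_sided n a b lam"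
  using assms
proof (induction b rule: dec_induct)
  case base
  then show ?case by (simp add: two_sided_def)
next
  case (step b)
  have "{n - Suc b..n + Suc b} = insert (n - Suc b) (insert (n + Suc b) {n - b..n + b})" using step by auto
  moreover have "n - Suc b \<notin> insert (n + Suc b) {n - b..n + b}" "n + Suc b \<notin> {n - b..n + b}" using step by auto
  ultimately have "centred_sum n (Suc b) lam = centred_sum n b lam
      + (rr (n + Suc b) / (real (n + Suc b) - lam) + rr (n - Suc b) / (real (n - Suc b) - lam))"
    by (simp add: centred_sum_def)
  moreover have "{a<..Suc b} = insert (Suc b) {a<..b}" using step by auto
  ultimately show ?case using step by (simp add: two_sided_def)
qed

text \<open>With \<open>e = lam - n\<close> one has \<open>0 < e <= g\<close> and
  \<open>h > 2 * e\<close>, so replacing \<open>h - e\<close> or \<open>h + e\<close> by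
  \<open>h\<close> in a denominator costs at most \<open>2 * g / h^2\<close>.\<close>

lemma two_sided_bound:
  assumes "real n < lam" "lam \<le> real n + g" "2 * g \<le> real a" "b \<le> n"
  shows "\<bar>two_sided n a b lam\<bar> \<le> \<bar>odd_sum n a b\<bar> + 2 * g * square_sum n a b"
proof -
  define e where "e = lam - real n"
  have e: "0 < e" "e \<le> g" using assms by (auto simp: e_def)
  have "\<bar>two_sided n a b lam - odd_sum n a b\<bar> \<le> (\<Sum>h\<in>{a<..b}. 2 * g * ((rr (n + h) + rr (n - h)) / (real h)\<^sup>2))"
    unfolding two_sided_def odd_sum_def sum_subtractf [symmetric]
  proof (intro order_trans [OF sum_abs] sum_mono)
    fix h assume h: "h \<in> {a<..b}"
    have hr: "real h > 2 * e" "real h > 0" using h e assms by (auto intro: order_le_less_trans [of _ "real a"])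
    have d: "real (n + h) - lam = real h - e" "real (n - h) - lam = - (real h + e)"
      using h assms by (auto simp: e_def of_nat_diff)
    have p: "\<bar>1 / (real h - e) - 1 / real h\<bar> \<le> 2 * g / (real h)\<^sup>2"
    proof -
      have "1 / (real h - e) - 1 / real h = e / ((real h - e) * real h)" using hr e by (simp add: field_simps)
      also have "\<dots> \<le> g / ((real h / 2) * real h)" using hr e by (intro frac_le mult_right_mono) auto
      also have "\<dots> = 2 * g / (real h)\<^sup>2" by (simp add: power2_eq_square)
      finally have "1 / (real h - e) - 1 / real h \<le> 2 * g / (real h)\<^sup>2" .
      moreover have "1 / (real h - e) - 1 / real h \<ge> 0" using hr e by (auto intro!: divide_left_mono)
      ultimately show ?thesis by simp
    qed
    have q: "\<bar>1 / real h - 1 / (real h + e)\<bar> \<le> 2 * g / (real h)\<^sup>2"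
    proof -
      have "1 / real h - 1 / (real h + e) = e / ((real h + e) * real h)" using hr e by (simp add: field_simps)
      also have "\<dots> \<le> g / ((real h / 2) * real h)" using hr e by (intro frac_le mult_right_mono) auto
      also have "\<dots> = 2 * g / (real h)\<^sup>2" by (simp add: power2_eq_square)
      finally have "1 / real h - 1 / (real h + e) \<le> 2 * g / (real h)\<^sup>2" .
      moreover have "1 / real h - 1 / (real h + e) \<ge> 0" using hr e by (auto intro!: divide_left_mono)
      ultimately show ?thesis by simp
    qed
    have "rr (n + h) / (real (n + h) - lam) + rr (n - h) / (real (n - h) - lam) - (rr (n + h) - rr (n - h)) / real h
      = rr (n + h) * (1 / (real h - e) - 1 / real h) + rr (n - h) * (1 / real h - 1 / (real h + e))"
      unfolding d minus_divide_right [symmetric] by (simp add: right_diff_distrib diff_divide_distrib)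
    also have "\<bar>\<dots>\<bar> \<le> rr (n + h) * (2 * g / (real h)\<^sup>2) + rr (n - h) * (2 * g / (real h)\<^sup>2)"
    proof (intro order_trans [OF abs_triangle_ineq] add_mono)
      show "\<bar>rr (n + h) * (1 / (real h - e) - 1 / real h)\<bar> \<le> rr (n + h) * (2 * g / (real h)\<^sup>2)"
        unfolding abs_mult abs_of_nat by (rule mult_left_mono [OF p]) simp
      show "\<bar>rr (n - h) * (1 / real h - 1 / (real h + e))\<bar> \<le> rr (n - h) * (2 * g / (real h)\<^sup>2)"
        unfolding abs_mult abs_of_nat by (rule mult_left_mono [OF q]) simp
    qed
    also have "\<dots> = 2 * g * ((rr (n + h) + rr (n - h)) / (real h)\<^sup>2)"
      by (simp add: distrib_left distrib_right add_divide_distrib mult_ac)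
    finally show "\<bar>rr (n + h) / (real (n + h) - lam) + rr (n - h) / (real (n - h) - lam) - (rr (n + h) - rr (n - h)) / real h\<bar>
      \<le> 2 * g * ((rr (n + h) + rr (n - h)) / (real h)\<^sup>2)" .
  qed
  also have "\<dots> = 2 * g * square_sum n a b" by (simp add: square_sum_def sum_distrib_left)
  finally show ?thesis by argo
qed

text \<open>In the eigenvalue equation the terms beyond \<open>P = n + n div 2\<close> add up to at
  most 256, and the unregularised terms below \<open>n - n div 2\<close> to at most 48. The
  regularisation over \<open>m <= P\<close> differs from the sum of \<open>r(m) / m\<close> by at
  most 48, and that sum is \<open>pi * ln P\<close> up to 40; this is where the logarithm comes
  from. Passing from \<open>P\<close> to \<open>lam\<close> costs 4.\<close>

lemma weak_centred_sum:
  assumes lam: "lam \<in> Lambda_weak \<phi>" "lam \<ge> 1" and n: "n \<ge> 16" "real n < lam" "lam \<le> real n + real n / 16"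
  shows "\<bar>centred_sum n (n div 2) lam - pi * ln lam\<bar>
    \<le> \<bar>tan (\<phi> / 2) * (\<Sum>k. rr (Suc k) / ((real (Suc k))\<^sup>2 + 1))\<bar> + 400"
proof -
  let ?u = "\<lambda>m. real m / ((real m)\<^sup>2 + 1)"
  define c where "c = tan (\<phi> / 2) * (\<Sum>k. rr (Suc k) / ((real (Suc k))\<^sup>2 + 1))"
  define h where "h = n div 2"
  define P where "P = n + h"
  have h: "real h \<ge> real n / 2 - 1/2" "real h \<ge> real n / 3" "h \<le> n" using n(1) by (auto simp: h_def)
  have Pn: "real P \<ge> 4 / 3 * lam" "real P \<le> 2 * lam" "lam \<le> real P" "P \<ge> 1"
    using n h by (auto simp: P_def)
  define f where "f = (\<lambda>k. regularized (Suc k) lam)"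
  have sm: "summable f" unfolding f_def by (rule summable_regularized [OF lam(2)])
  have c: "suminf f = c" using lam(1) by (simp add: Lambda_weak_def f_def regularized_def c_def)
  have split: "suminf f = (\<Sum>k. f (k + P)) + (\<Sum>k<P. f k)" by (rule suminf_split_initial_segment [OF sm])
  have tail: "0 \<le> (\<Sum>k. f (k + P))" "(\<Sum>k. f (k + P)) \<le> 256"
  proof -
    have smt: "summable (\<lambda>k. f (k + P))" using sm by (simp add: summable_iff_shift)
    have ft: "0 \<le> f (k + P)" "f (k + P) \<le> 8 * lam * (rr (Suc (k + P)) / (real (Suc (k + P)))\<^sup>2)" for k
      unfolding f_def using Pn lam(2) by (intro regularized_bound; simp)+
    show "0 \<le> (\<Sum>k. f (k + P))" by (rule suminf_nonneg [OF smt ft(1)])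
    show "(\<Sum>k. f (k + P)) \<le> 256"
    proof (rule suminf_le_const [OF smt])
      fix N
      have "(\<Sum>k<N. f (k + P)) \<le> (\<Sum>k<N. 8 * lam * (rr (Suc (k + P)) / (real (Suc (k + P)))\<^sup>2))"
        by (rule sum_mono) (rule ft)
      also have "\<dots> = 8 * lam * (\<Sum>m\<in>{P<..P + N}. rr m / (real m)\<^sup>2)"
        unfolding sum_distrib_left
        by (rule sum.reindex_bij_witness [of _ "\<lambda>m. m - Suc P" "\<lambda>k. Suc (k + P)"]) auto
      also have "\<dots> \<le> 8 * lam * (32 / real P)"
        using lam(2) by (intro mult_left_mono r2_square_tail Pn) auto
      also have "\<dots> \<le> 256" using Pn lam(2) by (simp add: divide_simps)
      finally show "(\<Sum>k<N. f (k + P)) \<le> 256" .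
    qed
  qed
  have initial: "(\<Sum>k<P. f k) = (\<Sum>m=1..P. rr m / (real m - lam)) - (\<Sum>m=1..P. rr m * ?u m)"
  proof -
    have "(\<Sum>k<P. f k) = (\<Sum>m=1..P. regularized m lam)"
      unfolding f_def by (rule sum.reindex_bij_witness [of _ "\<lambda>m. m - 1" Suc]) auto
    then show ?thesis by (simp add: regularized_def right_diff_distrib sum_subtractf)
  qed
  have near0: "(\<Sum>m=1..P. rr m / (real m - lam)) = (\<Sum>m\<in>{1..<n - h}. rr m / (real m - lam)) + centred_sum n h lam"
  proof -
    have "n - h \<ge> 1" using n(1) by (simp add: h_def)
    then have "{1..P} = {1..<n - h} \<union> {n - h..n + h}" "{1..<n - h} \<inter> {n - h..n + h} = {}" by (auto simp: P_def)
    then show ?thesis by (simp add: sum.union_disjoint centred_sum_def)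
  qed
  have low: "\<bar>\<Sum>m\<in>{1..<n - h}. rr m / (real m - lam)\<bar> \<le> 48"
  proof -
    have "\<bar>\<Sum>m\<in>{1..<n - h}. rr m / (real m - lam)\<bar> \<le> (\<Sum>m\<in>{1..<n - h}. rr m * (3 / real n))"
    proof (intro order_trans [OF sum_abs] sum_mono)
      fix m assume "m \<in> {1..<n - h}"
      then have "real m \<le> real n - real h" using h by auto
      then have d: "lam - real m \<ge> real n / 3" using h n by linarith
      have "\<bar>real m - lam\<bar> = lam - real m" using d n by simp
      then have "\<bar>rr m / (real m - lam)\<bar> = rr m / (lam - real m)" by simp
      also have "\<dots> \<le> rr m / (real n / 3)" using d n by (intro divide_left_mono mult_pos_pos) auto
      finally show "\<bar>rr m / (real m - lam)\<bar> \<le> rr m * (3 / real n)" by simp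
    qed
    also have "\<dots> = (\<Sum>m\<in>{1..<n - h}. rr m) * (3 / real n)" by (simp only: sum_distrib_right)
    also have "\<dots> \<le> r2_sum n * (3 / real n)"
      unfolding r2_sum_def by (intro mult_right_mono sum_mono2) auto
    also have "\<dots> \<le> (16 * real n) * (3 / real n)" by (intro mult_right_mono r2_sum_le) auto
    also have "\<dots> = 48" using n by simp
    finally show ?thesis .
  qed
  have reg: "\<bar>(\<Sum>m=1..P. rr m / real m) - (\<Sum>m=1..P. rr m * ?u m)\<bar> \<le> 48"
  proof -
    have "\<bar>(\<Sum>m=1..P. rr m / real m) - (\<Sum>m=1..P. rr m * ?u m)\<bar>
      \<le> (\<Sum>m=1..P. rr m / (real m)\<^sup>2)"
      unfolding sum_subtractf [symmetric]
    proof (intro order_trans [OF sum_abs] sum_mono)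
      fix m assume "m \<in> {1..P}"
      then have m: "real m \<ge> 1" by simp
      have "1 / real m - ?u m = 1 / (real m * ((real m)\<^sup>2 + 1))"
        using m by (simp add: diff_frac_eq add_nonneg_eq_0_iff power2_eq_square)
      moreover have "1 / (real m * ((real m)\<^sup>2 + 1)) \<le> 1 / (real m)\<^sup>2"
      proof (rule divide_left_mono)
        have "(real m)\<^sup>2 * 1 \<le> ((real m)\<^sup>2 + 1) * real m" using m by (intro mult_mono) auto
        then show "(real m)\<^sup>2 \<le> real m * ((real m)\<^sup>2 + 1)" by (simp add: mult.commute)
      qed (use m in \<open>auto intro!: mult_pos_pos add_pos_pos\<close>)
      moreover have "1 / (real m * ((real m)\<^sup>2 + 1)) \<ge> 0" by simp
      ultimately have "\<bar>1 / real m - ?u m\<bar> \<le> 1 / (real m)\<^sup>2" by linarith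
      then have "rr m * \<bar>1 / real m - ?u m\<bar> \<le> rr m * (1 / (real m)\<^sup>2)"
        by (rule mult_left_mono) simp
      moreover have "rr m / real m - rr m * ?u m
          = rr m * (1 / real m - ?u m)" by (simp add: right_diff_distrib)
      ultimately show "\<bar>rr m / real m - rr m * ?u m\<bar> \<le> rr m / (real m)\<^sup>2"
        by (simp only: abs_mult abs_of_nat) simp
    qed
    also have "\<dots> \<le> 48" by (rule r2_square_sum_le)
    finally show ?thesis .
  qed
  have harm: "\<bar>(\<Sum>m=1..P. rr m / real m) - pi * ln (real P)\<bar> \<le> 40" by (rule r2_harmonic_sum [OF Pn(4)])
  have lnP: "\<bar>pi * ln (real P) - pi * ln lam\<bar> \<le> 4"
  proof -
    have "ln (real P) \<le> ln (2 * lam)" using Pn lam(2) by (intro ln_mono) auto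
    also have "\<dots> = ln 2 + ln lam" using lam(2) by (simp add: ln_mult)
    also have "ln 2 \<le> (1::real)" using ln_le_minus_one [of 2] by simp
    finally have "ln (real P) - ln lam \<le> 1" by simp
    moreover have "ln lam \<le> ln (real P)" using Pn(3) lam(2) by (subst ln_le_cancel_iff) auto
    ultimately have d: "ln (real P) - ln lam \<le> 1" "0 \<le> ln (real P) - ln lam" by simp_all
    have "pi * (ln (real P) - ln lam) \<le> pi * 1" "pi * (ln (real P) - ln lam) \<ge> 0"
      using mult_left_mono [OF d(1), of pi] mult_nonneg_nonneg [OF _ d(2), of pi] by simp_all
    then show ?thesis using pi_less_4 by (simp add: right_diff_distrib)
  qed
  show ?thesis
    using tail initial near0 low reg harm lnP c split unfolding c_def [symmetric] h_def [symmetric] by argo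
qed

text \<open>The equation evaluates a window of radius \<open>sqrt lam\<close>, which is compared
  with one of radius \<open>h\<close> about \<open>n\<close>. Between the two windows every
  denominator is at least \<open>r\<close>, and by the circle problem \<open>r(m)\<close> has total
  mass of order \<open>r\<close>, so the difference is bounded. From \<open>h\<close> to
  \<open>n div 2\<close> the odd sum is bounded by the circle problem alone, and the regularisation
  over so short a window is bounded as well.\<close>

lemma strong_centred_sum:
  assumes lam: "lam \<in> Lambda_strong \<alpha>" "lam \<ge> 1"
    and n: "n \<ge> 100" "real n < lam" "lam \<le> real n + g" "g \<ge> 0" "2 * g \<le> sqrt (real n)"
    and sq: "2 * g * square_sum n a (n div 2) \<le> 2" "real a \<le> sqrt (real n)"
  shows "\<bar>centred_sum n (n div 2) lam - 1 / \<alpha>\<bar> \<le> 400"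
proof -
  let ?u = "\<lambda>m. real m / ((real m)\<^sup>2 + 1)"
  define r where "r = sqrt (real n)"
  have r: "r \<ge> 10" "r * r = real n" using n(1) real_le_rsqrt [of 10 "real n"] by (auto simp: r_def)
  have gr: "g \<le> r / 2" using n by (simp add: r_def)
  have rn: "10 * r \<le> real n" using r mult_right_mono [of 10 r r] by simp
  \<comment> \<open>The radius \<open>sqrt lam\<close> is at most \<open>2 * r\<close> and
    \<open>lam - n\<close> at most \<open>r / 2\<close>, so \<open>3 * r\<close> covers the window
    of the equation.\<close>
  define h where "h = nat \<lceil>3 * r\<rceil>"
  have h: "3 * r \<le> real h" "real h \<le> 3 * r + 1" using r unfolding h_def by linarith+
  have hn: "h \<le> n div 2"
  proof -
    have "2 * real h \<le> real n" using h r rn by linarith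
    then show ?thesis by linarith
  qed
  define w where "w = {m::nat. 1 \<le> m \<and> \<bar>real m - lam\<bar> \<le> sqrt lam}"
  have lam2: "lam \<le> 2 * real n" "lam \<ge> 100" using n gr r rn by linarith+
  have sl: "r \<le> sqrt lam" "sqrt lam \<le> 2 * r" "sqrt lam \<le> lam / 2"
  proof -
    show "r \<le> sqrt lam" unfolding r_def using n by simp
    have "sqrt lam \<le> sqrt (4 * real n)" using lam2 by simp
    also have "\<dots> = 2 * r" by (simp add: real_sqrt_mult r_def)
    finally show "sqrt lam \<le> 2 * r" .
    then show "sqrt lam \<le> lam / 2" using rn n r by linarith
  qed
  have wsub: "w \<subseteq> {n - h..n + h}"
  proof
    fix m assume "m \<in> w"
    then have "\<bar>real m - lam\<bar> \<le> 2 * r" using sl by (auto simp: w_def)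
    then have "\<bar>real m - real n\<bar> \<le> real h" using n gr h r by linarith
    then show "m \<in> {n - h..n + h}" by auto
  qed
  have fw: "finite w" using wsub by (rule finite_subset) simp
  have "(\<Sum>m\<in>w. regularized m lam) = 1 / \<alpha>"
    using lam(1) by (simp add: Lambda_strong_def regularized_def w_def)
  then have eq: "(\<Sum>m\<in>w. rr m / (real m - lam)) - (\<Sum>m\<in>w. rr m * ?u m) = 1 / \<alpha>"
    by (simp add: regularized_def right_diff_distrib sum_subtractf)
  have reg: "\<bar>\<Sum>m\<in>w. rr m * ?u m\<bar> \<le> 64"
  proof -
    have "(\<Sum>m\<in>w. rr m * ?u m) \<le> (\<Sum>m\<in>w. rr m * (2 / real n))"
    proof (intro sum_mono mult_left_mono)
      fix m assume m: "m \<in> w"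
      then have "real m \<ge> lam - sqrt lam" by (auto simp: w_def)
      then have m2: "real m \<ge> real n / 2" using sl n by linarith
      have "?u m \<le> real m / (real m)\<^sup>2" using m2 n by (intro frac_le) auto
      also have "\<dots> = 1 / real m" by (simp add: power2_eq_square)
      also have "\<dots> \<le> 1 / (real n / 2)" using m2 n by (intro divide_left_mono) auto
      finally show "?u m \<le> 2 / real n" by simp
    qed auto
    also have "\<dots> = (\<Sum>m\<in>w. rr m) * (2 / real n)" by (simp only: sum_distrib_right)
    also have "\<dots> \<le> r2_sum (2 * n) * (2 / real n)"
    proof (intro mult_right_mono)
      have "w \<subseteq> {1..2 * n}"
      proof
        fix m assume m: "m \<in> w"
        then have "m \<in> {n - h..n + h}" using wsub by blast
        then show "m \<in> {1..2 * n}" using m hn by (auto simp: w_def)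
      qed
      then show "(\<Sum>m\<in>w. rr m) \<le> r2_sum (2 * n)" unfolding r2_sum_def by (intro sum_mono2) auto
    qed auto
    also have "\<dots> \<le> (16 * real (2 * n)) * (2 / real n)" by (intro mult_right_mono r2_sum_le) auto
    also have "\<dots> = 64" using n by simp
    finally have "(\<Sum>m\<in>w. rr m * ?u m) \<le> 64" .
    moreover have "(\<Sum>m\<in>w. rr m * ?u m) \<ge> 0" by (intro sum_nonneg) auto
    ultimately show ?thesis by simp
  qed
  have window: "\<bar>centred_sum n h lam - (\<Sum>m\<in>w. rr m / (real m - lam))\<bar> \<le> 100"
  proof -
    have "centred_sum n h lam - (\<Sum>m\<in>w. rr m / (real m - lam)) = (\<Sum>m\<in>{n - h..n + h} - w. rr m / (real m - lam))"
      unfolding centred_sum_def by (rule sum_diff [OF _ wsub, symmetric]) simp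
    also have "\<bar>\<dots>\<bar> \<le> (\<Sum>m\<in>{n - h..n + h} - w. rr m * (1 / r))"
    proof (intro order_trans [OF sum_abs] sum_mono)
      fix m assume m: "m \<in> {n - h..n + h} - w"
      then have "1 \<le> m" using hn n by auto
      then have "\<bar>real m - lam\<bar> \<ge> r" using m sl by (auto simp: w_def)
      then have "rr m / \<bar>real m - lam\<bar> \<le> rr m / r" using r by (intro divide_left_mono) auto
      then show "\<bar>rr m / (real m - lam)\<bar> \<le> rr m * (1 / r)" by simp
    qed
    also have "\<dots> \<le> (\<Sum>m\<in>{n - h..n + h}. rr m * (1 / r))" using r by (intro sum_mono2) auto
    also have "\<dots> = (\<Sum>m\<in>{n - h - 1<..n + h}. rr m) * (1 / r)"
    proof -
      have "{n - h..n + h} = {n - h - 1<..n + h}" using hn n by auto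
      then show ?thesis by (simp only: sum_distrib_right)
    qed
    also have "(\<Sum>m\<in>{n - h - 1<..n + h}. rr m) = r2_sum (n + h) - r2_sum (n - h - 1)"
      by (rule r2_sum_interval) auto
    also have "(r2_sum (n + h) - r2_sum (n - h - 1)) * (1 / r) \<le> (100 * r) * (1 / r)"
    proof (intro mult_right_mono)
      have "sqrt (real (n + h)) \<le> sqrt (4 * real n)" "sqrt (real (n - h - 1)) \<le> sqrt (4 * real n)" using hn by auto
      then have "sqrt (real (n + h)) \<le> 2 * r" "sqrt (real (n - h - 1)) \<le> 2 * r" by (simp_all add: real_sqrt_mult r_def)
      moreover have "pi * real (n + h) - pi * real (n - h - 1) \<le> 4 * (7 * r)"
      proof -
        have "pi * real (n + h) - pi * real (n - h - 1) = pi * (2 * real h + 1)"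
          using hn n by (simp add: of_nat_diff algebra_simps)
        also have "\<dots> \<le> 4 * (7 * r)" using pi_less_4 h r by (intro mult_mono) auto
        finally show ?thesis .
      qed
      ultimately show "r2_sum (n + h) - r2_sum (n - h - 1) \<le> 100 * r"
        using circle_bound [of "n + h"] circle_bound [of "n - h - 1"] r by argo
    qed (use r in auto)
    also have "\<dots> = 100" using r by simp
    finally show ?thesis .
  qed
  have outer: "\<bar>two_sided n h (n div 2) lam\<bar> \<le> 74"
  proof -
    have "\<bar>two_sided n h (n div 2) lam\<bar> \<le> \<bar>odd_sum n h (n div 2)\<bar> + 2 * g * square_sum n h (n div 2)"
      using n gr h r by (intro two_sided_bound) auto
    moreover have "\<bar>odd_sum n h (n div 2)\<bar> \<le> 72"
    proof -
      have "\<bar>odd_sum n h (n div 2)\<bar> \<le> 72 * sqrt (real n) / (real h + 1)"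
        unfolding odd_sum_def using n hn by (intro r2_symmetric_sum) auto
      also have "\<dots> \<le> 72 * r / r" using h r unfolding r_def [symmetric] by (intro frac_le) auto
      finally show ?thesis using r by simp
    qed
    moreover have "2 * g * square_sum n h (n div 2) \<le> 2 * g * square_sum n a (n div 2)"
    proof (intro mult_left_mono square_sum_antimono)
      have "real a \<le> real h" using sq h r unfolding r_def [symmetric] by linarith
      then show "a \<le> h" by simp
    qed (use n in auto)
    ultimately show ?thesis using sq by linarith
  qed
  have "centred_sum n (n div 2) lam = centred_sum n h lam + two_sided n h (n div 2) lam"
    by (rule centred_sum_split [OF hn]) simp
  then show ?thesis using outer window reg eq by argo
qed

section \<open>The exceptional set\<close>

text \<open>Eigenvalues above bad integers inject into \<open>Bad\<close>. If
  \<open>lam > n + Y\<close> with \<open>n = below_sos lam\<close>, there is no sum of two squares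
  in the interval from \<open>n\<close> to \<open>n + Y\<close>. Such \<open>n\<close> are therefore
  more than \<open>Y\<close> apart, and the integer part of \<open>n / Y\<close> determines
  them.\<close>

lemma card_exceptional:
  fixes S :: "real set" and Bad :: "nat set"
  assumes S: "S \<subseteq> {1..x}" "S \<inter> sos_reals = {}" "inj_on below_sos S"
    and x: "x > 0" and Y: "Y \<ge> 1" and Bad: "finite Bad"
  defines "E \<equiv> {lam \<in> S. below_sos lam \<in> Bad \<or> lam > real (below_sos lam) + Y}"
  shows "finite E" "real (card E) \<le> real (card Bad) + (x / Y + 1)"
proof -
  let ?r = "\<lambda>a. real (below_sos a)"
  define E1 where "E1 = {lam \<in> S. below_sos lam \<in> Bad}"
  define E2 where "E2 = {lam \<in> S. lam > ?r lam + Y}"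
  have E: "E = E1 \<union> E2" by (auto simp: E_def E1_def E2_def)
  have sos: "lam \<ge> 1" "lam \<notin> sos_reals" "lam \<le> x" if "lam \<in> S" for lam using that S by auto
  have inj1: "inj_on below_sos E1" by (rule inj_on_subset [OF S(3)]) (auto simp: E1_def)
  have sub1: "below_sos ` E1 \<subseteq> Bad" by (auto simp: E1_def)
  have fin1: "finite E1" using finite_subset [OF sub1 Bad] inj1 by (rule finite_imageD)
  have card1: "card E1 \<le> card Bad"
    using card_mono [OF Bad sub1] card_image [OF inj1] by simp
  define f where "f = (\<lambda>lam. nat \<lfloor>?r lam / Y\<rfloor>)"
  have inj2: "inj_on f E2"
  proof (rule inj_onI)
    fix a b assume ab: "a \<in> E2" "b \<in> E2" "f a = f b"
    have key: False if "a \<in> E2" "b \<in> E2" "below_sos a < below_sos b" "f a = f b" for a b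
    proof -
      have "\<not> ?r b < a"
        using below_sos(5) [of a "below_sos b"] below_sos(2) [of b] sos that by (fastforce simp: E2_def)
      then have "?r a + Y < ?r b" using that by (auto simp: E2_def)
      then have "(?r a + Y) / Y < ?r b / Y" using Y by (intro divide_strict_right_mono) auto
      then have "?r a / Y + 1 < ?r b / Y" using Y by (simp add: add_divide_distrib)
      moreover have "?r a / Y \<ge> 0" using Y by simp
      ultimately have "f a < f b" unfolding f_def by linarith
      then show False using that by simp
    qed
    have "below_sos a = below_sos b" using key [of a b] key [of b a] ab by (metis linorder_neqE_nat)
    then show "a = b" using ab S(3) by (auto simp: E2_def inj_on_def)
  qed
  have sub2: "f ` E2 \<subseteq> {..nat \<lfloor>x / Y\<rfloor>}"
  proof
    fix m assume "m \<in> f ` E2"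
    then obtain lam where lam: "lam \<in> S" "m = f lam" by (auto simp: E2_def)
    have "?r lam \<le> x" using below_sos(4) sos [OF lam(1)] by (meson less_le_trans less_imp_le)
    then have "?r lam / Y \<le> x / Y" using Y by (intro divide_right_mono) auto
    then show "m \<in> {..nat \<lfloor>x / Y\<rfloor>}" unfolding lam(2) f_def by (auto intro!: nat_mono floor_mono)
  qed
  have fin2: "finite E2" using finite_subset [OF sub2] inj2 by (auto intro: finite_imageD)
  have "card E2 \<le> card {..nat \<lfloor>x / Y\<rfloor>}"
    using card_mono [OF _ sub2] card_image [OF inj2] by simp
  then have "real (card E2) \<le> real (nat \<lfloor>x / Y\<rfloor>) + 1" by simp
  moreover have "real (nat \<lfloor>x / Y\<rfloor>) \<le> x / Y" using x Y by simp
  ultimately have card2: "real (card E2) \<le> x / Y + 1" by linarith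
  show "finite E" using fin1 fin2 E by simp
  show "real (card E) \<le> real (card Bad) + (x / Y + 1)"
    using card_Un_le [of E1 E2] card1 card2 unfolding E by linarith
qed

lemma short_sum_eq_centred_sum:
  assumes "x > 0" "n = below_sos lam"
  shows "short_sum B x lam = centred_sum n (nat \<lfloor>real n * (ln x) powr B / x\<rfloor>) lam"
proof -
  define t where "t = real n * (ln x) powr B / x"
  have t: "t \<ge> 0" "real n / x * (ln x) powr B = t" using assms by (auto simp: t_def)
  have "{m::nat. \<bar>real m - real n\<bar> \<le> t} = {n - nat \<lfloor>t\<rfloor>..n + nat \<lfloor>t\<rfloor>}"
  proof (rule set_eqI)
    fix m
    have "\<bar>real m - real n\<bar> \<le> t \<longleftrightarrow> \<bar>int m - int n\<bar> \<le> \<lfloor>t\<rfloor>"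
    proof -
      have "\<bar>real m - real n\<bar> = of_int \<bar>int m - int n\<bar>" by simp
      then show ?thesis by (simp only: le_floor_iff)
    qed
    also have "\<dots> \<longleftrightarrow> m \<in> {n - nat \<lfloor>t\<rfloor>..n + nat \<lfloor>t\<rfloor>}" 
    proof -
      obtain L where "\<lfloor>t\<rfloor> = int L" using t(1) nonneg_int_cases [of "\<lfloor>t\<rfloor>"] by auto
      then show ?thesis by auto
    qed
    finally show "m \<in> {m. \<bar>real m - real n\<bar> \<le> t} \<longleftrightarrow> m \<in> {n - nat \<lfloor>t\<rfloor>..n + nat \<lfloor>t\<rfloor>}" by simp
  qed
  then show ?thesis
    unfolding short_sum_def Let_def assms(2) [symmetric] t(2) centred_sum_def t_def [symmetric] by (simp only:)
qed

lemma large_parameters: "\<exists>x0. \<forall>x\<ge>x0. x > 0 \<and> ln x \<ge> 10 \<and> 4 * (ln x) powr B \<le> sqrt x" for B :: real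
proof -
  have "\<forall>\<^sub>F x in at_top. x > 0 \<and> ln x \<ge> 10 \<and> 4 * (ln x) powr B \<le> sqrt x"
    by (intro eventually_conj; real_asymp)
  then show ?thesis by (simp add: eventually_at_top_linorder)
qed

text \<open>The part common to both quantizations: \<open>f\<close> is the expected value, and the
  hypothesis on it asks for the evaluation of the wide centred sum at eigenvalues close to
  \<open>n\<close>. The hypothesis is applied with \<open>g = Y\<close> and \<open>a\<close> the
  inner cut-off \<open>L\<close>. The removed outer part costs 77: 75 for the odd sum and 2 for the
  shift of the centre.\<close>

lemma exceptional_set_bound:
  fixes x B D :: real and k :: nat and f :: "real \<Rightarrow> real"
  assumes x: "x > 0" "ln x \<ge> 10" "4 * (ln x) powr B \<le> sqrt x" and B: "B \<ge> real (6 * k + 12)"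
    and S: "S \<subseteq> {1..x}" "S \<inter> sos_reals = {}" "inj_on below_sos S"
    and f: "\<And>lam n a g. lam \<in> S \<Longrightarrow> n = below_sos lam \<Longrightarrow> n \<ge> 100 \<Longrightarrow> real n < lam \<Longrightarrow> lam \<le> real n + g \<Longrightarrow>
       g \<ge> 0 \<Longrightarrow> 16 * g \<le> real n \<Longrightarrow> 2 * g \<le> sqrt (real n) \<Longrightarrow> 2 * g * square_sum n a (n div 2) \<le> 2 \<Longrightarrow>
       real a \<le> sqrt (real n) \<Longrightarrow> \<bar>centred_sum n (n div 2) lam - f lam\<bar> \<le> D"
  shows "\<exists>E. E \<subseteq> S \<and> finite E \<and> real (card E) \<le> 20000000000 * (x / (ln x) ^ k) \<and>
    (\<forall>lam\<in>S - E. \<bar>short_sum B x lam - f lam\<bar> \<le> D + 77)"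
proof -
  define l where "l = ln x"
  define s where "s = sqrt x"
  define Y where "Y = l ^ k"
  define K where "K = Y\<^sup>2 * l\<^sup>2"
  define Lam where "Lam = l powr B"
  have l: "l \<ge> 10" using x by (simp add: l_def)
  have Y: "Y \<ge> 1" unfolding Y_def using l by (intro one_le_power) simp
  have KL: "K\<^sup>2 * Y\<^sup>2 * l ^ 8 \<le> Lam"
  proof -
    have "K\<^sup>2 * Y\<^sup>2 * l ^ 8 = l ^ (6 * k + 12)"
    proof -
      have "l ^ (6 * k + 12) = Y ^ 6 * l ^ 12"
        using power_mult [of l k 6] by (simp add: Y_def power_add mult.commute)
      moreover have "K\<^sup>2 * Y\<^sup>2 * l ^ 8 = Y ^ 6 * l ^ 12" by (simp add: K_def eval_nat_numeral)
      ultimately show ?thesis by simp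
    qed
    also have "\<dots> = l powr real (6 * k + 12)" using l by (subst powr_realpow) auto
    also have "\<dots> \<le> Lam" unfolding Lam_def using l B by (intro powr_mono) auto
    finally show ?thesis .
  qed
  have Ls: "4 * Lam \<le> s" using x by (simp add: Lam_def l_def s_def)
  have xs: "x = s * s" and s0: "s > 0" using x(1) by (simp_all add: s_def)
  have K: "K \<ge> 100 * Y"
  proof -
    have "l\<^sup>2 \<ge> 100" using power_mono [of 10 l 2] l by simp
    moreover have "Y\<^sup>2 \<ge> Y" using Y self_le_power [of Y 2] by auto
    ultimately have "Y * 100 \<le> Y\<^sup>2 * l\<^sup>2" using Y by (intro mult_mono) auto
    then show ?thesis by (simp add: K_def)
  qed
  have LY: "10000 * (Y * Y) \<le> Lam"
  proof -
    have "(100 * Y) * (100 * Y) \<le> K * K" using K Y by (intro mult_mono) auto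
    also have "\<dots> = K\<^sup>2 * 1 * 1" by (simp add: power2_eq_square)
    also have "\<dots> \<le> K\<^sup>2 * Y\<^sup>2 * l ^ 8" using Y l by (intro mult_mono one_le_power) auto
    finally show ?thesis using KL by simp
  qed
  have YY: "Y * Y \<ge> Y" using Y by simp
  have Lam0: "Lam \<ge> 10000" using LY YY Y by linarith
  have sY: "s \<ge> 40000 * (Y * Y)" using LY Ls by simp
  obtain Bad where Bad: "finite Bad" "real (card Bad) \<le> 10000000000 * (x / Y)"
    "\<And>n::nat. 0 < n \<Longrightarrow> real n \<le> x \<Longrightarrow> n \<notin> Bad \<Longrightarrow>
      x / Y \<le> real n \<and> \<bar>odd_sum n (nat \<lfloor>real n * Lam / x\<rfloor>) (n div 2)\<bar> \<le> 75 \<and>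
      square_sum n (nat \<lfloor>real n * Lam / x\<rfloor>) (n div 2) \<le> 1 / Y"
    using generic_estimate [OF x(1) s_def l_def l Y K_def KL Ls] by blast
  define E where "E = {lam \<in> S. below_sos lam \<in> Bad \<or> lam > real (below_sos lam) + Y}"
  have xY: "x / Y \<ge> s" "x / Y \<ge> 40000 * (Y * Y)" "x / Y \<ge> 40000"
  proof -
    have "Y \<le> s" using sY YY Y by linarith
    then have "s * Y \<le> s * s" using s0 by (intro mult_left_mono) auto
    then show "x / Y \<ge> s" using Y xs by (simp add: pos_le_divide_eq)
    then show "x / Y \<ge> 40000 * (Y * Y)" using sY by linarith
    then show "x / Y \<ge> 40000" using YY Y by linarith
  qed
  have fin: "finite E" and "real (card E) \<le> real (card Bad) + (x / Y + 1)"
    unfolding E_def by (rule card_exceptional [OF S x(1) Y Bad(1)])+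
  then have card: "real (card E) \<le> 20000000000 * (x / Y)" using Bad(2) xY(3) by argo
  have "\<bar>short_sum B x lam - f lam\<bar> \<le> D + 77" if lam: "lam \<in> S - E" for lam
  proof -
    define n where "n = below_sos lam"
    define L where "L = nat \<lfloor>real n * Lam / x\<rfloor>"
    have lam1: "lam \<ge> 1" "lam \<notin> sos_reals" "lam \<le> x" using lam S by auto
    have n: "n \<ge> 1" "real n < lam" "n \<notin> Bad" "lam \<le> real n + Y"
      using below_sos(3,4) [OF lam1(1,2)] lam by (auto simp: n_def E_def)
    have nx: "real n \<le> x" using n lam1 by simp
    have good: "x / Y \<le> real n" "\<bar>odd_sum n L (n div 2)\<bar> \<le> 75" "square_sum n L (n div 2) \<le> 1 / Y"
      using Bad(3) [of n] n nx by (auto simp: L_def)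
    have nY: "real n \<ge> 40000 * (Y * Y)" "real n \<ge> 40000" using good xY by linarith+
    have sq: "2 * Y * square_sum n L (n div 2) \<le> 2"
    proof -
      have "2 * Y * square_sum n L (n div 2) \<le> 2 * Y * (1 / Y)" using good Y by (intro mult_left_mono) auto
      then show ?thesis using Y by simp
    qed
    have Lr: "real L \<le> real n * Lam / x" "real L \<ge> real n * Lam / x - 1"
    proof -
      have "real n * Lam / x \<ge> 0" using x(1) Lam0 by simp
      then show "real L \<le> real n * Lam / x" "real L \<ge> real n * Lam / x - 1" unfolding L_def by linarith+
    qed
    have LY2: "2 * Y \<le> real L"
    proof -
      have "10000 * Y \<le> Lam / Y" using LY Y by (simp add: pos_le_divide_eq)
      also have "Lam / Y = (x / Y) * Lam / x" using x(1) by simp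
      also have "\<dots> \<le> real n * Lam / x" using good(1) x(1) Lam0 by (intro divide_right_mono mult_right_mono) auto
      finally show ?thesis using Lr Y by linarith
    qed
    \<comment> \<open>The window is proportional to \<open>n\<close>, so it is compared with
      \<open>sqrt n\<close> and not only with \<open>sqrt x\<close>: \<open>n <= sqrt n * s\<close>
      and \<open>4 * Lam <= s\<close>.\<close>
    have Lsq: "real L \<le> sqrt (real n) / 4"
    proof -
      have "sqrt (real n) \<le> s" using nx by (simp add: s_def)
      then have "real n \<le> sqrt (real n) * s" using mult_left_mono [of "sqrt (real n)" s "sqrt (real n)"] by simp
      then have "real n * Lam / x \<le> (sqrt (real n) * s) * Lam / x" using x(1) Lam0 by (intro divide_right_mono mult_right_mono) auto
      also have "\<dots> = sqrt (real n) * (Lam / s)" using s0 by (simp add: xs)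
      also have "\<dots> \<le> sqrt (real n) * (1 / 4)" using Ls s0 by (intro mult_left_mono) (auto simp: pos_divide_le_eq)
      finally show ?thesis using Lr(1) by argo
    qed
    have Ln: "L \<le> n div 2"
    proof -
      have "real L \<le> real n / 4" using Lsq sqrt_of_nat_le [of n] by linarith
      then show ?thesis by linarith
    qed
    have Yn: "2 * Y \<le> sqrt (real n)" using LY2 Lsq by simp
    have c: "\<bar>centred_sum n (n div 2) lam - f lam\<bar> \<le> D"
    proof (rule f [where g = Y and a = L])
      show "16 * Y \<le> real n" using nY YY Y by linarith
      show "real L \<le> sqrt (real n)" using Lsq by simp
    qed (use lam n nY Y Yn sq in \<open>auto simp: n_def\<close>)
    have "\<bar>two_sided n L (n div 2) lam\<bar> \<le> \<bar>odd_sum n L (n div 2)\<bar> + 2 * Y * square_sum n L (n div 2)"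
      using n LY2 by (intro two_sided_bound) auto
    then have t: "\<bar>two_sided n L (n div 2) lam\<bar> \<le> 77" using good sq by linarith
    have "centred_sum n (n div 2) lam = centred_sum n L lam + two_sided n L (n div 2) lam"
      by (rule centred_sum_split [OF Ln]) simp
    moreover have "short_sum B x lam = centred_sum n L lam"
      using short_sum_eq_centred_sum [OF x(1) n_def, of B] by (simp add: L_def Lam_def l_def)
    ultimately show ?thesis using c t by linarith
  qed
  then show ?thesis using fin card unfolding Y_def l_def by (intro exI [of _ E]) (auto simp: E_def)
qed

theorem theorem3p1:
  fixes A :: real
  assumes "A \<ge> 1"
  shows "\<exists>B0. \<forall>B \<ge> B0.
    (\<forall>\<phi>. -pi < \<phi> \<and> \<phi> < pi \<longrightarrow>
       (\<exists>C x0. \<forall>x \<ge> x0. \<exists>E. E \<subseteq> Lambda_weak \<phi> \<inter> {1..x} \<and> finite E \<and>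
          real (card E) \<le> C * x / (ln x) powr A \<and>
          (\<forall>lam \<in> Lambda_weak \<phi> \<inter> {1..x} - E.
             \<bar>short_sum B x lam - pi * ln lam\<bar> \<le> C))) \<and>
    (\<forall>\<alpha>. \<alpha> \<noteq> 0 \<longrightarrow>
       (\<exists>C x0. \<forall>x \<ge> x0. \<exists>E. E \<subseteq> Lambda_strong \<alpha> \<inter> {1..x} \<and> finite E \<and>
          real (card E) \<le> C * x / (ln x) powr A \<and>
          (\<forall>lam \<in> Lambda_strong \<alpha> \<inter> {1..x} - E.
             \<bar>short_sum B x lam - 1 / \<alpha>\<bar> \<le> C)))"
proof -
  let ?P = "\<lambda>B T f. \<exists>C x0. \<forall>x \<ge> x0. \<exists>E. E \<subseteq> T \<inter> {1..x} \<and> finite E \<and>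
          real (card E) \<le> C * x / (ln x) powr A \<and>
          (\<forall>lam \<in> T \<inter> {1..x} - E. \<bar>short_sum B x lam - f lam\<bar> \<le> C)"
  \<comment> \<open>Rounding \<open>A\<close> up lets the saving \<open>Y\<close> be an integral
    power of the logarithm.\<close>
  define k where "k = nat \<lceil>A\<rceil>"
  have k: "A \<le> real k" unfolding k_def by linarith
  have conclude: "?P B T f"
    if B: "B \<ge> real (6 * k + 12)" and T: "T \<inter> sos_reals = {}" "inj_on below_sos (T \<inter> {1..})"
      and f: "\<And>lam n a g. lam \<in> T \<Longrightarrow> lam \<ge> 1 \<Longrightarrow> n = below_sos lam \<Longrightarrow> n \<ge> 100 \<Longrightarrow> real n < lam \<Longrightarrow> lam \<le> real n + g \<Longrightarrow>
       g \<ge> 0 \<Longrightarrow> 16 * g \<le> real n \<Longrightarrow> 2 * g \<le> sqrt (real n) \<Longrightarrow> 2 * g * square_sum n a (n div 2) \<le> 2 \<Longrightarrow>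
       real a \<le> sqrt (real n) \<Longrightarrow> \<bar>centred_sum n (n div 2) lam - f lam\<bar> \<le> D"
    for B D :: real and T :: "real set" and f :: "real \<Rightarrow> real"
  proof -
    obtain x0 where x0: "\<And>x. x \<ge> x0 \<Longrightarrow> x > 0 \<and> ln x \<ge> 10 \<and> 4 * (ln x) powr B \<le> sqrt x"
      using large_parameters [of B] by blast
    \<comment> \<open>One constant must bound both the size of the exceptional set and the error. In
      the weak case \<open>D\<close> depends on the phase through the right side of the eigenvalue
      equation.\<close>
    define C where "C = max 20000000000 (D + 77)"
    have "\<exists>E. E \<subseteq> T \<inter> {1..x} \<and> finite E \<and> real (card E) \<le> C * x / (ln x) powr A \<and>
          (\<forall>lam \<in> T \<inter> {1..x} - E. \<bar>short_sum B x lam - f lam\<bar> \<le> C)" if "x \<ge> x0" for x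
    proof -
      have x: "x > 0" "ln x \<ge> 10" "4 * (ln x) powr B \<le> sqrt x" using x0 [OF that] by auto
      have "\<exists>E. E \<subseteq> T \<inter> {1..x} \<and> finite E \<and> real (card E) \<le> 20000000000 * (x / (ln x) ^ k) \<and>
        (\<forall>lam\<in>T \<inter> {1..x} - E. \<bar>short_sum B x lam - f lam\<bar> \<le> D + 77)"
      proof (rule exceptional_set_bound [OF x B, where S = "T \<inter> {1..x}" and f = f and D = D])
        show "inj_on below_sos (T \<inter> {1..x})" by (rule inj_on_subset [OF T(2)]) auto
      qed (use T(1) f in auto)
      then obtain E where E: "E \<subseteq> T \<inter> {1..x}" "finite E" "real (card E) \<le> 20000000000 * (x / (ln x) ^ k)"
        "\<And>lam. lam \<in> T \<inter> {1..x} - E \<Longrightarrow> \<bar>short_sum B x lam - f lam\<bar> \<le> D + 77" by blast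
      have "0 < ln x" using x(2) by linarith
      then have x1: "1 < x" using x(1) by simp
      have "(ln x) powr A \<le> (ln x) powr real k" using x k by (intro powr_mono) auto
      also have "\<dots> = (ln x) ^ k" using x1 by (subst powr_realpow) auto
      finally have "x / (ln x) ^ k \<le> x / (ln x) powr A" using x x1 by (intro divide_left_mono) auto
      then have "20000000000 * (x / (ln x) ^ k) \<le> C * (x / (ln x) powr A)"
        using x x1 by (intro mult_mono) (auto simp: C_def)
      then have "real (card E) \<le> C * x / (ln x) powr A" using E(3) by simp
      moreover have "\<bar>short_sum B x lam - f lam\<bar> \<le> C" if "lam \<in> T \<inter> {1..x} - E" for lam
        using E(4) [OF that] by (simp add: C_def)
      ultimately show ?thesis using E(1,2) by blast
    qed
    then show ?thesis by blast
  qed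
  show ?thesis
  \<comment> \<open>The threshold comes from \<open>K^2 * Y^2 * l^8 = l ^ (6 * k + 12)\<close> and
    depends on \<open>A\<close> alone, neither on the phase nor on the coupling constant.\<close>
  proof (rule exI [of _ "real (6 * k + 12)"], intro allI impI conjI)
    fix B \<phi> :: real assume B: "B \<ge> real (6 * k + 12)"
    show "?P B (Lambda_weak \<phi>) (\<lambda>lam. pi * ln lam)"
    proof (rule conclude [OF B, where T = "Lambda_weak \<phi>" and f = "\<lambda>lam. pi * ln lam"])
      show "Lambda_weak \<phi> \<inter> sos_reals = {}" by (auto simp: Lambda_weak_def)
      show "inj_on below_sos (Lambda_weak \<phi> \<inter> {1..})" 
        by (rule inj_onI, rule Lambda_weak_unique) auto
    qed (rule weak_centred_sum; simp)
  next
    fix B \<alpha> :: real assume B: "B \<ge> real (6 * k + 12)" and \<alpha>: "\<alpha> \<noteq> 0"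
    show "?P B (Lambda_strong \<alpha>) (\<lambda>lam. 1 / \<alpha>)"
    proof (rule conclude [OF B, where T = "Lambda_strong \<alpha>" and f = "\<lambda>lam. 1 / \<alpha>"])
      show "Lambda_strong \<alpha> \<inter> sos_reals = {}" by (auto simp: Lambda_strong_def)
      show "inj_on below_sos (Lambda_strong \<alpha> \<inter> {1..})"
        by (rule inj_onI, rule Lambda_strong_unique [OF _ _ _ _ \<alpha>]) auto
    qed (rule strong_centred_sum; simp)
  qed
qed

end
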